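(* Let $d\in[1,+\infty]$. Let $(\varphi_{s,t})_{0\le s\le t<+\infty}$ be a family of holomorphic self-maps of the unit disc $\mathbb{D}$ having a common Denjoy-Wolff point $\tau\in\overline{\mathbb{D}}$ (each $\varphi_{s,t}$ which is not the identity has Denjoy-Wolff point $\tau$). Assume that $\varphi_{s,s}=\mathrm{id}_{\mathbb{D}}$ for all $s\ge0$, that $\varphi_{s,t}=\varphi_{u,t}\circ\varphi_{s,u}$ for all $0\le s\le u\le t<+\infty$, and that $\varphi_{0,t}'(\tau)\ne0$ for all $t\ge0$. Then the following are equivalent: (1) $(\varphi_{s,t})$ is an evolution family of order $d$. (2) The following properties are satisfied: (2.1) the map $[0,+\infty)\ni t\mapsto\mu(t):=\varphi_{0,t}'(\tau)$ is locally absolutely continuous and $\mu'\in L^d_{loc}([0,+\infty),\mathbb{C})$; (2.2) if $\tau\in\partial\mathbb{D}$, there exists a point $z_0\in\mathbb{D}$ such that for all $T>0$ there exists a non-negative function $k_{z_0,T}\in L^d([0,T],\mathbb{R})$ such that $$|\varphi_{s,u}(z_0)-\varphi_{s,t}(z_0)|\le\int_u^t k_{z_0,T}(\xi)\,d\xi$$ for all $0\le s\le u\le t\le T$.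
   Context: $\mathbb{D}=\{\zeta\in\mathbb{C}:|\zeta|<1\}$. Evolution family: for $d\in[1,+\infty]$, a family $(\varphi_{s,t})_{0\le s\le t<+\infty}$ of holomorphic self-maps of $\mathbb{D}$ is an evolution family of order $d$ if (EF1) $\varphi_{s,s}=\mathrm{id}_{\mathbb{D}}$ for all $s\ge 0$; (EF2) $\varphi_{s,t}=\varphi_{u,t}\circ\varphi_{s,u}$ for all $0\le s\le u\le t<+\infty$; (EF3) for all $z\in\mathbb{D}$ and all $T>0$ there is a non-negative $k_{z,T}\in L^d([0,T],\mathbb{R})$ with $|\varphi_{s,u}(z)-\varphi_{s,t}(z)|\le\int_u^t k_{z,T}(\xi)\,d\xi$ for all $0\le s\le u\le t\le T$. Denjoy-Wolff point of a non-identity holomorphic $f:\mathbb{D}\to\mathbb{D}$: the unique fixed point of $f$ in $\mathbb{D}$ if there is one; otherwise the unique $\tau\in\partial\mathbb{D}$ to which the iterates of $f$ converge uniformly on compact sets. If $\tau\in\mathbb{D}$, $f'(\tau)$ is the usual derivative; if $\tau\in\partial\mathbb{D}$, $f'(\tau)=\angle\lim_{z\to\tau}\frac{f(z)-\tau}{z-\tau}$ is the angular derivative at $\tau$ ($\angle\lim$ is the non-tangential limit; $\angle\lim_{z\to\tau}f(z)=\tau$ for the Denjoy-Wolff point, and the limit lies in $(0,1]$). *)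

theory Defs
  imports "HOL-Complex_Analysis.Complex_Analysis"
begin

abbreviation unit_disc :: "complex set" where
  "unit_disc \<equiv> ball 0 1"

definition Lp_on :: "ennreal \<Rightarrow> real set \<Rightarrow> (real \<Rightarrow> 'a :: euclidean_space) \<Rightarrow> bool" where
  "Lp_on d S f \<longleftrightarrow>
     set_borel_measurable lebesgue S f \<and>
     (if d = \<infinity> then \<exists>C. AE x\<in>S in lebesgue. norm (f x) \<le> C
      else set_integrable lebesgue S (\<lambda>x. norm (f x) powr enn2real d))"

definition Lp_loc_on :: "ennreal \<Rightarrow> real set \<Rightarrow> (real \<Rightarrow> 'a :: euclidean_space) \<Rightarrow> bool" where
  "Lp_loc_on d S f \<longleftrightarrow> (\<forall>K. compact K \<and> K \<subseteq> S \<longrightarrow> Lp_on d K f)"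

definition absolutely_continuous_fun_on ::
  "real set \<Rightarrow> (real \<Rightarrow> 'a :: real_normed_vector) \<Rightarrow> bool" where
  "absolutely_continuous_fun_on S f \<longleftrightarrow>
     (\<forall>\<epsilon>>0. \<exists>\<delta>>0. \<forall>(n::nat) l r.
        (\<forall>i<n. l i \<le> r i \<and> {l i..r i} \<subseteq> S) \<and>
        disjoint_family_on (\<lambda>i. {l i<..<r i}) {..<n} \<and>
        (\<Sum>i<n. r i - l i) < \<delta>
        \<longrightarrow> (\<Sum>i<n. norm (f (r i) - f (l i))) < \<epsilon>)"

definition locally_absolutely_continuous_on ::
  "real set \<Rightarrow> (real \<Rightarrow> 'a :: real_normed_vector) \<Rightarrow> bool" where
  "locally_absolutely_continuous_on S f \<longleftrightarrow>
     (\<forall>a b. {a..b} \<subseteq> S \<longrightarrow> absolutely_continuous_fun_on {a..b} f)"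

definition Lp_increments ::
  "ennreal \<Rightarrow> (real \<Rightarrow> real \<Rightarrow> complex \<Rightarrow> complex) \<Rightarrow> complex \<Rightarrow> bool" where
  "Lp_increments d \<phi> z \<longleftrightarrow>
     (\<forall>T>0. \<exists>k :: real \<Rightarrow> real.
        (\<forall>\<xi>\<in>{0..T}. 0 \<le> k \<xi>) \<and> Lp_on d {0..T} k \<and>
        (\<forall>s u t. 0 \<le> s \<and> s \<le> u \<and> u \<le> t \<and> t \<le> T \<longrightarrow>
           norm (\<phi> s u z - \<phi> s t z) \<le> (LINT \<xi>:{u..t}|lebesgue. k \<xi>)))"

definition holomorphic_self_map :: "(complex \<Rightarrow> complex) \<Rightarrow> bool" where
  "holomorphic_self_map f \<longleftrightarrow> f holomorphic_on unit_disc \<and> f ` unit_disc \<subseteq> unit_disc"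

text \<open>Only the values \<open>\<phi> s t z\<close> with \<open>0 \<le> s \<le> t\<close> and \<open>z\<close> in the disc are meaningful.\<close>

definition evolution_family ::
  "ennreal \<Rightarrow> (real \<Rightarrow> real \<Rightarrow> complex \<Rightarrow> complex) \<Rightarrow> bool" where
  "evolution_family d \<phi> \<longleftrightarrow>
     (\<forall>s t. 0 \<le> s \<and> s \<le> t \<longrightarrow> holomorphic_self_map (\<phi> s t)) \<and>
     (\<forall>s\<ge>0. \<forall>z\<in>unit_disc. \<phi> s s z = z) \<and>
     (\<forall>s u t. 0 \<le> s \<and> s \<le> u \<and> u \<le> t \<longrightarrow> (\<forall>z\<in>unit_disc. \<phi> s t z = \<phi> u t (\<phi> s u z))) \<and>
     (\<forall>z\<in>unit_disc. Lp_increments d \<phi> z)"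

text \<open>To be used only for holomorphic self-maps of the disc other than the identity.\<close>

definition is_Denjoy_Wolff_point :: "(complex \<Rightarrow> complex) \<Rightarrow> complex \<Rightarrow> bool" where
  "is_Denjoy_Wolff_point f \<tau> \<longleftrightarrow>
     (if \<exists>z\<in>unit_disc. f z = z
      then \<tau> \<in> unit_disc \<and> f \<tau> = \<tau> \<and> (\<forall>z\<in>unit_disc. f z = z \<longrightarrow> z = \<tau>)
      else \<tau> \<in> sphere 0 1 \<and>
        (\<forall>K. compact K \<and> K \<subseteq> unit_disc \<longrightarrow>
           uniform_limit K (\<lambda>n. f ^^ n) (\<lambda>_. \<tau>) sequentially))"

text \<open>Non-tangential approach to a boundary point \<open>\<tau>\<close> means approach within one of
  the Stolz regions below; \<open>M\<close> corresponds to the opening of an angular sector at \<open>\<tau>\<close>.\<close>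

definition stolz_region :: "complex \<Rightarrow> real \<Rightarrow> complex set" where
  "stolz_region \<tau> M = {z \<in> unit_disc. norm (z - \<tau>) < M * (1 - norm z)}"

definition has_angular_limit :: "(complex \<Rightarrow> complex) \<Rightarrow> complex \<Rightarrow> complex \<Rightarrow> bool" where
  "has_angular_limit g \<tau> L \<longleftrightarrow> (\<forall>M>1. (g \<longlongrightarrow> L) (at \<tau> within stolz_region \<tau> M))"

definition angular_deriv :: "(complex \<Rightarrow> complex) \<Rightarrow> complex \<Rightarrow> complex" where
  "angular_deriv f \<tau> = (THE L. has_angular_limit (\<lambda>z. (f z - \<tau>) / (z - \<tau>)) \<tau> L)"

text \<open>The derivative of a self-map at its Denjoy--Wolff point; in the boundary case the
  difference quotient uses that the angular limit of \<open>f\<close> at \<open>\<tau>\<close> is \<open>\<tau>\<close> itself.\<close>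

definition deriv_at_DW :: "(complex \<Rightarrow> complex) \<Rightarrow> complex \<Rightarrow> complex" where
  "deriv_at_DW f \<tau> = (if \<tau> \<in> unit_disc then deriv f \<tau> else angular_deriv f \<tau>)"

end

theory Submission
  imports Defs
begin

text \<open>Write \<open>\<lambda>\<close> for the multiplier of \<open>f = \<phi> u t\<close> at the common Denjoy--Wolff point \<open>\<tau>\<close>. The chain
rule gives \<open>\<mu> t = \<lambda> * \<mu> u\<close>, so increments of \<open>\<mu>\<close> measure \<open>\<bar>\<lambda> - 1\<bar>\<close>, while increments of an
orbit are displacements \<open>\<bar>f w - w\<bar>\<close> at the points \<open>w = \<phi> s u z\<close>. The theorem holds because
these two quantities control each other, with constants that are locally uniform in \<open>w\<close> away
from \<open>\<tau>\<close>.

If \<open>\<tau>\<close> is interior, conjugate by the Moebius automorphism that sends \<open>\<tau>\<close> to \<open>0\<close>. Schwarz's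
lemma turns \<open>f\<close> into \<open>y * g y\<close> with \<open>\<bar>g\<bar> \<le> 1\<close> and \<open>g 0 = \<lambda>\<close>, and \<open>q = 1 - g\<close> has nonnegative
real part. Harnack's inequality compares the values of \<open>q\<close> at any two points, hence the
displacement at one point with \<open>\<bar>1 - \<lambda>\<bar>\<close>: \<open>interior_derivative_le_displacement\<close> and
\<open>interior_displacement_le_derivative\<close>.

If \<open>\<tau>\<close> is on the circle, the Cayley transform moves \<open>\<tau>\<close> to infinity. The
Julia--Wolff--Caratheodory theorem (\<open>julia_wolff_caratheodory\<close>) shows that the transform of
\<open>f\<close> is \<open>c\<close> times the identity plus a function of nonnegative real part, with
\<open>c = 1 / \<lambda> \<ge> 1\<close>. Reading this at the origin bounds \<open>1 - \<lambda>\<close> by a multiple of \<open>\<bar>f 0\<bar>\<close>;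
comparing the second summand at two points by Harnack bounds the displacement at \<open>z\<close> by that
at \<open>z\<^sub>0\<close> plus \<open>c - 1\<close> (\<open>boundary_displacement_bound\<close>). The latter bound is uniform on
compact subsets of the disc only, and \<open>orbit_stays_in_compact\<close> confines the orbits to one.

What remains is real analysis: the increments of \<open>\<mu>\<close> are dominated by integrals of an \<open>L\<^sup>d\<close>
function on bounded intervals if and only if \<open>\<mu>\<close> is locally absolutely continuous with
derivative locally in \<open>L\<^sup>d\<close>. This rests on Lebesgue's theorem that an absolutely continuous
function is differentiable almost everywhere and is the integral of its derivative, which is
derived here from Vitali's covering theorem.\<close>

section \<open>Finite Vitali families and divisions of an interval\<close>

abbreviation total_length :: "real set set \<Rightarrow> real" where
  "total_length D \<equiv> (\<Sum>K\<in>D. Sup K - Inf K)"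

abbreviation total_increment :: "(real \<Rightarrow> real) \<Rightarrow> real set set \<Rightarrow> real" where
  "total_increment F D \<equiv> (\<Sum>K\<in>D. F (Sup K) - F (Inf K))"

abbreviation total_variation :: "(real \<Rightarrow> 'a::real_normed_vector) \<Rightarrow> real set set \<Rightarrow> real" where
  "total_variation F D \<equiv> (\<Sum>K\<in>D. norm (F (Sup K) - F (Inf K)))"

text \<open>A countable disjoint Vitali family exhausts \<open>E\<close> up to a null set, so by continuity of the
measure finitely many of its members lose less than \<open>\<eta>\<close>. The predicate \<open>P\<close> records the
property for which the intervals were admitted to the cover.\<close>

lemma vitali_intervals:
  fixes E U :: "real set" and P :: "real \<Rightarrow> real \<Rightarrow> bool"
  assumes E: "E \<in> lmeasurable" "E \<subseteq> U" and U: "open U" and \<eta>: "\<eta> > 0"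
    and fine: "\<And>x \<delta>. x \<in> E \<Longrightarrow> \<delta> > 0 \<Longrightarrow> \<exists>l r. l < x \<and> x < r \<and> r - l < \<delta> \<and> P l r"
  obtains D where "finite D" "pairwise disjnt D"
    "\<And>K. K \<in> D \<Longrightarrow> \<exists>l r. l < r \<and> K = {l..r} \<and> {l..r} \<subseteq> U \<and> P l r"
    "total_length D > measure lebesgue E - \<eta>"
proof -
  define A where "A = {(l,r). l < r \<and> {l..r} \<subseteq> U \<and> P l r}"
  define c where "c = (\<lambda>i::real\<times>real. (fst i + snd i) / 2)"
  define \<rho> where "\<rho> = (\<lambda>i::real\<times>real. (snd i - fst i) / 2)"
  have cb: "cball (c i) (\<rho> i) = {fst i..snd i}" for i
  proof -
    have "c i - \<rho> i = fst i" "c i + \<rho> i = snd i"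
      by (simp_all add: c_def \<rho>_def field_simps)
    then show ?thesis by (simp add: cball_eq_atLeastAtMost)
  qed
  have cover: "\<exists>i. i \<in> A \<and> x \<in> cball (c i) (\<rho> i) \<and> \<rho> i < d" if x: "x \<in> E" and d: "0 < d" for x d
  proof -
    obtain e where e: "e > 0" "cball x e \<subseteq> U"
      using U E x open_contains_cball by blast
    obtain l r where lr: "l < x" "x < r" "r - l < min d e" "P l r"
      using fine[OF x, of "min d e"] d e by auto
    have "{l..r} \<subseteq> cball x e" using lr by (auto simp: cball_eq_atLeastAtMost)
    then have "(l, r) \<in> A" using lr e by (auto simp: A_def)
    moreover have "x \<in> cball (c (l,r)) (\<rho> (l,r))" unfolding cb using lr by simp
    moreover have "\<rho> (l,r) < d" using lr by (simp add: \<rho>_def)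
    ultimately show ?thesis by blast
  qed
  obtain C where C: "countable C" "C \<subseteq> A"
    "pairwise (\<lambda>i j. disjnt (cball (c i) (\<rho> i)) (cball (c j) (\<rho> j))) C"
    "negligible (E - (\<Union>i\<in>C. cball (c i) (\<rho> i)))"
  proof (rule Vitali_covering_theorem_cballs[of A \<rho> E c])
    show "0 < \<rho> i" if "i \<in> A" for i using that by (auto simp: A_def \<rho>_def)
  qed (use cover in blast)+
  define V where "V = (\<lambda>F. \<Union>i\<in>F. {fst i..snd i::real})"
  have "\<exists>F. finite F \<and> F \<subseteq> C \<and> measure lebesgue (E \<inter> V F) > measure lebesgue E - \<eta>"
  proof (cases "C = {}")
    case True
    then have "negligible E" using C(4) by simp
    then show ?thesis using \<eta> by (intro exI[of _ "{}"]) (simp add: negligible_imp_measure0 V_def)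
  next
    case False
    define g where "g = from_nat_into C"
    have g: "range g = C" unfolding g_def using C(1) False by (simp add: range_from_nat_into)
    define W where "W = (\<lambda>n. E \<inter> V (g ` {..n::nat}))"
    have meas: "W n \<in> lmeasurable" for n
      unfolding W_def V_def by (intro fmeasurable_Int_fmeasurable E) auto
    have un: "(\<Union>n. W n) = E \<inter> V C" unfolding W_def V_def g[symmetric] by auto
    have lim: "(\<lambda>n. measure lebesgue (W n)) \<longlonglongrightarrow> measure lebesgue (\<Union>n. W n)"
    proof (rule Lim_measure_incseq)
      show "range W \<subseteq> sets lebesgue" using meas by auto
      show "incseq W" unfolding W_def V_def incseq_def
        by (intro allI impI Int_mono UN_mono image_mono) auto
      have "emeasure lebesgue (\<Union>n. W n) \<le> emeasure lebesgue E"
        by (rule emeasure_mono) (use E in \<open>auto simp: un\<close>)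
      then show "emeasure lebesgue (\<Union>n. W n) \<noteq> \<infinity>"
        using E(1) by (metis fmeasurableD2 infinity_ennreal_def top.extremum_unique)
    qed
    have "measure lebesgue (\<Union>n. W n) = measure lebesgue E"
      unfolding un
    proof (rule measure_negligible_symdiff)
      show "E \<in> lmeasurable" by fact
      have "E - E \<inter> V C \<union> (E \<inter> V C - E) = E - (\<Union>i\<in>C. cball (c i) (\<rho> i))"
        unfolding V_def cb by auto
      then show "negligible (E - E \<inter> V C \<union> (E \<inter> V C - E))" using C(4) by simp
    qed
    then have "(\<lambda>n. measure lebesgue (W n)) \<longlonglongrightarrow> measure lebesgue E" using lim by simp
    then have "eventually (\<lambda>n. measure lebesgue (W n) > measure lebesgue E - \<eta>) sequentially"
      by (rule order_tendstoD) (use \<eta> in simp)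
    then obtain n where "measure lebesgue (W n) > measure lebesgue E - \<eta>"
      by (auto simp: eventually_sequentially)
    then show ?thesis using g unfolding W_def by (intro exI[of _ "g ` {..n}"]) auto
  qed
  then obtain F where F: "finite F" "F \<subseteq> C" "measure lebesgue (E \<inter> V F) > measure lebesgue E - \<eta>" by blast
  define D where "D = (\<lambda>i. {fst i..snd i}) ` F"
  have fin: "finite D" using F by (simp add: D_def)
  have DA: "\<exists>l r. l < r \<and> K = {l..r} \<and> {l..r} \<subseteq> U \<and> P l r" if KD: "K \<in> D" for K
  proof -
    obtain i where "i \<in> F" "K = {fst i..snd i}" using KD unfolding D_def by blast
    moreover have "i \<in> A" using calculation F(2) C(2) by blast
    ultimately show ?thesis unfolding A_def by (auto simp: case_prod_beta)
  qed
  have dj: "pairwise disjnt D"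
    unfolding D_def pairwise_image
    by (rule pairwise_mono[OF C(3)[unfolded cb]]) (use F(2) in auto)
  have "measure lebesgue (E \<inter> V F) \<le> measure lebesgue (V F)"
  proof (rule measure_mono_fmeasurable)
    show "V F \<in> lmeasurable" using F(1) by (auto simp: V_def)
    then show "E \<inter> V F \<in> sets lebesgue" using E(1) by auto
  qed auto
  moreover have "V F = \<Union>D" by (simp add: V_def D_def)
  moreover have "measure lebesgue (\<Union>D) \<le> (\<Sum>K\<in>D. measure lebesgue K)"
    by (rule measure_Union_le) (use fin DA in fastforce)+
  moreover have "(\<Sum>K\<in>D. measure lebesgue K) = total_length D"
  proof (rule sum.cong)
    fix K assume "K \<in> D"
    then obtain l r where "l < r" "K = {l..r}" using DA by blast
    then show "measure lebesgue K = Sup K - Inf K" by simp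
  qed simp
  ultimately have "measure lebesgue E - \<eta> < total_length D" using F(3) by simp
  then show ?thesis using that[OF fin dj _] DA by blast
qed

text \<open>Below, families of nonoverlapping intervals are divisions, because these can be refined and
extended. Enumerating a finite division gives the indexed families of the definition.\<close>

lemma absolutely_continuous_divisionD:
  fixes F :: "real \<Rightarrow> 'a::real_normed_vector"
  assumes "absolutely_continuous_fun_on {a..b} F" "\<epsilon> > 0"
  obtains \<delta> where "\<delta> > 0"
    "\<And>D. D division_of \<Union>D \<Longrightarrow> \<Union>D \<subseteq> {a..b} \<Longrightarrow> total_length D < \<delta>
       \<Longrightarrow> total_variation F D < \<epsilon>"
proof -
  obtain \<delta> where \<delta>: "\<delta> > 0" and *: "\<forall>(n::nat) l r.
        (\<forall>i<n. l i \<le> r i \<and> {l i..r i} \<subseteq> {a..b}) \<and>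
        disjoint_family_on (\<lambda>i. {l i<..<r i}) {..<n} \<and>
        (\<Sum>i<n. r i - l i) < \<delta>
        \<longrightarrow> (\<Sum>i<n. norm (F (r i) - F (l i))) < \<epsilon>"
    using assms(1)[unfolded absolutely_continuous_fun_on_def, THEN spec, THEN mp, OF assms(2)] by blast
  show ?thesis
  proof (rule that[OF \<delta>])
    fix D assume D: "D division_of \<Union>D" "\<Union>D \<subseteq> {a..b}" and len: "total_length D < \<delta>"
    have fin: "finite D" using D by auto
    then obtain h where h: "bij_betw h {..<card D} D"
      by (metis atLeast0LessThan ex_bij_betw_nat_finite)
    have K: "K \<noteq> {} \<and> Inf K \<le> Sup K \<and> K = {Inf K..Sup K} \<and> interior K = {Inf K<..<Sup K}" if KD: "K \<in> D" for K
    proof -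
      obtain u v where uv: "K = {u..v}" using division_ofD(4)[OF D(1) KD] by auto
      have "K \<noteq> {}" using division_ofD(3)[OF D(1) KD] .
      then show ?thesis using uv by (auto simp: interior_atLeastAtMost_real)
    qed
    have hD: "i < card D \<Longrightarrow> h i \<in> D" for i using h bij_betwE by blast
    have "(\<Sum>i<card D. norm (F (Sup (h i)) - F (Inf (h i)))) < \<epsilon>"
    proof (rule *[THEN spec, THEN spec, THEN spec, THEN mp], intro conjI)
      show "\<forall>i<card D. Inf (h i) \<le> Sup (h i) \<and> {Inf (h i)..Sup (h i)} \<subseteq> {a..b}"
      proof (intro allI impI)
        fix i assume "i < card D"
        then have "h i \<in> D" by (rule hD)
        then show "Inf (h i) \<le> Sup (h i) \<and> {Inf (h i)..Sup (h i)} \<subseteq> {a..b}"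
          using K[of "h i"] D(2) by blast
      qed
      show "disjoint_family_on (\<lambda>i. {Inf (h i)<..<Sup (h i)}) {..<card D}"
        unfolding disjoint_family_on_def
      proof (intro ballI impI)
        fix i j assume ij: "i \<in> {..<card D}" "j \<in> {..<card D}" "i \<noteq> j"
        then have "h i \<noteq> h j" using h by (auto simp: bij_betw_def inj_on_def)
        then have "interior (h i) \<inter> interior (h j) = {}"
          using division_ofD(5)[OF D(1)] hD ij by auto
        then show "{Inf (h i)<..<Sup (h i)} \<inter> {Inf (h j)<..<Sup (h j)} = {}"
          using K hD ij by (metis lessThan_iff)
      qed
      show "(\<Sum>i<card D. Sup (h i) - Inf (h i)) < \<delta>"
        using len sum.reindex_bij_betw[OF h, of "\<lambda>K. Sup K - Inf K"] by simp
    qed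
    then show "total_variation F D < \<epsilon>"
      using sum.reindex_bij_betw[OF h, of "\<lambda>K. norm (F (Sup K) - F (Inf K))"] by simp
  qed
qed

lemma absolutely_continuous_dominated:
  fixes F :: "real \<Rightarrow> 'a::real_normed_vector" and G :: "real \<Rightarrow> 'b::real_normed_vector"
  assumes "absolutely_continuous_fun_on S F" "R \<subseteq> S" "\<And>u v. norm (G v - G u) \<le> norm (F v - F u)"
  shows "absolutely_continuous_fun_on R G"
  unfolding absolutely_continuous_fun_on_def
proof (intro allI impI)
  fix \<epsilon> :: real assume "\<epsilon> > 0"
  from assms(1)[unfolded absolutely_continuous_fun_on_def, THEN spec, THEN mp, OF this]
  obtain \<delta> where \<delta>: "\<delta> > 0" and *: "\<forall>(n::nat) l r.
        (\<forall>i<n. l i \<le> r i \<and> {l i..r i} \<subseteq> S) \<and>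
        disjoint_family_on (\<lambda>i. {l i<..<r i}) {..<n} \<and>
        (\<Sum>i<n. r i - l i) < \<delta>
        \<longrightarrow> (\<Sum>i<n. norm (F (r i) - F (l i))) < \<epsilon>" by blast
  show "\<exists>\<delta>>0. \<forall>(n::nat) l r.
        (\<forall>i<n. l i \<le> r i \<and> {l i..r i} \<subseteq> R) \<and>
        disjoint_family_on (\<lambda>i. {l i<..<r i}) {..<n} \<and>
        (\<Sum>i<n. r i - l i) < \<delta>
        \<longrightarrow> (\<Sum>i<n. norm (G (r i) - G (l i))) < \<epsilon>"
  proof (intro exI[of _ \<delta>] conjI allI impI \<delta>)
    fix n :: nat and l r :: "nat \<Rightarrow> real"
    assume A: "(\<forall>i<n. l i \<le> r i \<and> {l i..r i} \<subseteq> R) \<and>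
        disjoint_family_on (\<lambda>i. {l i<..<r i}) {..<n} \<and> (\<Sum>i<n. r i - l i) < \<delta>"
    have "(\<Sum>i<n. norm (G (r i) - G (l i))) \<le> (\<Sum>i<n. norm (F (r i) - F (l i)))"
      by (rule sum_mono) (rule assms(3))
    also have "\<dots> < \<epsilon>" using *[THEN spec, THEN spec, THEN spec, THEN mp] A assms(2) by blast
    finally show "(\<Sum>i<n. norm (G (r i) - G (l i))) < \<epsilon>" .
  qed
qed

lemma absolutely_continuous_imp_continuous_on:
  fixes F :: "real \<Rightarrow> 'a::real_normed_vector"
  assumes "absolutely_continuous_fun_on {a..b} F"
  shows "continuous_on {a..b} F"
  unfolding continuous_on_iff
proof (intro ballI allI impI)
  fix x and e :: real assume x: "x \<in> {a..b}" and e: "0 < e"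
  obtain \<delta> where \<delta>: "\<delta> > 0"
    "\<And>D. D division_of \<Union>D \<Longrightarrow> \<Union>D \<subseteq> {a..b} \<Longrightarrow> total_length D < \<delta>
       \<Longrightarrow> total_variation F D < e"
    using absolutely_continuous_divisionD[OF assms e] by blast
  have *: "norm (F v - F u) < e" if "a \<le> u" "u \<le> v" "v \<le> b" "v - u < \<delta>" for u v
  proof -
    have "{{u..v}} division_of \<Union>{{u..v}}"
      using division_of_self[of u v] that by simp
    then have "(\<Sum>K\<in>{{u..v}}. norm (F (Sup K) - F (Inf K))) < e"
      by (rule \<delta>(2)) (use that in auto)
    then show ?thesis using that by simp
  qed
  show "\<exists>d>0. \<forall>x'\<in>{a..b}. dist x' x < d \<longrightarrow> dist (F x') (F x) < e"
  proof (intro exI[of _ \<delta>] conjI ballI impI)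
    fix y assume y: "y \<in> {a..b}" "dist y x < \<delta>"
    show "dist (F y) (F x) < e"
      using *[of x y] *[of y x] x y by (cases "x \<le> y") (auto simp: dist_norm norm_minus_commute)
  qed (fact \<delta>(1))
qed

text \<open>The increments over \<open>D\<close> become the increments over \<open>J\<close> plus those over the pieces \<open>Q - J\<close>
that \<open>J\<close> leaves uncovered; absolute continuity is applied to the latter.\<close>

lemma division_extend_disjoint_intervals:
  fixes D J :: "real set set"
  assumes D: "finite D" "pairwise disjnt D" "\<And>K. K \<in> D \<Longrightarrow> \<exists>l r. l < r \<and> K = {l..r}"
    and J: "J division_of \<Union>J" "\<And>K. K \<in> J \<Longrightarrow> \<exists>I\<in>D. K \<subseteq> I"
  obtains Q where "J \<subseteq> Q" "Q division_of \<Union>Q" "\<Union>Q \<subseteq> \<Union>D"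
    "\<And>F::real \<Rightarrow> real. total_increment F Q = total_increment F D"
proof -
  have "\<exists>q. {K\<in>J. K \<subseteq> I} \<subseteq> q \<and> q division_of I" if I: "I \<in> D" for I
  proof -
    obtain l r where lr: "I = cbox l r" using D(3)[OF I] by auto
    have "{K\<in>J. K \<subseteq> I} division_of \<Union>{K\<in>J. K \<subseteq> I}"
      by (rule division_of_subset[OF J(1)]) auto
    moreover have "\<Union>{K\<in>J. K \<subseteq> I} \<subseteq> cbox l r" using lr by auto
    ultimately show ?thesis using partial_division_extend_interval lr by metis
  qed
  then obtain q where q: "\<And>I. I \<in> D \<Longrightarrow> {K\<in>J. K \<subseteq> I} \<subseteq> q I" "\<And>I. I \<in> D \<Longrightarrow> q I division_of I"
    by metis
  define Q where "Q = (\<Union>I\<in>D. q I)"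
  have sub: "K \<subseteq> I" "K \<noteq> {}" if "I \<in> D" "K \<in> q I" for I K
    using q(2)[OF that(1)] that(2) by (auto dest: division_ofD(2,3))
  have dis: "I1 \<inter> I2 = {}" if "I1 \<in> D" "I2 \<in> D" "I1 \<noteq> I2" for I1 I2
    using D(2) that by (auto simp: pairwise_def disjnt_def)
  show ?thesis
  proof
    show "J \<subseteq> Q" unfolding Q_def using J(2) q(1) by blast
    show "Q division_of \<Union>Q"
    proof (rule division_ofI)
      show "finite Q" unfolding Q_def using D(1) q(2) by (blast intro: division_ofD(1))
      show "K \<subseteq> \<Union>Q" if "K \<in> Q" for K using that by auto
      show "K \<noteq> {}" if "K \<in> Q" for K using that sub unfolding Q_def by blast
      show "\<exists>a b. K = cbox a b" if "K \<in> Q" for K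
        using that q(2) unfolding Q_def by (blast dest: division_ofD(4))
      show "interior K1 \<inter> interior K2 = {}" if KQ: "K1 \<in> Q" "K2 \<in> Q" "K1 \<noteq> K2" for K1 K2
      proof -
        obtain I1 I2 where I: "I1 \<in> D" "K1 \<in> q I1" "I2 \<in> D" "K2 \<in> q I2"
          using KQ unfolding Q_def by blast
        show ?thesis
        proof (cases "I1 = I2")
          case True then show ?thesis using I q(2) division_ofD(5) KQ(3) by metis
        next
          case False
          have "K1 \<inter> K2 = {}" using dis[OF I(1,3) False] sub(1)[OF I(1,2)] sub(1)[OF I(3,4)] by blast
          then show ?thesis using interior_subset by blast
        qed
      qed
    qed auto
    show "\<Union>Q \<subseteq> \<Union>D" unfolding Q_def using sub by blast
    fix F :: "real \<Rightarrow> real"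
    have "total_increment F Q = (\<Sum>I\<in>D. \<Sum>K\<in>q I. F (Sup K) - F (Inf K))"
      unfolding Q_def
    proof (rule sum.UNION_disjoint)
      show "\<forall>I\<in>D. finite (q I)" using q(2) by (blast intro: division_ofD(1))
      show "\<forall>i\<in>D. \<forall>j\<in>D. i \<noteq> j \<longrightarrow> q i \<inter> q j = {}"
      proof (intro ballI impI equals0I)
        fix i j K assume ij: "i \<in> D" "j \<in> D" "i \<noteq> j" and "K \<in> q i \<inter> q j"
        then have "K \<subseteq> i" "K \<subseteq> j" "K \<noteq> {}" using sub[of i K] sub[of j K] by auto
        then show False using dis[OF ij] by auto
      qed
    qed fact
    also have "\<dots> = total_increment F D"
    proof (rule sum.cong)
      fix I assume I: "I \<in> D"
      obtain l r where lr: "l < r" "I = {l..r}" using D(3)[OF I] by auto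
      have "(\<lambda>K. (Inf K, K)) ` q I tagged_division_of I"
      proof (rule tagged_division_ofI)
        show "finite ((\<lambda>K. (Inf K, K)) ` q I)" using q(2)[OF I] by auto
        fix x K assume "(x, K) \<in> (\<lambda>K. (Inf K, K)) ` q I"
        then have x: "x = Inf K" "K \<in> q I" by auto
        obtain u v where uv: "K = {u..v}" using division_ofD(4)[OF q(2)[OF I] x(2)] by auto
        show "x \<in> K" using x uv sub[OF I x(2)] by auto
        show "K \<subseteq> I" using sub[OF I x(2)] by auto
        show "\<exists>a b. K = cbox a b" using uv by auto
        fix x' K' assume "(x', K') \<in> (\<lambda>K. (Inf K, K)) ` q I" "(x, K) \<noteq> (x', K')"
        then show "interior K \<inter> interior K' = {}" using division_ofD(5)[OF q(2)[OF I]] x by auto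
      next
        have "{k. \<exists>x. (x, k) \<in> (\<lambda>K. (Inf K, K)) ` q I} = q I" by auto
        then show "\<Union>{k. \<exists>x. (x, k) \<in> (\<lambda>K. (Inf K, K)) ` q I} = I"
          using division_ofD(6)[OF q(2)[OF I]] by simp
      qed
      then have "(\<Sum>(x,K)\<in>(\<lambda>K. (Inf K, K)) ` q I. F (Sup K) - F (Inf K)) = F r - F l"
        using additive_tagged_division_1[of l r _ F] lr by simp
      moreover have "(\<Sum>(x,K)\<in>(\<lambda>K. (Inf K, K)) ` q I. F (Sup K) - F (Inf K)) = total_increment F (q I)"
        by (subst sum.reindex) (auto simp: inj_on_def)
      ultimately show "total_increment F (q I) = F (Sup I) - F (Inf I)"
        using lr by simp
    qed simp
    finally show "total_increment F Q = total_increment F D" .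
  qed
qed

section \<open>Absolutely continuous functions are differentiable almost everywhere\<close>

text \<open>Up to the choice between strict and weak inequality, the points of \<open>(a, b)\<close> at which the
upper derivate of \<open>F\<close> is at least \<open>p\<close>; replacing \<open>F\<close> by \<open>-F\<close> and \<open>p\<close> by \<open>-q\<close> gives the
points where the lower derivate is at most \<open>q\<close>. Slopes are taken over intervals with \<open>x\<close>
strictly inside, so that the points admitted by a given \<open>n\<close> form an open set and the whole
set is a \<open>G\<^sub>\<delta>\<close>.\<close>

definition steep_points :: "real \<Rightarrow> real \<Rightarrow> real \<Rightarrow> (real \<Rightarrow> real) \<Rightarrow> real set" where
  "steep_points a b p F =
     {x. \<forall>n::nat. \<exists>l r. a < l \<and> l < x \<and> x < r \<and> r < b \<and> r - l < 1 / real (Suc n) \<and> p * (r - l) < F r - F l}"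

lemma steep_points_lmeasurable: "steep_points a b p F \<in> lmeasurable"
proof -
  define W where "W = (\<lambda>n. \<Union>(l,r)\<in>{(l,r). a < l \<and> r < b \<and> r - l < 1 / real (Suc n) \<and> p * (r - l) < F r - F l}. {l<..<r})"
  have op: "open (W n)" for n unfolding W_def by auto
  have eq: "steep_points a b p F = (\<Inter>n. W n)"
  proof (rule set_eqI)
    fix x
    have "x \<in> W n \<longleftrightarrow> (\<exists>l r. a < l \<and> l < x \<and> x < r \<and> r < b \<and> r - l < 1 / real (Suc n) \<and> p * (r - l) < F r - F l)" for n
      unfolding W_def by auto
    then show "x \<in> steep_points a b p F \<longleftrightarrow> x \<in> (\<Inter>n. W n)"
      unfolding steep_points_def by simp
  qed
  have "steep_points a b p F \<in> sets lebesgue"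
    unfolding eq using op by (intro sets.countable_INT) auto
  moreover have "steep_points a b p F \<subseteq> {a..b}" unfolding steep_points_def by fastforce
  ultimately show ?thesis
    by (meson bounded_closed_interval bounded_set_imp_lmeasurable bounded_subset)
qed

lemma steep_points_fine:
  assumes "x \<in> steep_points a b p F" "\<delta> > 0"
  shows "\<exists>l r. l < x \<and> x < r \<and> r - l < \<delta> \<and> a < l \<and> r < b \<and> p * (r - l) < F r - F l"
proof -
  obtain n where n: "1 / real (Suc n) < \<delta>" using assms(2) nat_approx_posE by blast
  from assms(1) have "\<exists>l r. a < l \<and> l < x \<and> x < r \<and> r < b \<and> r - l < 1 / real (Suc n) \<and> p * (r - l) < F r - F l"
    unfolding steep_points_def by blast
  then show ?thesis using n by (meson less_trans)
qed

lemma disjoint_intervals_division: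
  fixes D :: "real set set"
  assumes "finite D" "pairwise disjnt D" "\<And>K. K \<in> D \<Longrightarrow> \<exists>l r. l < r \<and> K = {l..r}"
  shows "D division_of \<Union>D"
proof (rule division_ofI)
  fix K assume "K \<in> D"
  then obtain l r where "l < r" "K = {l..r}" using assms(3) by blast
  then show "K \<noteq> {}" "\<exists>a b. K = cbox a b" by auto
next
  fix K L assume "K \<in> D" "L \<in> D" "K \<noteq> L"
  then have "K \<inter> L = {}" using assms(2) by (auto simp: pairwise_def disjnt_def)
  then show "interior K \<inter> interior L = {}" using interior_subset by blast
qed (use assms in auto)

lemma sum_lengths_division:
  fixes D :: "real set set"
  assumes D: "D division_of \<Union>D"
  shows "total_length D = measure lebesgue (\<Union>K\<in>D. interior K)"
    and "\<And>U. U \<in> lmeasurable \<Longrightarrow> \<Union>D \<subseteq> U \<Longrightarrow> total_length D \<le> measure lebesgue U"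
proof -
  have K: "interior K = {Inf K<..<Sup K}" "Inf K \<le> Sup K" if KD: "K \<in> D" for K
  proof -
    obtain l r where "K = cbox l r" "K \<noteq> {}" using division_ofD(3)[OF D KD] division_ofD(4)[OF D KD] by blast
    then show "interior K = {Inf K<..<Sup K}" "Inf K \<le> Sup K" by (auto simp: interior_atLeastAtMost_real)
  qed
  have "measure lebesgue (\<Union>K\<in>D. interior K) = (\<Sum>K\<in>D. measure lebesgue (interior K))"
  proof (rule measure_UNION')
    show "pairwise (\<lambda>x y. disjnt (interior x) (interior y)) D"
      unfolding pairwise_def disjnt_def using division_ofD(5)[OF D] by blast
    show "interior K \<in> lmeasurable" if "K \<in> D" for K using K(1)[OF that] by simp
  qed (use D in auto)
  also have "\<dots> = total_length D"
    by (rule sum.cong) (use K in auto)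
  finally show *: "total_length D = measure lebesgue (\<Union>K\<in>D. interior K)" by simp
  fix U :: "real set" assume U: "U \<in> lmeasurable" "\<Union>D \<subseteq> U"
  show "total_length D \<le> measure lebesgue U"
    unfolding *
  proof (rule measure_mono_fmeasurable)
    show "(\<Union>K\<in>D. interior K) \<subseteq> U" using U(2) interior_subset by fastforce
    have "open (\<Union>K\<in>D. interior K)" by auto
    from borel_open[OF this] show "(\<Union>K\<in>D. interior K) \<in> sets lebesgue"
      by (rule sets_completionI_sets[of _ lborel, simplified])
  qed fact
qed

lemma outer_open_measure:
  fixes E :: "real set"
  assumes "E \<in> lmeasurable" "\<eta> > 0" "E \<subseteq> W" "open W" "bounded W"
  obtains U where "open U" "E \<subseteq> U" "U \<subseteq> W" "U \<in> lmeasurable" "measure lebesgue U < measure lebesgue E + \<eta>"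
proof -
  obtain T where T: "open T" "E \<subseteq> T" "T - E \<in> lmeasurable" "emeasure lebesgue (T - E) < ennreal \<eta>"
    using sets_lebesgue_outer_open[of E \<eta>] assms by auto
  have m: "measure lebesgue (T - E) < \<eta>"
    using T(3,4) assms(2) by (simp add: emeasure_eq_measure2 ennreal_less_iff)
  have W: "T \<inter> W \<in> lmeasurable" using T(1) assms(4,5) by (intro lmeasurable_open) auto
  have "measure lebesgue (T \<inter> W) \<le> measure lebesgue (E \<union> (T - E))"
    by (rule measure_mono_fmeasurable) (use W fmeasurable.Un[OF assms(1) T(3)] in auto)
  also have "\<dots> \<le> measure lebesgue E + measure lebesgue (T - E)"
    by (rule measure_Un_le) (use T assms in auto)
  also have "\<dots> < measure lebesgue E + \<eta>" using m by simp
  finally have "measure lebesgue (T \<inter> W) < measure lebesgue E + \<eta>" .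
  then show ?thesis using that[of "T \<inter> W"] T W assms by auto
qed

text \<open>Suppose the set had measure \<open>m > 0\<close>. Fill it up to a small error with disjoint intervals \<open>D\<close>
of slope above \<open>p\<close>, and then, inside \<open>D\<close>, with disjoint intervals \<open>J\<close> of slope below \<open>q\<close>.
Both families have total length close to \<open>m\<close>, so the pieces of \<open>D\<close> left uncovered by \<open>J\<close>
have tiny total length although they carry an increment of about \<open>(p - q) * m\<close>. Absolute
continuity forbids this. The argument works directly with \<open>F\<close>, without decomposing it into
monotone functions.\<close>

lemma steep_points_opposite_null:
  assumes AC: "absolutely_continuous_fun_on {a..b} F" and qp: "q < p"
  shows "negligible (steep_points a b p F \<inter> steep_points a b (-q) (\<lambda>x. - F x))"
    (is "negligible ?E")
proof (rule ccontr)
  assume neg: "\<not> negligible ?E"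
  define E where "E = ?E"
  have E: "E \<in> lmeasurable" unfolding E_def
    by (intro fmeasurable.Int steep_points_lmeasurable)
  define m where "m = measure lebesgue E"
  have m: "m > 0" using neg E negligible_iff_measure[of E] unfolding E_def[symmetric] m_def
    by (metis measure_nonneg less_eq_real_def)
  define \<epsilon> where "\<epsilon> = (p - q) * m / 2"
  have \<epsilon>: "\<epsilon> > 0" using m qp by (simp add: \<epsilon>_def)
  obtain \<delta> where \<delta>: "\<delta> > 0" "\<And>D. D division_of \<Union>D \<Longrightarrow> \<Union>D \<subseteq> {a..b} \<Longrightarrow> total_length D < \<delta>
       \<Longrightarrow> total_variation F D < \<epsilon>"
    using absolutely_continuous_divisionD[OF AC \<epsilon>] by blast
  \<comment> \<open>The number \<open>c * \<eta>\<close> collects the errors: the length of \<open>J\<close> falls short of \<open>m\<close> by at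
    most \<open>3 * \<eta>\<close>, and the lengths of \<open>D\<close> and \<open>J\<close> differ by at most \<open>4 * \<eta>\<close>.\<close>
  define c where "c = 3 * (p - q) + 4 * \<bar>p\<bar>"
  have c: "c > 0" using qp by (simp add: c_def add_pos_nonneg)
  define \<eta> where "\<eta> = min (\<delta> / 5) (\<epsilon> / c)"
  have \<eta>: "\<eta> > 0" "4 * \<eta> < \<delta>" using \<delta>(1) \<epsilon> c by (auto simp: \<eta>_def min_def)
  have "\<eta> \<le> \<epsilon> / c" by (simp add: \<eta>_def)
  then have \<eta>2: "c * \<eta> \<le> \<epsilon>" using c by (simp add: field_simps)
  have Eab: "E \<subseteq> {a<..<b}" unfolding E_def steep_points_def by fastforce
  obtain U where U: "open U" "E \<subseteq> U" "U \<subseteq> {a<..<b}" "U \<in> lmeasurable" "measure lebesgue U < m + \<eta>"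
    unfolding m_def by (rule outer_open_measure[OF E \<eta>(1) Eab]) auto
  have fineD: "\<exists>l r. l < x \<and> x < r \<and> r - l < \<delta> \<and> p * (r - l) < F r - F l"
    if "x \<in> E" "\<delta> > 0" for x \<delta>
    using steep_points_fine[of x a b p F \<delta>] that unfolding E_def by blast
  obtain D where D: "finite D" "pairwise disjnt D"
    and DP: "\<And>K. K \<in> D \<Longrightarrow> \<exists>l r. l < r \<and> K = {l..r} \<and> {l..r} \<subseteq> U \<and> p * (r - l) < F r - F l"
    and Dm: "total_length D > m - \<eta>"
    by (rule vitali_intervals[OF E U(2) U(1) \<eta>(1) fineD, folded m_def]) (assumption+, rule that)
  have Dint: "\<exists>l r. l < r \<and> K = {l..r}" if "K \<in> D" for K using DP[OF that] by blast
  have DU: "\<Union>D \<subseteq> U" by (rule Union_least) (use DP in blast)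
  have SD1: "total_length D = measure lebesgue (\<Union>K\<in>D. interior K)"
    by (rule sum_lengths_division(1)[OF disjoint_intervals_division[OF D Dint]])
  have SDU: "total_length D < m + \<eta>"
  proof -
    have "total_length D \<le> measure lebesgue U" using DU
      by (intro sum_lengths_division(2)[OF disjoint_intervals_division[OF D Dint]] U(4))
    then show ?thesis using U(5) by linarith
  qed
  define V where "V = (\<Union>K\<in>D. interior K)"
  have V: "open V" unfolding V_def by auto
  have VU: "V \<subseteq> U" unfolding V_def using DU interior_subset by blast
  have Vl: "V \<in> lmeasurable"
    by (rule fmeasurableI2[OF U(4) VU]) (use V in auto)
  have EV: "E \<inter> V \<in> lmeasurable" using E Vl by (rule fmeasurable.Int)
  have mEV: "measure lebesgue (E \<inter> V) > m - 2 * \<eta>"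
  proof -
    have "m \<le> measure lebesgue ((E \<inter> V) \<union> (U - V))" unfolding m_def
      by (rule measure_mono_fmeasurable) (use E EV U Vl in \<open>auto intro!: fmeasurable.Un fmeasurable.Diff\<close>)
    also have "\<dots> \<le> measure lebesgue (E \<inter> V) + measure lebesgue (U - V)"
      by (rule measure_Un_le) (use EV U Vl in auto)
    also have "measure lebesgue (U - V) = measure lebesgue U - measure lebesgue V"
      by (rule measurable_measure_Diff[OF U(4) _ VU]) (use Vl in auto)
    finally show ?thesis using SD1 Dm U(5) unfolding V_def[symmetric] by linarith
  qed
  \<comment> \<open>Each interval of \<open>J\<close> is chosen inside a single member of \<open>D\<close>, which makes \<open>J\<close> a
    refinement of part of \<open>D\<close>.\<close>
  have fineJ: "\<exists>l r. l < x \<and> x < r \<and> r - l < \<delta> \<and> ((\<exists>I\<in>D. {l..r} \<subseteq> I) \<and> F r - F l < q * (r - l))"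
    if x: "x \<in> E \<inter> V" "\<delta> > 0" for x \<delta>
  proof -
    obtain I where I: "I \<in> D" "x \<in> interior I" using x(1) unfolding V_def by blast
    then obtain e where e: "e > 0" "ball x e \<subseteq> I" unfolding mem_interior by blast
    obtain l r where lr: "l < x" "x < r" "r - l < min \<delta> e" "- q * (r - l) < - F r - - F l"
      using steep_points_fine[of x a b "- q" "\<lambda>x. - F x" "min \<delta> e"] x e x unfolding E_def by auto
    have "{l..r} \<subseteq> ball x e" using lr by (auto simp: dist_real_def)
    then show ?thesis
      using lr I e by (intro exI[of _ l] exI[of _ r]) auto
  qed
  obtain J where J: "finite J" "pairwise disjnt J"
    and JP: "\<And>K. K \<in> J \<Longrightarrow> \<exists>l r. l < r \<and> K = {l..r} \<and> {l..r} \<subseteq> V \<and> ((\<exists>I\<in>D. {l..r} \<subseteq> I) \<and> F r - F l < q * (r - l))"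
    and Jm0: "total_length J > measure lebesgue (E \<inter> V) - \<eta>"
    by (rule vitali_intervals[OF EV Int_lower2 V \<eta>(1) fineJ]) (assumption+, rule that)
  have Jint: "\<exists>l r. l < r \<and> K = {l..r}" if "K \<in> J" for K using JP[OF that] by blast
  have JD: "\<exists>I\<in>D. K \<subseteq> I" if "K \<in> J" for K using JP[OF that] by blast
  have Jm: "total_length J > m - 3 * \<eta>" using Jm0 mEV by linarith
  obtain Q where Q: "J \<subseteq> Q" "Q division_of \<Union>Q" "\<Union>Q \<subseteq> \<Union>D"
    and Qs: "\<And>F::real \<Rightarrow> real. total_increment F Q = total_increment F D"
    using division_extend_disjoint_intervals[OF D Dint disjoint_intervals_division[OF J Jint] JD] by metis
  define R where "R = Q - J"
  have finQ: "finite Q" using Q(2) by auto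
  have QJ: "(\<Sum>K\<in>Q. f K) = (\<Sum>K\<in>J. f K) + (\<Sum>K\<in>R. f K)" for f :: "real set \<Rightarrow> real"
    unfolding R_def using sum.subset_diff[OF Q(1) finQ, of f] by simp
  have "R division_of \<Union>R" by (rule division_of_subset[OF Q(2)]) (auto simp: R_def)
  moreover have "\<Union>R \<subseteq> {a..b}"
  proof -
    have "\<Union>R \<subseteq> \<Union>D" using Q(3) by (auto simp: R_def)
    also have "\<dots> \<subseteq> {a<..<b}" using DU U(3) by (rule subset_trans)
    also have "\<dots> \<subseteq> {a..b}" by auto
    finally show ?thesis .
  qed
  moreover have SR: "total_length R = total_length D - total_length J"
    using QJ[of "\<lambda>K. Sup K - Inf K"] Qs[of "\<lambda>x. x"] by simp
  moreover have "total_length D - total_length J < \<delta>"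
    using Jm SDU \<eta>(2) by linarith
  ultimately have "total_variation F R < \<epsilon>" using \<delta>(2)[of R] by simp
  moreover have "total_increment F R \<le> total_variation F R"
    by (rule sum_mono) simp
  ultimately have FR: "total_increment F R < \<epsilon>" by linarith
  have FD: "p * total_length D \<le> total_increment F D"
    unfolding sum_distrib_left
  proof (rule sum_mono)
    fix K assume "K \<in> D"
    from DP[OF this] obtain l r where "l < r" "K = {l..r}" "p * (r - l) < F r - F l" by blast
    then show "p * (Sup K - Inf K) \<le> F (Sup K) - F (Inf K)" by simp
  qed
  have FJ: "total_increment F J \<le> q * total_length J"
    unfolding sum_distrib_left
  proof (rule sum_mono)
    fix K assume "K \<in> J"
    from JP[OF this] obtain l r where "l < r" "K = {l..r}" "F r - F l < q * (r - l)" by blast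
    then show "F (Sup K) - F (Inf K) \<le> q * (Sup K - Inf K)" by simp
  qed
  have R0: "total_length R \<ge> 0"
  proof (rule sum_nonneg)
    fix K assume "K \<in> R"
    then have "K \<in> Q" by (simp add: R_def)
    then obtain u v where "K = cbox u v" "K \<noteq> {}"
      using division_ofD(3)[OF Q(2)] division_ofD(4)[OF Q(2)] by blast
    then show "0 \<le> Sup K - Inf K" by auto
  qed
  define SDl where "SDl = total_length D"
  define SJl where "SJl = total_length J"
  have "p * SDl < q * SJl + \<epsilon>"
    using FD FJ FR QJ[of "\<lambda>K. F (Sup K) - F (Inf K)"] Qs[of F] unfolding SDl_def SJl_def by linarith
  then have "(p - q) * SJl + p * (SDl - SJl) < \<epsilon>" by (simp add: algebra_simps)
  moreover have "(p - q) * (m - 3 * \<eta>) \<le> (p - q) * SJl"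
    using Jm qp unfolding SJl_def by (intro mult_left_mono) auto
  moreover have "- (\<bar>p\<bar> * (4 * \<eta>)) \<le> p * (SDl - SJl)"
  proof -
    have d: "0 \<le> SDl - SJl" "SDl - SJl \<le> 4 * \<eta>"
      using R0 SR Jm SDU unfolding SDl_def SJl_def by linarith+
    have "\<bar>p * (SDl - SJl)\<bar> \<le> \<bar>p\<bar> * (4 * \<eta>)"
      unfolding abs_mult using d by (intro mult_left_mono) auto
    then show ?thesis by linarith
  qed
  ultimately have "(p - q) * m < \<epsilon> + c * \<eta>"
    unfolding c_def by (simp add: algebra_simps)
  then show False using \<eta>2 unfolding \<epsilon>_def by simp
qed

text \<open>Near a point, disjoint intervals of total length below \<open>\<delta>\<close> carry an increment below \<open>1\<close>. If
they fill half of a set on which every slope \<open>N\<close> is reached, then \<open>N\<close> times half of its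
measure stays below \<open>1\<close> for every \<open>N\<close>, so the set is null.\<close>

lemma steep_points_all_null:
  assumes AC: "absolutely_continuous_fun_on {a..b} F"
  shows "negligible (\<Inter>n::nat. steep_points a b (real n) F)" (is "negligible ?S")
proof -
  obtain \<delta> where \<delta>: "\<delta> > 0" "\<And>D. D division_of \<Union>D \<Longrightarrow> \<Union>D \<subseteq> {a..b} \<Longrightarrow> total_length D < \<delta>
       \<Longrightarrow> total_variation F D < 1"
    using absolutely_continuous_divisionD[OF AC zero_less_one] by blast
  have Sl: "?S \<in> lmeasurable"
  proof (rule fmeasurableI2[OF steep_points_lmeasurable[of a b 0 F]])
    show "?S \<subseteq> steep_points a b 0 F" using INT_lower[of 0 UNIV "\<lambda>n::nat. steep_points a b (real n) F"] by simp
    show "?S \<in> sets lebesgue"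
      by (intro sets.countable_INT) (use steep_points_lmeasurable in \<open>auto intro!: fmeasurableD\<close>)
  qed
  have loc: "negligible (?S \<inter> ball y (\<delta>/3))" for y
  proof (rule ccontr)
    define E where "E = ?S \<inter> ball y (\<delta>/3)"
    assume "\<not> negligible (?S \<inter> ball y (\<delta>/3))"
    moreover have E: "E \<in> lmeasurable" unfolding E_def using Sl by (intro fmeasurable.Int) auto
    ultimately have m: "measure lebesgue E > 0" using negligible_iff_measure[of E]
      unfolding E_def[symmetric] by (metis measure_nonneg less_eq_real_def)
    obtain N :: nat where N: "real N > 2 / measure lebesgue E" using reals_Archimedean2 by blast
    define U where "U = ball y (\<delta>/3) \<inter> {a<..<b}"
    have U: "open U" "U \<in> lmeasurable" unfolding U_def by (auto intro!: fmeasurable.Int)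
    have "E \<subseteq> U" unfolding E_def U_def steep_points_def by fastforce
    have fineD: "\<exists>l r. l < x \<and> x < r \<and> r - l < \<delta> \<and> real N * (r - l) < F r - F l"
      if "x \<in> E" "\<delta> > 0" for x \<delta>
      using steep_points_fine[of x a b "real N" F \<delta>] that unfolding E_def by blast
    obtain D where D: "finite D" "pairwise disjnt D"
      and DP: "\<And>K. K \<in> D \<Longrightarrow> \<exists>l r. l < r \<and> K = {l..r} \<and> {l..r} \<subseteq> U \<and> real N * (r - l) < F r - F l"
      and Dm: "total_length D > measure lebesgue E - measure lebesgue E / 2"
      by (rule vitali_intervals[OF E \<open>E \<subseteq> U\<close> U(1) half_gt_zero[OF m] fineD]) (assumption+, rule that)
    have Dint: "\<exists>l r. l < r \<and> K = {l..r}" if "K \<in> D" for K using DP[OF that] by blast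
    have DU: "\<Union>D \<subseteq> U" by (rule Union_least) (use DP in blast)
    have "total_length D \<le> measure lebesgue U"
      by (rule sum_lengths_division(2)[OF disjoint_intervals_division[OF D Dint] U(2) DU])
    also have "\<dots> \<le> measure lebesgue (ball y (\<delta>/3))"
      by (rule measure_mono_fmeasurable) (use U in \<open>auto simp: U_def\<close>)
    also have "\<dots> < \<delta>" using \<delta>(1) by (simp add: ball_eq_greaterThanLessThan)
    finally have "total_variation F D < 1"
      by (intro \<delta>(2) disjoint_intervals_division[OF D Dint]) (use DU in \<open>auto simp: U_def\<close>)
    moreover have "real N * total_length D \<le> total_variation F D"
      unfolding sum_distrib_left
    proof (rule sum_mono)
      fix K assume "K \<in> D"
      from DP[OF this] obtain l r where "l < r" "K = {l..r}" "real N * (r - l) < F r - F l" by blast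
      then show "real N * (Sup K - Inf K) \<le> norm (F (Sup K) - F (Inf K))" by simp
    qed
    moreover have "1 < real N * total_length D"
    proof -
      have "1 = 2 / measure lebesgue E * (measure lebesgue E / 2)" using m by simp
      also have "\<dots> < real N * total_length D"
      proof (rule mult_strict_mono)
        show "0 < real N" using N m by (meson divide_pos_pos less_trans zero_less_numeral)
      qed (use N Dm m in auto)
      finally show ?thesis .
    qed
    ultimately show False by linarith
  qed
  show ?thesis
  proof (rule locally_negligible_alt[THEN iffD2], rule ballI)
    fix x assume x: "x \<in> ?S"
    have "openin (top_of_set ?S) (?S \<inter> ball x (\<delta>/3))" by (rule openin_open_Int) simp
    moreover have "x \<in> ?S \<inter> ball x (\<delta>/3)" using x \<delta>(1) by (intro IntI) auto
    ultimately show "\<exists>U. openin (top_of_set ?S) U \<and> x \<in> U \<and> negligible U"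
      using loc by blast
  qed
qed

lemma not_steep_pointD:
  assumes "x \<notin> steep_points a b p F" "a < x" "x < b"
  obtains \<delta> where "\<delta> > 0" "\<And>l r. l < x \<Longrightarrow> x < r \<Longrightarrow> r - l < \<delta> \<Longrightarrow> F r - F l \<le> p * (r - l)"
proof -
  obtain n :: nat where n: "\<not> (\<exists>l r. a < l \<and> l < x \<and> x < r \<and> r < b \<and> r - l < 1 / real (Suc n) \<and> p * (r - l) < F r - F l)"
    using assms(1) unfolding steep_points_def by blast
  define \<delta> where "\<delta> = min (1 / real (Suc n)) (min (x - a) (b - x))"
  show ?thesis
  proof (rule that[of \<delta>])
    show "\<delta> > 0" using assms by (simp add: \<delta>_def)
    fix l r assume "l < x" "x < r" "r - l < \<delta>"
    then have "a < l" "r < b" "r - l < 1 / real (Suc n)" unfolding \<delta>_def by linarith+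
    then show "F r - F l \<le> p * (r - l)" using n \<open>l < x\<close> \<open>x < r\<close> by (meson not_le)
  qed
qed

lemma steep_points_antimono:
  assumes "p \<le> p'" shows "steep_points a b p' F \<subseteq> steep_points a b p F"
proof
  fix x assume x: "x \<in> steep_points a b p' F"
  show "x \<in> steep_points a b p F"
    unfolding steep_points_def mem_Collect_eq
  proof
    fix n :: nat
    obtain l r where lr: "a < l" "l < x" "x < r" "r < b" "r - l < 1 / real (Suc n)" "p' * (r - l) < F r - F l"
      using x unfolding steep_points_def by blast
    moreover have "p * (r - l) \<le> p' * (r - l)" using assms lr by (intro mult_right_mono) auto
    ultimately show "\<exists>l r. a < l \<and> l < x \<and> x < r \<and> r < b \<and> r - l < 1 / real (Suc n) \<and> p * (r - l) < F r - F l"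
      by (intro exI[of _ l] exI[of _ r]) linarith
  qed
qed

text \<open>Letting one end of an interval around \<open>x\<close> tend to \<open>x\<close> turns two-sided slopes into difference
quotients at \<open>x\<close>, by continuity.\<close>

lemma two_sided_slopes_imp_derivative:
  fixes F :: "real \<Rightarrow> real"
  assumes cont: "isCont F x"
    and slopes: "\<And>\<epsilon>. \<epsilon> > 0 \<Longrightarrow> \<exists>\<delta>>0. \<forall>l r. l < x \<and> x < r \<and> r - l < \<delta> \<longrightarrow> \<bar>F r - F l - L * (r - l)\<bar> \<le> \<epsilon> * (r - l)"
  shows "(F has_real_derivative L) (at x)"
proof -
  have "((\<lambda>h. (F (x + h) - F x) / h) \<longlongrightarrow> L) (at 0)"
    unfolding LIM_eq
  proof (intro allI impI)
    fix e :: real assume e: "0 < e"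
    obtain \<delta> where \<delta>: "\<delta> > 0" "\<And>l r. l < x \<Longrightarrow> x < r \<Longrightarrow> r - l < \<delta> \<Longrightarrow> \<bar>F r - F l - L * (r - l)\<bar> \<le> e/2 * (r - l)"
      using slopes[of "e/2"] e by auto
    have right: "\<bar>F r - F x - L * (r - x)\<bar> \<le> e/2 * (r - x)" if r: "x < r" "r < x + \<delta>" for r
    proof (rule tendsto_le[of "at_left x"])
      have "(F \<longlongrightarrow> F x) (at_left x)" using cont by (simp add: isCont_def filterlim_at_split)
      then show "((\<lambda>l. \<bar>F r - F l - L * (r - l)\<bar>) \<longlongrightarrow> \<bar>F r - F x - L * (r - x)\<bar>) (at_left x)"
        by (intro tendsto_intros)
      show "((\<lambda>l. e/2 * (r - l)) \<longlongrightarrow> e/2 * (r - x)) (at_left x)" by (intro tendsto_intros)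
      have "\<forall>\<^sub>F l in at_left x. r - \<delta> < l \<and> l < x"
        using eventually_at_left_real[of "r - \<delta>" x] r by (auto elim: eventually_mono)
      then show "\<forall>\<^sub>F l in at_left x. \<bar>F r - F l - L * (r - l)\<bar> \<le> e/2 * (r - l)"
        by eventually_elim (use \<delta>(2) r in auto)
    qed simp
    have left: "\<bar>F x - F l - L * (x - l)\<bar> \<le> e/2 * (x - l)" if l: "l < x" "x - \<delta> < l" for l
    proof (rule tendsto_le[of "at_right x"])
      have "(F \<longlongrightarrow> F x) (at_right x)" using cont by (simp add: isCont_def filterlim_at_split)
      then show "((\<lambda>r. \<bar>F r - F l - L * (r - l)\<bar>) \<longlongrightarrow> \<bar>F x - F l - L * (x - l)\<bar>) (at_right x)"
        by (intro tendsto_intros)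
      show "((\<lambda>r. e/2 * (r - l)) \<longlongrightarrow> e/2 * (x - l)) (at_right x)" by (intro tendsto_intros)
      have "\<forall>\<^sub>F r in at_right x. x < r \<and> r < l + \<delta>"
        using eventually_at_right_real[of x "l + \<delta>"] l by (auto elim: eventually_mono)
      then show "\<forall>\<^sub>F r in at_right x. \<bar>F r - F l - L * (r - l)\<bar> \<le> e/2 * (r - l)"
        by eventually_elim (use \<delta>(2) l in auto)
    qed simp
    show "\<exists>s>0. \<forall>h. h \<noteq> 0 \<and> norm (h - 0) < s \<longrightarrow> norm ((F (x + h) - F x) / h - L) < e"
    proof (intro exI[of _ \<delta>] conjI allI impI)
      fix h :: real assume h: "h \<noteq> 0 \<and> norm (h - 0) < \<delta>"
      have *: "\<bar>F (x + h) - F x - L * h\<bar> \<le> e/2 * \<bar>h\<bar>"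
      proof (cases "h > 0")
        case True
        then show ?thesis using right[of "x + h"] h by simp
      next
        case False
        then have "\<bar>F x - F (x + h) - L * (- h)\<bar> \<le> e/2 * (- h)" using left[of "x + h"] h by simp
        then show ?thesis using False by (simp add: abs_if split: if_splits)
      qed
      have "(F (x + h) - F x) / h - L = (F (x + h) - F x - L * h) / h" using h by (simp add: field_simps)
      then have "norm ((F (x + h) - F x) / h - L) = \<bar>F (x + h) - F x - L * h\<bar> / \<bar>h\<bar>" by simp
      also have "\<dots> \<le> e/2" using * h by (simp add: divide_le_eq)
      also have "\<dots> < e" using e by simp
      finally show "norm ((F (x + h) - F x) / h - L) < e" .
    qed (rule \<delta>(1))
  qed
  then show ?thesis by (simp add: DERIV_def)
qed

text \<open>The derivative is the supremum \<open>L\<close> of the slopes \<open>p\<close> for which \<open>x\<close> is steep: slopes of short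
intervals stay below \<open>L + \<epsilon>\<close> by the choice of \<open>L\<close>, and above \<open>L - \<epsilon>\<close> because otherwise two
rationals between \<open>L - \<epsilon>\<close> and \<open>L\<close> would violate the separation hypothesis.\<close>

lemma differentiable_off_steep_points:
  fixes F :: "real \<Rightarrow> real"
  assumes x: "a < x" "x < b" and cont: "isCont F x"
    and sep: "\<And>p q. q \<in> \<rat> \<Longrightarrow> p \<in> \<rat> \<Longrightarrow> q < p \<Longrightarrow> x \<notin> steep_points a b p F \<inter> steep_points a b (-q) (\<lambda>x. - F x)"
    and up: "x \<notin> steep_points a b (real n) F" and dn: "x \<notin> steep_points a b (real m) (\<lambda>x. - F x)"
  shows "F differentiable (at x)"
proof -
  define S where "S = {p. x \<in> steep_points a b p F}"
  have mono: "p \<in> S" if "p' \<in> S" "p \<le> p'" for p p'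
    using that steep_points_antimono unfolding S_def by blast
  have bdd: "bdd_above S" using up mono unfolding S_def by (intro bdd_aboveI[of _ "real n"]) (metis linear mem_Collect_eq)
  have ne: "- real m - 1 \<in> S"
  proof (rule ccontr)
    assume "- real m - 1 \<notin> S"
    then have nin: "x \<notin> steep_points a b (- real m - 1) F" by (simp add: S_def)
    obtain \<delta>1 where 1: "\<delta>1 > 0" "\<And>l r. l < x \<Longrightarrow> x < r \<Longrightarrow> r - l < \<delta>1 \<Longrightarrow> F r - F l \<le> (- real m - 1) * (r - l)"
      using not_steep_pointD[OF nin x] by blast
    obtain \<delta>2 where 2: "\<delta>2 > 0" "\<And>l r. l < x \<Longrightarrow> x < r \<Longrightarrow> r - l < \<delta>2 \<Longrightarrow> - F r - - F l \<le> real m * (r - l)"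
      using not_steep_pointD[OF dn x] by blast
    define h where "h = min \<delta>1 \<delta>2 / 3"
    have h: "h > 0" "(x + h) - (x - h) < \<delta>1" "(x + h) - (x - h) < \<delta>2"
      using 1 2 by (auto simp: h_def min_def)
    have "F (x + h) - F (x - h) \<le> (- real m - 1) * (2 * h)" "- F (x + h) - - F (x - h) \<le> real m * (2 * h)"
      using 1(2)[of "x - h" "x + h"] 2(2)[of "x - h" "x + h"] h by (simp_all add: algebra_simps)
    then show False using h(1) by (simp add: algebra_simps)
  qed
  define L where "L = Sup S"
  have "(F has_real_derivative L) (at x)"
  proof (rule two_sided_slopes_imp_derivative[OF cont])
    fix \<epsilon> :: real assume \<epsilon>: "\<epsilon> > 0"
    have "L + \<epsilon> \<notin> S" using cSup_upper[OF _ bdd, of "L + \<epsilon>"] \<epsilon> unfolding L_def by auto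
    then have "x \<notin> steep_points a b (L + \<epsilon>) F" by (simp add: S_def)
    then obtain \<delta>1 where 1: "\<delta>1 > 0" "\<And>l r. l < x \<Longrightarrow> x < r \<Longrightarrow> r - l < \<delta>1 \<Longrightarrow> F r - F l \<le> (L + \<epsilon>) * (r - l)"
      using not_steep_pointD[OF _ x] by metis
    have "x \<notin> steep_points a b (- (L - \<epsilon>)) (\<lambda>x. - F x)"
    proof
      assume A: "x \<in> steep_points a b (- (L - \<epsilon>)) (\<lambda>x. - F x)"
      obtain q where q: "q \<in> \<rat>" "L - \<epsilon> < q" "q < L" using Rats_dense_in_real[of "L - \<epsilon>" L] \<epsilon> by auto
      obtain p where p: "p \<in> \<rat>" "q < p" "p < L" using Rats_dense_in_real[OF q(3)] by auto
      obtain s where "s \<in> S" "p < s" using less_cSupD[of S p] ne p(3) unfolding L_def by blast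
      then have "x \<in> steep_points a b p F" using mono[of s p] by (simp add: S_def)
      moreover have "x \<in> steep_points a b (- q) (\<lambda>x. - F x)"
        using A steep_points_antimono[of "- q" "- (L - \<epsilon>)"] q(2) by auto
      ultimately show False using sep[OF q(1) p(1,2)] by blast
    qed
    then obtain \<delta>2 where 2: "\<delta>2 > 0" "\<And>l r. l < x \<Longrightarrow> x < r \<Longrightarrow> r - l < \<delta>2 \<Longrightarrow> - F r - - F l \<le> - (L - \<epsilon>) * (r - l)"
      using not_steep_pointD[OF _ x] by metis
    show "\<exists>\<delta>>0. \<forall>l r. l < x \<and> x < r \<and> r - l < \<delta> \<longrightarrow> \<bar>F r - F l - L * (r - l)\<bar> \<le> \<epsilon> * (r - l)"
    proof (intro exI[of _ "min \<delta>1 \<delta>2"] conjI allI impI)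
      fix l r assume lr: "l < x \<and> x < r \<and> r - l < min \<delta>1 \<delta>2"
      have "F r - F l \<le> (L + \<epsilon>) * (r - l)" "- F r - - F l \<le> - (L - \<epsilon>) * (r - l)"
        using 1(2)[of l r] 2(2)[of l r] lr by auto
      then show "\<bar>F r - F l - L * (r - l)\<bar> \<le> \<epsilon> * (r - l)"
        by (simp add: algebra_simps abs_le_iff)
    qed (use 1 2 in auto)
  qed
  then show ?thesis by (simp add: real_differentiable_def)  (blast)
qed

lemma absolutely_continuous_ae_differentiable_real:
  fixes F :: "real \<Rightarrow> real"
  assumes AC: "absolutely_continuous_fun_on {a..b} F"
  obtains N where "negligible N" "\<And>x. x \<in> {a..b} \<Longrightarrow> x \<notin> N \<Longrightarrow> a < x \<and> x < b \<and> F differentiable (at x)"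
proof -
  have AC': "absolutely_continuous_fun_on {a..b} (\<lambda>x. - F x)"
    by (rule absolutely_continuous_dominated[OF AC order_refl]) simp
  define A where "A = {(q,p). q \<in> \<rat> \<and> p \<in> \<rat> \<and> q < (p::real)}"
  define M where "M = (\<lambda>(q,p). steep_points a b p F \<inter> steep_points a b (-q) (\<lambda>x. - F x))"
  define N where "N = {a, b} \<union> (\<Union>i\<in>A. M i) \<union> ((\<Inter>n::nat. steep_points a b (real n) F) \<union>
     (\<Inter>n::nat. steep_points a b (real n) (\<lambda>x. - F x)))"
  have "countable A"
    by (rule countable_subset[of _ "\<rat> \<times> \<rat>"]) (auto simp: A_def countable_rat)
  then have "negligible (\<Union>(M ` A))"
    by (intro negligible_countable_Union) (auto simp: A_def M_def intro!: steep_points_opposite_null[OF AC])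
  then have "negligible N"
    unfolding N_def by (intro negligible_Un steep_points_all_null AC AC') (simp_all add: negligible_finite)
  then show ?thesis
  proof (rule that)
    fix x assume x: "x \<in> {a..b}" "x \<notin> N"
    then have ab: "a < x" "x < b" by (auto simp: N_def)
    have "isCont F x"
      using absolutely_continuous_imp_continuous_on[OF AC] ab
      by (intro continuous_on_interior[of "{a..b}"]) (auto simp: interior_atLeastAtMost_real)
    moreover obtain n m where "x \<notin> steep_points a b (real n) F" "x \<notin> steep_points a b (real m) (\<lambda>x. - F x)"
      using x(2) unfolding N_def by auto
    ultimately have "F differentiable (at x)"
    proof (intro differentiable_off_steep_points[OF ab])
      fix p q :: real assume "q \<in> \<rat>" "p \<in> \<rat>" "q < p"
      then have "(q, p) \<in> A" by (simp add: A_def)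
      then have "x \<notin> M (q, p)" using x(2) unfolding N_def by blast
      then show "x \<notin> steep_points a b p F \<inter> steep_points a b (-q) (\<lambda>x. - F x)" by (simp add: M_def)
    qed
    then show "a < x \<and> x < b \<and> F differentiable (at x)" using ab by simp
  qed
qed

lemma absolutely_continuous_ae_differentiable:
  fixes F :: "real \<Rightarrow> complex"
  assumes AC: "absolutely_continuous_fun_on {a..b} F"
  obtains N where "negligible N"
    "\<And>x. x \<in> {a..b} \<Longrightarrow> x \<notin> N \<Longrightarrow> a < x \<and> x < b \<and> (F has_vector_derivative vector_derivative F (at x)) (at x)"
proof -
  have "absolutely_continuous_fun_on {a..b} (\<lambda>x. Re (F x))"
    by (rule absolutely_continuous_dominated[OF AC order_refl]) (metis abs_Re_le_cmod minus_complex.sel(1) real_norm_def)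
  then obtain N1 where N1: "negligible N1" "\<And>x. x \<in> {a..b} \<Longrightarrow> x \<notin> N1 \<Longrightarrow> a < x \<and> x < b \<and> (\<lambda>x. Re (F x)) differentiable (at x)"
    by (rule absolutely_continuous_ae_differentiable_real) blast
  have "absolutely_continuous_fun_on {a..b} (\<lambda>x. Im (F x))"
    by (rule absolutely_continuous_dominated[OF AC order_refl]) (metis abs_Im_le_cmod minus_complex.sel(2) real_norm_def)
  then obtain N2 where N2: "negligible N2" "\<And>x. x \<in> {a..b} \<Longrightarrow> x \<notin> N2 \<Longrightarrow> a < x \<and> x < b \<and> (\<lambda>x. Im (F x)) differentiable (at x)"
    by (rule absolutely_continuous_ae_differentiable_real) blast
  show ?thesis
  proof (rule that[of "N1 \<union> N2"])
    show "negligible (N1 \<union> N2)" using N1 N2 by (intro negligible_Un)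
    fix x assume x: "x \<in> {a..b}" "x \<notin> N1 \<union> N2"
    obtain u where u: "((\<lambda>x. Re (F x)) has_real_derivative u) (at x)"
      using N1(2)[of x] x by (auto simp: real_differentiable_def)
    obtain v where v: "((\<lambda>x. Im (F x)) has_real_derivative v) (at x)"
      using N2(2)[of x] x by (auto simp: real_differentiable_def)
    have "(F has_vector_derivative Complex u v) (at x)"
      using u v by (simp add: has_vector_derivative_complex_iff)
    then show "a < x \<and> x < b \<and> (F has_vector_derivative vector_derivative F (at x)) (at x)"
      using N1(2)[of x] x by (auto simp: vector_derivative_at)
  qed
qed

section \<open>The fundamental theorem of calculus for absolutely continuous functions\<close>

text \<open>In a fine Riemann sum, the intervals tagged outside \<open>N\<close> reproduce the increments of \<open>F\<close> by
differentiability. Those tagged in \<open>N\<close> lie in an open set of measure below \<open>\<delta>\<close>, so the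
increments of \<open>F\<close> over them are small by absolute continuity. Working with the
Henstock--Kurzweil integral yields measurability of \<open>f\<close> as a by-product.\<close>

lemma absolutely_continuous_ftc:
  fixes F :: "real \<Rightarrow> complex"
  assumes AC: "absolutely_continuous_fun_on {a..b} F" and ab: "a \<le> b" and N: "negligible N"
    and der: "\<And>x. x \<in> {a..b} \<Longrightarrow> x \<notin> N \<Longrightarrow> (F has_vector_derivative f x) (at x within {a..b})"
  shows "(f has_integral (F b - F a)) {a..b}"
proof -
  \<comment> \<open>With the value \<open>0\<close> on \<open>N\<close>, a term tagged in \<open>N\<close> contributes exactly the increment of
    \<open>F\<close> to the error.\<close>
  define g where "g = (\<lambda>x. if x \<in> N then 0 else f x)"
  have "(g has_integral (F b - F a)) {a..b}"
    unfolding has_integral_real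
  proof (intro allI impI)
    fix e :: real assume e: "e > 0"
    define e1 where "e1 = e / (2 * (b - a + 1))"
    have e1: "e1 > 0" "e1 * (b - a) < e / 2"
    proof -
      show "e1 > 0" using e ab by (simp add: e1_def)
      have "e1 * (b - a) < e1 * (b - a + 1)" using \<open>e1 > 0\<close> by simp
      also have "\<dots> = e / 2" using ab by (simp add: e1_def field_simps)
      finally show "e1 * (b - a) < e / 2" .
    qed
    obtain \<delta> where \<delta>: "\<delta> > 0" "\<And>D. D division_of \<Union>D \<Longrightarrow> \<Union>D \<subseteq> {a..b} \<Longrightarrow> total_length D < \<delta>
         \<Longrightarrow> total_variation F D < e / 2"
      using absolutely_continuous_divisionD[OF AC half_gt_zero[OF e]] by blast
    define N' where "N' = N \<inter> {a..b}"
    have N': "N' \<in> lmeasurable" "measure lebesgue N' = 0"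
      using negligible_Int[of N "{a..b}"] N unfolding N'_def
      by (auto simp: negligible_imp_measurable negligible_imp_measure0 negligible_subset)
    obtain U where U: "open U" "N' \<subseteq> U" "U \<in> lmeasurable" "measure lebesgue U < \<delta>"
    proof (rule outer_open_measure[OF N'(1) \<delta>(1), of "{a-1<..<b+1}"])
      show "N' \<subseteq> {a-1<..<b+1}" by (auto simp: N'_def)
    qed (use N'(2) in \<open>auto intro: that\<close>)
    have "\<exists>\<gamma>. \<gamma> > 0 \<and> (x \<in> N \<longrightarrow> ball x \<gamma> \<subseteq> U) \<and>
        (x \<notin> N \<longrightarrow> (\<forall>y\<in>{a..b}. \<bar>y - x\<bar> < \<gamma> \<longrightarrow> norm (F y - F x - (y - x) *\<^sub>R f x) \<le> e1 * \<bar>y - x\<bar>))"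
      if x: "x \<in> {a..b}" for x
    proof (cases "x \<in> N")
      case True
      then have "x \<in> U" using U x unfolding N'_def by auto
      then show ?thesis using U(1) True open_contains_ball by blast
    next
      case False
      from der[OF x False] obtain d where "d > 0"
        "\<forall>y\<in>{a..b}. norm (y - x) < d \<longrightarrow> norm (F y - F x - (y - x) *\<^sub>R f x) \<le> e1 * norm (y - x)"
        unfolding has_vector_derivative_def has_derivative_within_alt using e1(1) by blast
      then show ?thesis using False by (intro exI[of _ d]) auto
    qed
    then obtain \<gamma> where \<gamma>: "\<And>x. x \<in> {a..b} \<Longrightarrow> \<gamma> x > 0"
      "\<And>x. x \<in> {a..b} \<Longrightarrow> x \<in> N \<Longrightarrow> ball x (\<gamma> x) \<subseteq> U"
      "\<And>x y. x \<in> {a..b} \<Longrightarrow> x \<notin> N \<Longrightarrow> y \<in> {a..b} \<Longrightarrow> \<bar>y - x\<bar> < \<gamma> x \<Longrightarrow> norm (F y - F x - (y - x) *\<^sub>R f x) \<le> e1 * \<bar>y - x\<bar>"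
      by metis
    define G where "G = (\<lambda>x. if x \<in> {a..b} then ball x (\<gamma> x) else ball x 1)"
    show "\<exists>\<gamma>. gauge \<gamma> \<and> (\<forall>p. p tagged_division_of {a..b} \<and> \<gamma> fine p \<longrightarrow>
        norm ((\<Sum>(x, k)\<in>p. measure lborel k *\<^sub>R g x) - (F b - F a)) < e)"
    proof (intro exI[of _ G] conjI allI impI)
      show "gauge G" unfolding gauge_def G_def using \<gamma>(1) by auto
      fix p assume "p tagged_division_of {a..b} \<and> G fine p"
      then have p: "p tagged_division_of {a..b}" and fine: "G fine p" by auto
      note pD = tagged_division_ofD[OF p]
      define err where "err = (\<lambda>(x, K). norm (measure lborel K *\<^sub>R g x - (F (Sup K) - F (Inf K))))"
      have K: "x \<in> {a..b}" "\<exists>u v. K = {u..v} \<and> a \<le> u \<and> u \<le> x \<and> x \<le> v \<and> v \<le> b \<and> {u..v} \<subseteq> ball x (\<gamma> x)"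
        if xK: "(x, K) \<in> p" for x K
      proof -
        show x: "x \<in> {a..b}" using pD(2,3)[OF xK] by auto
        obtain u v where uv: "K = {u..v}" using pD(4)[OF xK] by auto
        have "u \<le> x" "x \<le> v" using pD(2)[OF xK] uv by auto
        moreover have "a \<le> u" "v \<le> b" using pD(3)[OF xK] uv calculation by auto
        moreover have "K \<subseteq> ball x (\<gamma> x)" using fineD[OF fine xK] x by (simp add: G_def)
        ultimately show "\<exists>u v. K = {u..v} \<and> a \<le> u \<and> u \<le> x \<and> x \<le> v \<and> v \<le> b \<and> {u..v} \<subseteq> ball x (\<gamma> x)"
          using uv by blast
      qed
      define p1 where "p1 = {(x,K)\<in>p. x \<notin> N}"
      define p2 where "p2 = {(x,K)\<in>p. x \<in> N}"
      have fin: "finite p1" "finite p2" unfolding p1_def p2_def by (rule finite_subset[OF _ pD(1)], blast)+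
      have pu: "p = p1 \<union> p2" "p1 \<inter> p2 = {}" unfolding p1_def p2_def by auto
      have e1b: "err i \<le> e1 * measure lborel (snd i)" if i: "i \<in> p1" for i
      proof -
        obtain x K where xK: "i = (x, K)" "(x, K) \<in> p" "x \<notin> N" using i by (auto simp: p1_def)
        obtain u v where uv: "K = {u..v}" "a \<le> u" "u \<le> x" "x \<le> v" "v \<le> b" "{u..v} \<subseteq> ball x (\<gamma> x)"
          using K(2)[OF xK(2)] by blast
        have uvb: "\<bar>u - x\<bar> < \<gamma> x" "\<bar>v - x\<bar> < \<gamma> x"
        proof -
          have "u \<in> ball x (\<gamma> x)" "v \<in> ball x (\<gamma> x)"
            by (rule subsetD[OF uv(6)], use uv(3,4) in simp)+
          then show "\<bar>u - x\<bar> < \<gamma> x" "\<bar>v - x\<bar> < \<gamma> x" by (simp_all add: dist_real_def abs_minus_commute)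
        qed
        have "norm (F u - F x - (u - x) *\<^sub>R f x) \<le> e1 * \<bar>u - x\<bar>" "norm (F v - F x - (v - x) *\<^sub>R f x) \<le> e1 * \<bar>v - x\<bar>"
          using \<gamma>(3)[OF K(1)[OF xK(2)] xK(3) _ uvb(1)] \<gamma>(3)[OF K(1)[OF xK(2)] xK(3) _ uvb(2)] uv by auto
        moreover have "measure lborel K *\<^sub>R g x - (F (Sup K) - F (Inf K)) =
           (F u - F x - (u - x) *\<^sub>R f x) - (F v - F x - (v - x) *\<^sub>R f x)"
          using uv xK(3) by (simp add: g_def algebra_simps)
        ultimately have "norm (measure lborel K *\<^sub>R g x - (F (Sup K) - F (Inf K))) \<le> e1 * \<bar>u - x\<bar> + e1 * \<bar>v - x\<bar>"
          using norm_triangle_ineq4[of "F u - F x - (u - x) *\<^sub>R f x" "F v - F x - (v - x) *\<^sub>R f x"] by simp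
        also have "\<dots> = e1 * measure lborel K" using uv by (simp add: algebra_simps)
        finally show ?thesis by (simp add: err_def xK(1))
      qed
      have s1: "(\<Sum>i\<in>p1. err i) \<le> e1 * (b - a)"
      proof -
        have "(\<Sum>i\<in>p1. err i) \<le> (\<Sum>i\<in>p1. e1 * measure lborel (snd i))" using e1b by (rule sum_mono)
        also have "\<dots> \<le> (\<Sum>i\<in>p. e1 * measure lborel (snd i))"
          by (rule sum_mono2) (use pD(1) pu e1 in auto)
        also have "\<dots> = e1 * (\<Sum>(x,K)\<in>p. measure lborel K)" by (simp add: sum_distrib_left case_prod_beta)
        also have "(\<Sum>(x,K)\<in>p. measure lborel K) = b - a"
          using additive_content_tagged_division[of p a b] p ab by simp
        finally show ?thesis .
      qed
      have p2p: "p2 tagged_partial_division_of {a..b}"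
        using p unfolding tagged_division_of_def
        by (elim conjE) (erule tagged_partial_division_subset, auto simp: p2_def)
      have s2: "(\<Sum>i\<in>p2. err i) < e / 2"
      proof -
        have "(\<Sum>i\<in>p2. err i) = (\<Sum>(x,K)\<in>p2. norm (F (Sup K) - F (Inf K)))"
        proof (rule sum.cong)
          fix i assume "i \<in> p2"
          then show "err i = (case i of (x, K) \<Rightarrow> norm (F (Sup K) - F (Inf K)))"
            by (auto simp: p2_def err_def g_def norm_minus_commute)
        qed simp
        also have "\<dots> = total_variation F (snd ` p2)"
        proof -
          have "norm (F (Sup (snd i)) - F (Inf (snd i))) = 0"
            if i: "i \<in> p2" "j \<in> p2" "i \<noteq> j" "snd i = snd j" for i j
          proof -
            obtain x y L where L: "i = (x, L)" "j = (y, L)" "(x, L) \<in> p" "(y, L) \<in> p" "x \<noteq> y"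
              using i by (cases i; cases j) (auto simp: p2_def)
            then have "interior L \<inter> interior L = {}" using pD(5)[of x L y L] by auto
            moreover obtain u v where "L = {u..v}" "u \<le> v" using K(2)[OF L(3)] by auto
            ultimately show ?thesis using L by (auto simp: interior_atLeastAtMost_real)
          qed
          then have "total_variation F (snd ` p2) = (\<Sum>i\<in>p2. norm (F (Sup (snd i)) - F (Inf (snd i))))"
            using sum.reindex_nontrivial[OF fin(2), of snd "\<lambda>K. norm (F (Sup K) - F (Inf K))"] by (simp add: o_def)
          then show ?thesis by (simp add: case_prod_beta)
        qed
        also have "\<dots> < e / 2"
        proof (rule \<delta>(2))
          show div: "snd ` p2 division_of \<Union>(snd ` p2)" by (rule partial_division_of_tagged_division[OF p2p])
          show "\<Union>(snd ` p2) \<subseteq> {a..b}"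
          proof (rule Union_least)
            fix K assume "K \<in> snd ` p2"
            then obtain x where x: "(x, K) \<in> p" by (auto simp: p2_def)
            then show "K \<subseteq> {a..b}" by (rule pD(3))
          qed
          have "\<Union>(snd ` p2) \<subseteq> U"
          proof (rule Union_least)
            fix K assume "K \<in> snd ` p2"
            then obtain x where x: "(x, K) \<in> p" "x \<in> N" by (auto simp: p2_def)
            obtain u v where "K = {u..v}" "{u..v} \<subseteq> ball x (\<gamma> x)" using K(2)[OF x(1)] by blast
            then show "K \<subseteq> U" using \<gamma>(2)[OF K(1)[OF x(1)] x(2)] by (metis order_trans)
          qed
          then have "total_length (snd ` p2) \<le> measure lebesgue U"
            by (rule sum_lengths_division(2)[OF div U(3)])
          then show "total_length (snd ` p2) < \<delta>" using U(4) by linarith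
        qed
        finally show ?thesis .
      qed
      have "(\<Sum>(x, k)\<in>p. measure lborel k *\<^sub>R g x) - (F b - F a) = (\<Sum>(x, K)\<in>p. measure lborel K *\<^sub>R g x - (F (Sup K) - F (Inf K)))"
        using additive_tagged_division_1[OF ab p, of F] by (simp add: sum_subtractf case_prod_beta)
      then have "norm ((\<Sum>(x, k)\<in>p. measure lborel k *\<^sub>R g x) - (F b - F a)) \<le> (\<Sum>i\<in>p. err i)"
        unfolding err_def by (simp add: case_prod_beta norm_sum)
      also have "\<dots> = (\<Sum>i\<in>p1. err i) + (\<Sum>i\<in>p2. err i)"
        unfolding pu(1) by (rule sum.union_disjoint[OF fin pu(2)])
      also have "\<dots> < e" using s1 s2 e1(2) by linarith
      finally show "norm ((\<Sum>(x, k)\<in>p. measure lborel k *\<^sub>R g x) - (F b - F a)) < e" .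
    qed
  qed
  then show ?thesis
    by (rule has_integral_spike[OF N, rotated]) (simp add: g_def)
qed

section \<open>Functions whose increments are dominated by integrals\<close>

lemma set_integral_const_lmeasurable:
  fixes c :: real and A :: "real set"
  assumes "A \<in> lmeasurable"
  shows "set_integrable lebesgue A (\<lambda>_. c)" "(LINT x:A|lebesgue. c) = c * measure lebesgue A"
proof -
  note * = lmeasurable_iff_integrable[THEN iffD1, OF assms]
  show "set_integrable lebesgue A (\<lambda>_. c)"
    unfolding set_integrable_def using * by simp
  show "(LINT x:A|lebesgue. c) = c * measure lebesgue A"
    unfolding set_lebesgue_integral_def using * by simp
qed

text \<open>Truncating \<open>k\<close> at a large height \<open>n\<close> costs at most \<open>\<epsilon>/2\<close> on all of \<open>S\<close>, and the truncated
part contributes at most \<open>n\<close> times the measure of \<open>A\<close>.\<close>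

lemma set_integral_uniformly_small:
  fixes k :: "real \<Rightarrow> real"
  assumes k: "set_integrable lebesgue S k" and pos: "\<And>x. x \<in> S \<Longrightarrow> 0 \<le> k x" and \<epsilon>: "\<epsilon> > 0"
  obtains \<delta> where "\<delta> > 0"
    "\<And>A. A \<in> lmeasurable \<Longrightarrow> A \<subseteq> S \<Longrightarrow> measure lebesgue A < \<delta> \<Longrightarrow> (LINT x:A|lebesgue. k x) < \<epsilon>"
proof -
  define h where "h = (\<lambda>x. indicator S x *\<^sub>R k x)"
  have h: "integrable lebesgue h" using k unfolding set_integrable_def h_def .
  have h0: "h x \<ge> 0" for x using pos by (auto simp: h_def indicator_def)
  have "(\<lambda>n. LINT x|lebesgue. min (h x) (real n)) \<longlonglongrightarrow> (LINT x|lebesgue. h x)"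
  proof (rule integral_dominated_convergence[where w = h])
    show "h \<in> borel_measurable lebesgue" using h by simp
    then show "(\<lambda>x. min (h x) (real n)) \<in> borel_measurable lebesgue" for n by simp
    show "AE x in lebesgue. (\<lambda>n. min (h x) (real n)) \<longlonglongrightarrow> h x"
    proof (rule AE_I2)
      fix x
      obtain n0 :: nat where "h x \<le> real n0" using real_arch_simple by blast
      then have "eventually (\<lambda>n. min (h x) (real n) = h x) sequentially"
        by (intro eventually_sequentiallyI[of n0]) auto
      then show "(\<lambda>n. min (h x) (real n)) \<longlonglongrightarrow> h x" by (rule tendsto_eventually)
    qed
    show "AE x in lebesgue. norm (min (h x) (real n)) \<le> h x" for n
      using h0 by (intro AE_I2) (simp add: min_def)
  qed (fact h)
  then have "eventually (\<lambda>n. (LINT x|lebesgue. min (h x) (real n)) > (LINT x|lebesgue. h x) - \<epsilon>/2) sequentially"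
    by (rule order_tendstoD) (use \<epsilon> in simp)
  then obtain n where n: "(LINT x|lebesgue. min (h x) (real n)) > (LINT x|lebesgue. h x) - \<epsilon>/2"
    by (auto simp: eventually_sequentially)
  have hn: "integrable lebesgue (\<lambda>x. min (h x) (real n))"
    by (rule Bochner_Integration.integrable_bound[OF h]) (use h h0 in \<open>auto intro!: AE_I2 simp: min_def\<close>)
  show ?thesis
  proof (rule that[of "\<epsilon> / (2 * (real n + 1))"])
    show "\<epsilon> / (2 * (real n + 1)) > 0" using \<epsilon> by simp
    fix A :: "real set" assume A: "A \<in> lmeasurable" "A \<subseteq> S" "measure lebesgue A < \<epsilon> / (2 * (real n + 1))"
    have iA: "integrable lebesgue (indicator A :: real \<Rightarrow> real)"
      by (rule lmeasurable_iff_integrable[THEN iffD1, OF A(1)])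
    have "(LINT x:A|lebesgue. k x) \<le> (LINT x|lebesgue. (h x - min (h x) (real n)) + indicator A x * real n)"
      unfolding set_lebesgue_integral_def
    proof (rule integral_mono)
      have "set_integrable lebesgue A k" by (rule set_integrable_subset[OF k]) (use A in auto)
      then show "integrable lebesgue (\<lambda>x. indicat_real A x *\<^sub>R k x)" by (simp add: set_integrable_def)
      show "integrable lebesgue (\<lambda>x. h x - min (h x) (real n) + indicat_real A x * real n)"
        using h hn iA by (intro Bochner_Integration.integrable_add Bochner_Integration.integrable_diff) auto
      show "indicat_real A x *\<^sub>R k x \<le> h x - min (h x) (real n) + indicat_real A x * real n" for x
        using A(2) h0[of x] by (cases "x \<in> A") (auto simp: h_def indicator_def min_def)
    qed
    also have "\<dots> = ((LINT x|lebesgue. h x) - (LINT x|lebesgue. min (h x) (real n))) + measure lebesgue A * real n"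
      using h hn iA by simp
    also have "measure lebesgue A * real n \<le> \<epsilon> / 2"
    proof -
      have "measure lebesgue A * real n \<le> \<epsilon> / (2 * (real n + 1)) * (real n + 1)"
        by (rule mult_mono) (use A \<epsilon> in auto)
      also have "\<dots> = \<epsilon> / 2" by (simp add: divide_simps)
      finally show ?thesis .
    qed
    finally show "(LINT x:A|lebesgue. k x) < \<epsilon>" using n by linarith
  qed
qed

lemma set_integral_open_closed_interval:
  fixes k :: "real \<Rightarrow> real"
  assumes "set_integrable lebesgue {l..r} k"
  shows "(LINT x:{l..r}|lebesgue. k x) = (LINT x:{l<..<r}|lebesgue. k x)"
proof -
  have "set_integrable lebesgue {l<..<r} k" by (rule set_integrable_subset[OF assms]) auto
  then show ?thesis
    using assms by (simp add: set_lebesgue_integral_eq_integral(2) integral_open_interval_real)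
qed

lemma absolutely_continuous_if_integral_bound:
  fixes F :: "real \<Rightarrow> 'a::real_normed_vector" and k :: "real \<Rightarrow> real"
  assumes k: "set_integrable lebesgue {a..b} k" and pos: "\<And>x. x \<in> {a..b} \<Longrightarrow> 0 \<le> k x"
    and bound: "\<And>u t. a \<le> u \<Longrightarrow> u \<le> t \<Longrightarrow> t \<le> b \<Longrightarrow> norm (F t - F u) \<le> (LINT x:{u..t}|lebesgue. k x)"
  shows "absolutely_continuous_fun_on {a..b} F"
  unfolding absolutely_continuous_fun_on_def
proof (intro allI impI)
  fix \<epsilon> :: real assume "\<epsilon> > 0"
  obtain \<delta> where \<delta>: "\<delta> > 0" "\<And>A. A \<in> lmeasurable \<Longrightarrow> A \<subseteq> {a..b} \<Longrightarrow> measure lebesgue A < \<delta> \<Longrightarrow> (LINT x:A|lebesgue. k x) < \<epsilon>"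
    using set_integral_uniformly_small[OF k pos \<open>\<epsilon> > 0\<close>] by metis
  show "\<exists>\<delta>>0. \<forall>(n::nat) l r.
        (\<forall>i<n. l i \<le> r i \<and> {l i..r i} \<subseteq> {a..b}) \<and>
        disjoint_family_on (\<lambda>i. {l i<..<r i}) {..<n} \<and>
        (\<Sum>i<n. r i - l i) < \<delta>
        \<longrightarrow> (\<Sum>i<n. norm (F (r i) - F (l i))) < \<epsilon>"
  proof (intro exI[of _ \<delta>] conjI allI impI \<delta>(1))
    fix n :: nat and l r :: "nat \<Rightarrow> real"
    assume "(\<forall>i<n. l i \<le> r i \<and> {l i..r i} \<subseteq> {a..b}) \<and>
        disjoint_family_on (\<lambda>i. {l i<..<r i}) {..<n} \<and> (\<Sum>i<n. r i - l i) < \<delta>"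
    then have lr: "\<And>i. i < n \<Longrightarrow> l i \<le> r i" "\<And>i. i < n \<Longrightarrow> {l i..r i} \<subseteq> {a..b}"
      and dis: "disjoint_family_on (\<lambda>i. {l i<..<r i}) {..<n}" and len: "(\<Sum>i<n. r i - l i) < \<delta>"
      by auto
    have ki: "set_integrable lebesgue {l i..r i} k" "set_integrable lebesgue {l i<..<r i} k" if "i < n" for i
      by (rule set_integrable_subset[OF k], simp, use lr(2)[OF that] in force)+
    have "(\<Sum>i<n. norm (F (r i) - F (l i))) \<le> (\<Sum>i<n. LINT x:{l i<..<r i}|lebesgue. k x)"
    proof (rule sum_mono)
      fix i assume "i \<in> {..<n}"
      then have i: "i < n" by simp
      have "norm (F (r i) - F (l i)) \<le> (LINT x:{l i..r i}|lebesgue. k x)"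
        by (rule bound) (use lr[OF i] in auto)
      then show "norm (F (r i) - F (l i)) \<le> (LINT x:{l i<..<r i}|lebesgue. k x)"
        using set_integral_open_closed_interval[OF ki(1)[OF i]] by simp
    qed
    also have "\<dots> = (LINT x:(\<Union>i\<in>{..<n}. {l i<..<r i})|lebesgue. k x)"
      by (rule set_integral_finite_Union[symmetric]) (use dis ki in auto)
    also have "\<dots> < \<epsilon>"
    proof (rule \<delta>(2))
      show "(\<Union>i\<in>{..<n}. {l i<..<r i}) \<in> lmeasurable" by (rule fmeasurable.finite_UN) auto
      show "(\<Union>i\<in>{..<n}. {l i<..<r i}) \<subseteq> {a..b}" using lr(2) by force
      have "measure lebesgue (\<Union>i\<in>{..<n}. {l i<..<r i}) \<le> (\<Sum>i<n. measure lebesgue {l i<..<r i})"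
        by (rule measure_UNION_le) auto
      also have "\<dots> = (\<Sum>i<n. r i - l i)" by (rule sum.cong) (use lr in auto)
      finally show "measure lebesgue (\<Union>i\<in>{..<n}. {l i<..<r i}) < \<delta>" using len by linarith
    qed
    finally show "(\<Sum>i<n. norm (F (r i) - F (l i))) < \<epsilon>" .
  qed
qed

text \<open>Around each point of \<open>E\<close> there are short intervals over which \<open>F\<close> moves by more than \<open>p\<close>
times the length. Disjoint ones filling \<open>E\<close> up to a small error give a movement of about
\<open>p * m\<close> or more, which is bounded by the integral of \<open>k\<close> over a slightly larger open set,
hence by about \<open>q * m\<close>, where \<open>m\<close> is the measure of \<open>E\<close>.\<close>

lemma derivative_le_integrand_null:
  fixes F :: "real \<Rightarrow> 'a::real_normed_vector" and k :: "real \<Rightarrow> real"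
  assumes k: "set_integrable lebesgue {a..b} k" and pos: "\<And>x. x \<in> {a..b} \<Longrightarrow> 0 \<le> k x"
    and bound: "\<And>u t. a \<le> u \<Longrightarrow> u \<le> t \<Longrightarrow> t \<le> b \<Longrightarrow> norm (F t - F u) \<le> (LINT x:{u..t}|lebesgue. k x)"
    and E: "E \<in> lmeasurable" "E \<subseteq> {a<..<b}"
    and der: "\<And>x. x \<in> E \<Longrightarrow> (F has_vector_derivative g x) (at x)"
    and qp: "q < p" "\<And>x. x \<in> E \<Longrightarrow> k x < q" "\<And>x. x \<in> E \<Longrightarrow> p < norm (g x)"
  shows "negligible E"
proof (rule ccontr)
  assume neg: "\<not> negligible E"
  define m where "m = measure lebesgue E"
  have m: "m > 0" using neg E negligible_iff_measure[of E] unfolding m_def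
    by (metis measure_nonneg less_eq_real_def)
  have "E \<noteq> {}" using neg by auto
  then obtain x0 where "x0 \<in> E" by blast
  then have "0 \<le> k x0" "k x0 < q" using pos[of x0] qp(2) E(2) by auto
  then have q: "q > 0" "p > 0" using qp(1) by auto
  define \<epsilon> where "\<epsilon> = (p - q) * m / 4"
  have \<epsilon>: "\<epsilon> > 0" using m qp by (simp add: \<epsilon>_def)
  obtain \<delta> where \<delta>: "\<delta> > 0" "\<And>A. A \<in> lmeasurable \<Longrightarrow> A \<subseteq> {a..b} \<Longrightarrow> measure lebesgue A < \<delta> \<Longrightarrow> (LINT x:A|lebesgue. k x) < \<epsilon>"
    using set_integral_uniformly_small[OF k pos \<epsilon>] by metis
  define \<eta> where "\<eta> = min \<delta> (\<epsilon> / p)"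
  have \<eta>: "\<eta> > 0" "\<eta> \<le> \<delta>" using \<delta>(1) \<epsilon> q by (auto simp: \<eta>_def)
  have "\<eta> \<le> \<epsilon> / p" by (simp add: \<eta>_def)
  then have \<eta>2: "p * \<eta> \<le> \<epsilon>" using q by (simp add: field_simps)
  obtain U where U: "open U" "E \<subseteq> U" "U \<subseteq> {a<..<b}" "U \<in> lmeasurable" "measure lebesgue U < m + \<eta>"
    unfolding m_def by (rule outer_open_measure[OF E(1) \<eta>(1) E(2)]) auto
  have mUE: "measure lebesgue (U - E) < \<eta>"
    using measurable_measure_Diff[OF U(4) _ U(2)] E(1) U(5) unfolding m_def by auto
  have UE: "U - E \<in> lmeasurable" using U(4) E(1) by (intro fmeasurable.Diff)
  have fine: "\<exists>l r. l < x \<and> x < r \<and> r - l < d \<and> p * (r - l) < norm (F r - F l)" if x: "x \<in> E" and d: "d > 0" for x d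
  proof -
    define e where "e = norm (g x) - p"
    have e: "e > 0" using qp(3)[OF x] by (simp add: e_def)
    obtain d' where d': "d' > 0" "\<And>y. norm (y - x) < d' \<Longrightarrow> norm (F y - F x - (y - x) *\<^sub>R g x) \<le> e/2 * norm (y - x)"
      using der[OF x] half_gt_zero[OF e] unfolding has_vector_derivative_def has_derivative_at_alt by blast
    \<comment> \<open>The symmetric interval \<open>[x - c, x + c]\<close> works: the errors of the two linear
      approximations are at most \<open>e * c\<close> together.\<close>
    define c where "c = min d d' / 3"
    have c: "c > 0" "c < d'" "2 * c < d" using d d' by (auto simp: c_def min_def)
    have "norm (F (x + c) - F x - c *\<^sub>R g x) \<le> e/2 * c" "norm (F (x - c) - F x + c *\<^sub>R g x) \<le> e/2 * c"
      using d'(2)[of "x + c"] d'(2)[of "x - c"] c by auto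
    moreover have "(2 * c) *\<^sub>R g x = (F (x + c) - F (x - c)) - ((F (x + c) - F x - c *\<^sub>R g x) - (F (x - c) - F x + c *\<^sub>R g x))"
      by (simp add: algebra_simps scaleR_2[symmetric])
    then have "norm ((2 * c) *\<^sub>R g x) \<le> norm (F (x + c) - F (x - c)) + (norm (F (x + c) - F x - c *\<^sub>R g x) + norm (F (x - c) - F x + c *\<^sub>R g x))"
      by (metis (no_types, lifting) add_left_mono norm_triangle_ineq4 order_trans)
    moreover have "norm ((2 * c) *\<^sub>R g x) = 2 * c * p + 2 * c * e" using c by (simp add: e_def algebra_simps)
    moreover have "c * e > 0" using c e by simp
    ultimately have "p * (2 * c) < norm (F (x + c) - F (x - c))" by (simp add: algebra_simps)
    then show ?thesis using c by (intro exI[of _ "x - c"] exI[of _ "x + c"]) (auto simp: algebra_simps)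
  qed
  obtain D where D: "finite D" "pairwise disjnt D"
    and DP: "\<And>K. K \<in> D \<Longrightarrow> \<exists>l r. l < r \<and> K = {l..r} \<and> {l..r} \<subseteq> U \<and> p * (r - l) < norm (F r - F l)"
    and Dm: "total_length D > m - \<eta>"
    by (rule vitali_intervals[OF E(1) U(2) U(1) \<eta>(1) fine, folded m_def]) (assumption+, rule that)
  have DU: "\<Union>D \<subseteq> U" by (rule Union_least) (use DP in blast)
  have Uab: "U \<subseteq> {a..b}" using U(3) by auto
  have kU: "set_integrable lebesgue U k"
    by (rule set_integrable_subset[OF k _ Uab]) (use U(4) in auto)
  have Dl: "K \<in> sets lebesgue" if K: "K \<in> D" for K
  proof -
    obtain l r where "K = {l..r}" using DP[OF K] by blast
    then show ?thesis by simp
  qed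
  have kD: "set_integrable lebesgue K k" if "K \<in> D" for K
    by (rule set_integrable_subset[OF kU]) (use Dl[OF that] DU that in auto)
  have "p * (m - \<eta>) \<le> p * total_length D" using Dm q by (intro mult_left_mono) auto
  also have "\<dots> \<le> (\<Sum>K\<in>D. LINT x:K|lebesgue. k x)"
    unfolding sum_distrib_left
  proof (rule sum_mono)
    fix K assume "K \<in> D"
    from DP[OF this] obtain l r where lr: "l < r" "K = {l..r}" "{l..r} \<subseteq> U" "p * (r - l) < norm (F r - F l)" by blast
    have "l \<in> {a..b}" "r \<in> {a..b}" by (rule subsetD[OF Uab], rule subsetD[OF lr(3)], use lr in simp)+
    then have "norm (F r - F l) \<le> (LINT x:K|lebesgue. k x)" using bound[of l r] lr by simp
    then show "p * (Sup K - Inf K) \<le> (LINT x:K|lebesgue. k x)" using lr by simp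
  qed
  also have "\<dots> = (LINT x:(\<Union>K\<in>D. K)|lebesgue. k x)"
    by (rule set_integral_finite_Union[symmetric])
       (use D Dl kD in \<open>auto simp: disjoint_family_on_def pairwise_def disjnt_def\<close>)
  also have "\<dots> \<le> (LINT x:U|lebesgue. k x)"
    unfolding set_lebesgue_integral_def
  proof (rule integral_mono)
    have "set_integrable lebesgue (\<Union>K\<in>D. K) k"
      by (rule set_integrable_subset[OF kU]) (use Dl D DU in auto)
    then show "integrable lebesgue (\<lambda>x. indicat_real (\<Union>K\<in>D. K) x *\<^sub>R k x)" by (simp add: set_integrable_def)
    show "integrable lebesgue (\<lambda>x. indicat_real U x *\<^sub>R k x)" using kU by (simp add: set_integrable_def)
    show "indicat_real (\<Union>K\<in>D. K) x *\<^sub>R k x \<le> indicat_real U x *\<^sub>R k x" for x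
    proof (cases "x \<in> U")
      case True
      then have "0 \<le> k x" using pos Uab by blast
      then show ?thesis using True by (simp add: indicator_def)
    next
      case False
      then have "x \<notin> (\<Union>K\<in>D. K)" using DU by blast
      then show ?thesis using False by simp
    qed
  qed
  also have "\<dots> = (LINT x:E \<union> (U - E)|lebesgue. k x)" using U(2) by (simp add: Un_absorb1)
  also have "\<dots> = (LINT x:E|lebesgue. k x) + (LINT x:U - E|lebesgue. k x)"
  proof (rule set_integral_Un)
    show "set_integrable lebesgue E k" "set_integrable lebesgue (U - E) k"
      by (rule set_integrable_subset[OF kU], use E(1) UE U(2) in auto)+
  qed auto
  also have "(LINT x:U - E|lebesgue. k x) < \<epsilon>" by (rule \<delta>(2)) (use UE Uab mUE \<eta> in auto)
  also have "(LINT x:E|lebesgue. k x) \<le> (LINT x:E|lebesgue. q)"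
  proof (rule set_integral_mono)
    show "set_integrable lebesgue E k" by (rule set_integrable_subset[OF kU]) (use E(1) U(2) in auto)
    show "set_integrable lebesgue E (\<lambda>x. q)" by (rule set_integral_const_lmeasurable[OF E(1)])
  qed (use qp(2) in \<open>auto intro: less_imp_le\<close>)
  also have "\<dots> = q * m" using set_integral_const_lmeasurable(2)[OF E(1)] by (simp add: m_def)
  finally have "p * (m - \<eta>) < q * m + \<epsilon>" by simp
  then have "(p - q) * m < 2 * \<epsilon>" using \<eta>2 by (simp add: algebra_simps)
  then show False using m qp(1) by (simp add: \<epsilon>_def)
qed

lemma derivative_le_integrand_ae:
  fixes F g :: "real \<Rightarrow> 'a::euclidean_space" and k :: "real \<Rightarrow> real"
  assumes k: "set_integrable lebesgue {a..b} k" and pos: "\<And>x. x \<in> {a..b} \<Longrightarrow> 0 \<le> k x"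
    and bound: "\<And>u t. a \<le> u \<Longrightarrow> u \<le> t \<Longrightarrow> t \<le> b \<Longrightarrow> norm (F t - F u) \<le> (LINT x:{u..t}|lebesgue. k x)"
    and g: "set_borel_measurable lebesgue {a..b} g" and N: "negligible N"
    and der: "\<And>x. x \<in> {a..b} \<Longrightarrow> x \<notin> N \<Longrightarrow> a < x \<and> x < b \<and> (F has_vector_derivative g x) (at x)"
  shows "AE x\<in>{a..b} in lebesgue. norm (g x) \<le> k x"
proof -
  define kk where "kk = (\<lambda>x. indicator {a..b} x *\<^sub>R k x)"
  define gg where "gg = (\<lambda>x. indicator {a..b} x *\<^sub>R g x)"
  have [measurable]: "kk \<in> borel_measurable lebesgue" using k unfolding set_integrable_def kk_def by simp
  have [measurable]: "gg \<in> borel_measurable lebesgue" using g unfolding set_borel_measurable_def gg_def by simp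
  define E where "E = (\<lambda>(q,p). ({a<..<b} \<inter> {x\<in>space lebesgue. kk x < q \<and> p < norm (gg x)}) - N)"
  define A where "A = {(q,p). q \<in> \<rat> \<and> p \<in> \<rat> \<and> q < (p::real)}"
  have Nl: "N \<in> sets lebesgue" using N by (simp add: negligible_imp_sets)
  have "negligible (E i)" if i: "i \<in> A" for i
  proof -
    obtain q p where qp: "i = (q, p)" "q < p" using i by (auto simp: A_def)
    have "{x\<in>space lebesgue. kk x < q \<and> p < norm (gg x)} \<in> sets lebesgue" by measurable
    then have "E i \<in> sets lebesgue" unfolding E_def qp using Nl by (auto intro!: sets.Diff sets.Int)
    moreover have Eab: "E i \<subseteq> {a<..<b}" unfolding E_def qp by auto
    ultimately have El: "E i \<in> lmeasurable" by (intro fmeasurableI2[OF _ Eab]) auto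
    show ?thesis
    proof (rule derivative_le_integrand_null[OF k pos bound El Eab _ qp(2)])
      fix x assume x: "x \<in> E i"
      then have ab: "x \<in> {a..b}" "x \<notin> N" using Eab by (auto simp: E_def qp)
      show "(F has_vector_derivative g x) (at x)" using der[OF ab] by simp
      show "k x < q" "p < norm (g x)" using x ab(1) by (auto simp: E_def qp kk_def gg_def)
    qed
  qed
  moreover have "countable A"
    by (rule countable_subset[of _ "\<rat> \<times> \<rat>"]) (auto simp: A_def countable_rat)
  ultimately have "negligible (N \<union> (\<Union>i\<in>A. E i))"
    using N by (intro negligible_Un negligible_countable_Union) auto
  then have "N \<union> (\<Union>i\<in>A. E i) \<in> null_sets lebesgue" by (simp add: negligible_iff_null_sets)
  moreover have "{x\<in>space lebesgue. \<not> (x \<in> {a..b} \<longrightarrow> norm (g x) \<le> k x)} \<subseteq> N \<union> (\<Union>i\<in>A. E i)"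
  proof
    fix x assume "x \<in> {x\<in>space lebesgue. \<not> (x \<in> {a..b} \<longrightarrow> norm (g x) \<le> k x)}"
    then have x: "x \<in> {a..b}" "\<not> norm (g x) \<le> k x" by auto
    show "x \<in> N \<union> (\<Union>i\<in>A. E i)"
    proof (rule ccontr)
      assume "x \<notin> N \<union> (\<Union>i\<in>A. E i)"
      then have xN: "x \<notin> N" and xE: "x \<notin> (\<Union>i\<in>A. E i)" by auto
      obtain q where q: "q \<in> \<rat>" "k x < q" "q < norm (g x)" using Rats_dense_in_real[of "k x" "norm (g x)"] x by auto
      obtain p where p: "p \<in> \<rat>" "q < p" "p < norm (g x)" using Rats_dense_in_real[OF q(3)] by auto
      have "(q, p) \<in> A" using p q by (simp add: A_def)
      moreover have "x \<in> E (q, p)" using x(1) xN q p der[OF x(1) xN] by (simp add: E_def kk_def gg_def)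
      ultimately show False using xE by blast
    qed
  qed
  ultimately show ?thesis by (rule AE_I')
qed

section \<open>Increments and derivatives in Lebesgue spaces\<close>

lemma Lp_on_imp_set_integrable:
  fixes f :: "real \<Rightarrow> 'a::euclidean_space"
  assumes d: "1 \<le> d" and S: "S \<in> lmeasurable" and f: "Lp_on d S f"
  shows "set_integrable lebesgue S f"
proof -
  have meas: "(\<lambda>x. indicator S x *\<^sub>R f x) \<in> borel_measurable lebesgue"
    using f unfolding Lp_on_def set_borel_measurable_def by simp
  show ?thesis
  proof (cases "d = \<infinity>")
    case True
    then obtain C where C: "AE x\<in>S in lebesgue. norm (f x) \<le> C" using f unfolding Lp_on_def by auto
    have "integrable lebesgue (\<lambda>x. indicator S x *\<^sub>R C)"
      using set_integral_const_lmeasurable(1)[OF S, of C] unfolding set_integrable_def .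
    then show ?thesis unfolding set_integrable_def
    proof (rule Bochner_Integration.integrable_bound[OF _ meas])
      show "AE x in lebesgue. norm (indicat_real S x *\<^sub>R f x) \<le> norm (indicat_real S x *\<^sub>R C)"
        using C by eventually_elim (auto simp: indicator_def)
    qed
  next
    case False
    define e where "e = enn2real d"
    have e: "1 \<le> e"
      using d False unfolding e_def
      by (metis enn2real_1 enn2real_mono infinity_ennreal_def top.not_eq_extremum)
    have "set_integrable lebesgue S (\<lambda>x. norm (f x) powr e)"
      using f False unfolding Lp_on_def e_def by simp
    then have "set_integrable lebesgue S (\<lambda>x. 1 + norm (f x) powr e)"
      by (intro set_integral_add set_integral_const_lmeasurable(1) S)
    then show ?thesis unfolding set_integrable_def
    proof (rule Bochner_Integration.integrable_bound[OF _ meas])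
      have "norm (f x) \<le> 1 + norm (f x) powr e" for x
      proof (cases "norm (f x) \<le> 1")
        case True then show ?thesis by (simp add: add_increasing2)
      next
        case False
        then have "norm (f x) powr 1 \<le> norm (f x) powr e" using e by (intro powr_mono) auto
        then show ?thesis using False by simp
      qed
      then show "AE x in lebesgue. norm (indicat_real S x *\<^sub>R f x) \<le> norm (indicat_real S x *\<^sub>R (1 + norm (f x) powr e))"
        by (intro AE_I2) (auto simp: indicator_def)
    qed
  qed
qed

text \<open>Two majorants are allowed because the increments of an orbit will be dominated by those of
another orbit together with those of the multiplier.\<close>

lemma Lp_on_dominated:
  fixes g :: "real \<Rightarrow> 'a::euclidean_space" and f :: "real \<Rightarrow> 'b::euclidean_space" and h :: "real \<Rightarrow> 'c::euclidean_space"
  assumes g: "set_borel_measurable lebesgue S g" and f: "Lp_on d S f" and h: "Lp_on d S h" and C: "C \<ge> 0"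
    and le: "AE x\<in>S in lebesgue. norm (g x) \<le> C * (norm (f x) + norm (h x))"
  shows "Lp_on d S g"
proof (cases "d = \<infinity>")
  case True
  obtain A where A: "AE x\<in>S in lebesgue. norm (f x) \<le> A" using f True unfolding Lp_on_def by auto
  obtain B where B: "AE x\<in>S in lebesgue. norm (h x) \<le> B" using h True unfolding Lp_on_def by auto
  have "AE x\<in>S in lebesgue. norm (g x) \<le> C * (A + B)"
    using le A B
  proof eventually_elim
    case (elim x)
    show ?case
    proof
      assume x: "x \<in> S"
      have "C * (norm (f x) + norm (h x)) \<le> C * (A + B)"
        by (rule mult_left_mono[OF _ C]) (use elim x in auto)
      then show "norm (g x) \<le> C * (A + B)" using elim x by auto
    qed
  qed
  then show ?thesis using True g unfolding Lp_on_def by auto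
next
  case False
  define e where "e = enn2real d"
  have e: "e \<ge> 0" by (simp add: e_def)
  have f': "set_integrable lebesgue S (\<lambda>x. norm (f x) powr e)" and h': "set_integrable lebesgue S (\<lambda>x. norm (h x) powr e)"
    using f h False unfolding Lp_on_def e_def by simp_all
  have "set_integrable lebesgue S (\<lambda>x. (2 * C) powr e * (norm (f x) powr e + norm (h x) powr e))"
    by (intro set_integrable_mult_right set_integral_add f' h')
  then have "set_integrable lebesgue S (\<lambda>x. norm (g x) powr e)"
    unfolding set_integrable_def
  proof (rule Bochner_Integration.integrable_bound)
    have m: "(\<lambda>x. indicator S x *\<^sub>R g x) \<in> borel_measurable lebesgue" using g unfolding set_borel_measurable_def .
    have eq: "(\<lambda>x. indicat_real S x *\<^sub>R norm (g x) powr e) = (\<lambda>x. norm (indicat_real S x *\<^sub>R g x) powr e)"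
      by (auto simp: indicator_def)
    show "(\<lambda>x. indicat_real S x *\<^sub>R norm (g x) powr e) \<in> borel_measurable lebesgue"
      unfolding eq using measurable_compose[OF m borel_measurable_norm] by (intro powr_real_measurable borel_measurable_const)
    show "AE x in lebesgue. norm (indicat_real S x *\<^sub>R norm (g x) powr e)
        \<le> norm (indicat_real S x *\<^sub>R ((2 * C) powr e * (norm (f x) powr e + norm (h x) powr e)))"
      using le
    proof eventually_elim
      case (elim x)
      show ?case
      proof (cases "x \<in> S")
        case True
        define M where "M = max (norm (f x)) (norm (h x))"
        have M: "M \<ge> 0" by (simp add: M_def le_max_iff_disj)
        have "norm (g x) \<le> C * (norm (f x) + norm (h x))" using elim True by simp
        also have "\<dots> \<le> C * (2 * M)" by (rule mult_left_mono[OF _ C]) (simp add: M_def max_def)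
        finally have "norm (g x) \<le> (2 * C) * M" by (simp add: algebra_simps)
        then have "norm (g x) powr e \<le> ((2 * C) * M) powr e" by (intro powr_mono2 e) auto
        also have "\<dots> = (2 * C) powr e * M powr e" using C M by (simp add: powr_mult)
        also have "\<dots> \<le> (2 * C) powr e * (norm (f x) powr e + norm (h x) powr e)"
          by (rule mult_left_mono) (auto simp: M_def max_def)
        finally show ?thesis using True by simp
      qed simp
    qed
  qed
  then show ?thesis using False g unfolding Lp_on_def e_def by auto
qed

lemma Lp_on_subset:
  assumes "Lp_on d S f" "K \<in> sets lebesgue" "K \<subseteq> S"
  shows "Lp_on d K f"
proof -
  have "(\<lambda>x. indicat_real S x *\<^sub>R f x) \<in> borel_measurable lebesgue"
    using assms(1) unfolding Lp_on_def set_borel_measurable_def by simp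
  then have "(\<lambda>x. indicat_real K x *\<^sub>R (indicator S x *\<^sub>R f x)) \<in> borel_measurable lebesgue"
    by (rule borel_measurable_scaleR[OF borel_measurable_indicator[OF assms(2)]])
  also have "(\<lambda>x. indicator K x *\<^sub>R (indicator S x *\<^sub>R f x)) = (\<lambda>x. indicator K x *\<^sub>R f x)"
    using assms(3) by (auto simp: indicator_def fun_eq_iff)
  finally have "set_borel_measurable lebesgue K f" unfolding set_borel_measurable_def .
  moreover have "\<exists>C. AE x\<in>K in lebesgue. norm (f x) \<le> C" if ex: "\<exists>C. AE x\<in>S in lebesgue. norm (f x) \<le> C"
  proof -
    obtain C where "AE x\<in>S in lebesgue. norm (f x) \<le> C" using ex by blast
    then have "AE x\<in>K in lebesgue. norm (f x) \<le> C" by eventually_elim (use assms(3) in blast)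
    then show ?thesis by blast
  qed
  ultimately show ?thesis using assms set_integrable_subset unfolding Lp_on_def by (auto split: if_splits)
qed

lemma Lp_on_norm:
  fixes f :: "real \<Rightarrow> 'a::euclidean_space"
  assumes f: "Lp_on d S f"
  shows "Lp_on d S (\<lambda>x. norm (f x))"
proof (rule Lp_on_dominated[OF _ f f, of _ 1])
  have "(\<lambda>x. indicat_real S x *\<^sub>R f x) \<in> borel_measurable lebesgue"
    using f unfolding Lp_on_def set_borel_measurable_def by simp
  then have "(\<lambda>x. norm (indicat_real S x *\<^sub>R f x)) \<in> borel_measurable lebesgue"
    by (rule measurable_compose[OF _ borel_measurable_norm])
  also have "(\<lambda>x. norm (indicat_real S x *\<^sub>R f x)) = (\<lambda>x. indicat_real S x *\<^sub>R norm (f x))" by auto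
  finally show "set_borel_measurable lebesgue S (\<lambda>x. norm (f x))" unfolding set_borel_measurable_def .
  show "AE x\<in>S in lebesgue. norm (norm (f x)) \<le> 1 * (norm (f x) + norm (f x))"
    by (intro AE_I2) simp
qed simp

lemma Lp_on_lincomb:
  fixes k l :: "real \<Rightarrow> real"
  assumes S: "S \<in> sets lebesgue" and C: "C \<ge> 0" and k: "Lp_on d S k" and l: "Lp_on d S l"
  shows "Lp_on d S (\<lambda>x. C * (k x + l x))"
proof (rule Lp_on_dominated[OF _ k l C])
  have "(\<lambda>x. indicat_real S x *\<^sub>R k x) \<in> borel_measurable lebesgue" "(\<lambda>x. indicat_real S x *\<^sub>R l x) \<in> borel_measurable lebesgue"
    using k l unfolding Lp_on_def set_borel_measurable_def by simp_all
  then have "(\<lambda>x. C * (indicat_real S x *\<^sub>R k x + indicat_real S x *\<^sub>R l x)) \<in> borel_measurable lebesgue"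
    by (intro borel_measurable_times borel_measurable_add borel_measurable_const)
  also have "(\<lambda>x. C * (indicat_real S x *\<^sub>R k x + indicat_real S x *\<^sub>R l x)) = (\<lambda>x. indicat_real S x *\<^sub>R (C * (k x + l x)))"
    by (auto simp: fun_eq_iff algebra_simps)
  finally show "set_borel_measurable lebesgue S (\<lambda>x. C * (k x + l x))" unfolding set_borel_measurable_def .
  have "norm (C * (k x + l x)) \<le> C * (norm (k x) + norm (l x))" for x
    unfolding norm_mult using C by (simp add: mult_left_mono abs_triangle_ineq)
  then show "AE x\<in>S in lebesgue. norm (C * (k x + l x)) \<le> C * (norm (k x) + norm (l x))"
    by (intro AE_I2) simp
qed

lemma set_integral_lincomb:
  fixes k l :: "real \<Rightarrow> real"
  assumes "set_integrable lebesgue S k" "set_integrable lebesgue S l"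
  shows "(LINT x:S|lebesgue. C * (k x + l x)) = C * ((LINT x:S|lebesgue. k x) + (LINT x:S|lebesgue. l x))"
  using assms by (simp add: set_integral_add)

lemma Lp_increments_imp_Lp_derivative:
  fixes \<mu> :: "real \<Rightarrow> complex"
  assumes d: "1 \<le> d"
    and incr: "\<And>T. T > 0 \<Longrightarrow> \<exists>k::real\<Rightarrow>real. (\<forall>\<xi>\<in>{0..T}. 0 \<le> k \<xi>) \<and> Lp_on d {0..T} k \<and>
       (\<forall>u t. 0 \<le> u \<and> u \<le> t \<and> t \<le> T \<longrightarrow> norm (\<mu> t - \<mu> u) \<le> (LINT \<xi>:{u..t}|lebesgue. k \<xi>))"
  shows "locally_absolutely_continuous_on {0..} \<mu>"
    and "Lp_loc_on d {0..} (\<lambda>t. vector_derivative \<mu> (at t within {0..}))"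
proof -
  have AC0: "absolutely_continuous_fun_on {0..T} \<mu>" if T: "T > 0" for T
  proof -
    obtain k :: "real \<Rightarrow> real" where k: "\<And>\<xi>. \<xi> \<in> {0..T} \<Longrightarrow> 0 \<le> k \<xi>" "Lp_on d {0..T} k"
       "\<And>u t. 0 \<le> u \<Longrightarrow> u \<le> t \<Longrightarrow> t \<le> T \<Longrightarrow> norm (\<mu> t - \<mu> u) \<le> (LINT \<xi>:{u..t}|lebesgue. k \<xi>)"
      using incr[OF T] by blast
    show ?thesis
      by (rule absolutely_continuous_if_integral_bound[OF Lp_on_imp_set_integrable[OF d _ k(2)] k(1) k(3)]) auto
  qed
  have AC: "absolutely_continuous_fun_on {a..b} \<mu>" if ab: "{a..b} \<subseteq> {0..}" for a b
  proof -
    have sub: "{a..b} \<subseteq> {0..max b 1}" using ab by (auto simp: le_max_iff_disj)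
    show ?thesis
      by (rule absolutely_continuous_dominated[OF AC0[of "max b 1"] sub order_refl]) simp
  qed
  then show "locally_absolutely_continuous_on {0..} \<mu>" unfolding locally_absolutely_continuous_on_def by blast
  let ?D = "\<lambda>t. vector_derivative \<mu> (at t within {0..})"
  have main: "Lp_on d {0..T} ?D" if T: "T > 0" for T
  proof -
    obtain k :: "real \<Rightarrow> real" where k: "\<And>\<xi>. \<xi> \<in> {0..T} \<Longrightarrow> 0 \<le> k \<xi>" "Lp_on d {0..T} k"
       "\<And>u t. 0 \<le> u \<Longrightarrow> u \<le> t \<Longrightarrow> t \<le> T \<Longrightarrow> norm (\<mu> t - \<mu> u) \<le> (LINT \<xi>:{u..t}|lebesgue. k \<xi>)"
      using incr[OF T] by blast
    have ki: "set_integrable lebesgue {0..T} k" by (rule Lp_on_imp_set_integrable[OF d _ k(2)]) auto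
    obtain N where N: "negligible N" and N': "\<And>x. x \<in> {0..T} \<Longrightarrow> x \<notin> N \<Longrightarrow>
        0 < x \<and> x < T \<and> (\<mu> has_vector_derivative vector_derivative \<mu> (at x)) (at x)"
      using absolutely_continuous_ae_differentiable[OF AC0[OF T]] by blast
    have der: "0 < x \<and> x < T \<and> (\<mu> has_vector_derivative ?D x) (at x)" if x: "x \<in> {0..T}" "x \<notin> N" for x
    proof -
      have "0 < x" using N'[OF x] by blast
      then have "at x within {0..} = at x" by (intro at_within_interior) (simp add: interior_real_atLeast)
      with N'[OF x] show ?thesis by (simp only:)
    qed
    have "(?D has_integral (\<mu> T - \<mu> 0)) {0..T}"
    proof (rule absolutely_continuous_ftc[OF AC0[OF T] _ N])
      fix x assume "x \<in> {0..T}" "x \<notin> N"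
      from der[OF this] show "(\<mu> has_vector_derivative ?D x) (at x within {0..T})"
        by (rule has_vector_derivative_at_within[OF conjunct2[OF conjunct2]])
    qed (use T in simp)
    then have "?D \<in> borel_measurable (lebesgue_on {0..T})"
      by (intro integrable_imp_measurable) (auto simp: integrable_on_def)
    then have meas: "set_borel_measurable lebesgue {0..T} ?D"
      unfolding set_borel_measurable_def by (subst (asm) borel_measurable_restrict_space_iff) auto
    have "AE x\<in>{0..T} in lebesgue. norm (?D x) \<le> k x"
      by (rule derivative_le_integrand_ae[OF ki k(1) k(3) meas N der])
    then have "AE x\<in>{0..T} in lebesgue. norm (?D x) \<le> 1 * (norm (k x) + norm (k x))"
      by eventually_elim auto
    then show ?thesis by (rule Lp_on_dominated[OF meas k(2) k(2), rotated]) simp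
  qed
  show "Lp_loc_on d {0..} ?D"
    unfolding Lp_loc_on_def
  proof (intro allI impI)
    fix K :: "real set" assume K: "compact K \<and> K \<subseteq> {0..}"
    then obtain B where B: "\<And>x. x \<in> K \<Longrightarrow> norm x \<le> B" using compact_imp_bounded bounded_iff by metis
    have "K \<subseteq> {0..max B 1}"
    proof
      fix x assume x: "x \<in> K"
      then show "x \<in> {0..max B 1}" using K B[OF x] by (auto simp: le_max_iff_disj)
    qed
    moreover have "K \<in> sets lebesgue" using K lmeasurable_compact by blast
    ultimately show "Lp_on d K ?D" using Lp_on_subset[OF main[of "max B 1"]] by simp
  qed
qed

lemma Lp_derivative_imp_increment_bound:
  fixes \<mu> :: "real \<Rightarrow> complex"
  assumes d: "1 \<le> d" and AC: "locally_absolutely_continuous_on {0..} \<mu>"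
    and Lp: "Lp_loc_on d {0..} (\<lambda>t. vector_derivative \<mu> (at t within {0..}))"
    and ut: "0 \<le> u" "u \<le> t"
  shows "norm (\<mu> t - \<mu> u) \<le> (LINT \<xi>:{u..t}|lebesgue. norm (vector_derivative \<mu> (at \<xi> within {0..})))"
proof -
  let ?D = "\<lambda>t. vector_derivative \<mu> (at t within {0..})"
  have AC': "absolutely_continuous_fun_on {u..t} \<mu>"
    using AC ut unfolding locally_absolutely_continuous_on_def by auto
  obtain N where N: "negligible N" and N': "\<And>x. x \<in> {u..t} \<Longrightarrow> x \<notin> N \<Longrightarrow>
      u < x \<and> x < t \<and> (\<mu> has_vector_derivative vector_derivative \<mu> (at x)) (at x)"
    using absolutely_continuous_ae_differentiable[OF AC'] by blast
  have "(?D has_integral (\<mu> t - \<mu> u)) {u..t}"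
  proof (rule absolutely_continuous_ftc[OF AC' ut(2) N])
    fix x assume x: "x \<in> {u..t}" "x \<notin> N"
    have "0 < x" using N'[OF x] ut by linarith
    then have "at x within {0..} = at x" by (intro at_within_interior) (simp add: interior_real_atLeast)
    then show "(\<mu> has_vector_derivative ?D x) (at x within {u..t})"
      using N'[OF x] has_vector_derivative_at_within by metis
  qed
  moreover have "set_integrable lebesgue {u..t} ?D"
    using Lp ut unfolding Lp_loc_on_def by (intro Lp_on_imp_set_integrable[OF d]) auto
  ultimately have "\<mu> t - \<mu> u = (LINT \<xi>:{u..t}|lebesgue. ?D \<xi>)"
    by (metis has_integral_unique has_integral_set_lebesgue)
  then show ?thesis
    unfolding set_lebesgue_integral_def
    using integral_norm_bound[of lebesgue "\<lambda>\<xi>. indicator {u..t} \<xi> *\<^sub>R ?D \<xi>"] by simp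
qed

section \<open>The Schwarz--Pick lemma and Harnack inequalities\<close>

abbreviation moebius :: "complex \<Rightarrow> complex \<Rightarrow> complex" where
  "moebius \<equiv> Moebius_function 0"

lemma one_minus_cnj_mult_nonzero:
  fixes w z :: complex
  assumes "norm w < 1" "norm z \<le> 1"
  shows "1 - cnj w * z \<noteq> 0"
proof
  assume "1 - cnj w * z = 0"
  then have "cnj w * z = 1" by simp
  then have "norm (cnj w * z) = 1" by simp
  then have "norm w * norm z = 1" by (simp add: norm_mult)
  moreover have "norm w * norm z \<le> norm w * 1" using assms by (intro mult_left_mono) auto
  ultimately show False using assms by linarith
qed

lemma one_minus_norm_Moebius:
  assumes "norm w < 1" "norm z < 1"
  shows "1 - (norm (moebius w z))\<^sup>2 = (1 - (norm w)\<^sup>2) * (1 - (norm z)\<^sup>2) / (norm (1 - cnj w * z))\<^sup>2"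
proof -
  have ne: "1 - cnj w * z \<noteq> 0" using one_minus_cnj_mult_nonzero assms by auto
  have "(norm (1 - cnj w * z))\<^sup>2 - (norm (z - w))\<^sup>2 = (1 - (norm w)\<^sup>2) * (1 - (norm z)\<^sup>2)"
    unfolding cmod_power2 by (simp add: power2_eq_square algebra_simps)
  moreover have "(norm (moebius w z))\<^sup>2 = (norm (z - w))\<^sup>2 / (norm (1 - cnj w * z))\<^sup>2"
    by (simp add: Moebius_function_simple norm_divide power_divide)
  ultimately show ?thesis using ne by (simp add: field_simps)
qed

lemma Moebius_inverse:
  assumes "norm w < 1" "norm z < 1"
  shows "moebius (- w) (moebius w z) = z"
  using Moebius_function_compose[of "- w" w z] assms by simp

lemma schwarz_lemma_based_at:
  assumes k: "k holomorphic_on ball 0 1" and kw: "k w = 0" and bd: "\<And>z. norm z < 1 \<Longrightarrow> norm (k z) < 1"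
    and w: "norm w < 1" and z: "norm z < 1"
  shows "norm (k z) \<le> norm (moebius w z)"
proof -
  define K where "K = k \<circ> moebius (- w)"
  have Mw: "norm (moebius (- w) y) < 1" if "norm y < 1" for y
    using Moebius_function_norm_lt_1[of "- w" y] w that by simp
  have "K holomorphic_on ball 0 1" unfolding K_def
    by (rule holomorphic_on_compose_gen[OF Moebius_function_holomorphic k]) (use w Mw in auto)
  moreover have "K 0 = 0" using kw by (simp add: K_def Moebius_function_of_zero)
  moreover have "norm (K y) < 1" if "norm y < 1" for y
    using bd[OF Mw[OF that]] by (simp add: K_def)
  moreover have "norm (moebius w z) < 1" by (rule Moebius_function_norm_lt_1[OF w z])
  ultimately have "norm (K (moebius w z)) \<le> norm (moebius w z)"
    by (rule Schwarz_Lemma(1))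
  then show ?thesis by (simp add: K_def Moebius_inverse[OF w z])
qed

lemma self_map_norm_less:
  assumes "holomorphic_self_map f" "norm z < 1" shows "norm (f z) < 1"
  using assms unfolding holomorphic_self_map_def by (auto simp: image_subset_iff)

lemma schwarz_pick:
  assumes f: "holomorphic_self_map f" and w: "norm w < 1" and z: "norm z < 1"
  shows "norm (moebius (f w) (f z)) \<le> norm (moebius w z)"
proof -
  note fw = self_map_norm_less[OF f]
  have "norm ((moebius (f w) \<circ> f) z) \<le> norm (moebius w z)"
  proof (rule schwarz_lemma_based_at[OF _ _ _ w z])
    show "moebius (f w) \<circ> f holomorphic_on ball 0 1"
      by (rule holomorphic_on_compose_gen[OF _ Moebius_function_holomorphic[OF fw[OF w]]])
         (use f in \<open>auto simp: holomorphic_self_map_def\<close>)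
    show "(moebius (f w) \<circ> f) w = 0" by (simp add: Moebius_function_eq_zero)
    show "norm ((moebius (f w) \<circ> f) y) < 1" if "norm y < 1" for y
      using Moebius_function_norm_lt_1[OF fw[OF w] fw[OF that]] by simp
  qed
  then show ?thesis by simp
qed

text \<open>Apart from the factors \<open>1 - \<bar>w\<bar>\<^sup>2\<close> and \<open>1 - \<bar>f w\<bar>\<^sup>2\<close>, both sides have limits when \<open>w\<close> and
\<open>f w\<close> tend to a boundary point. In this form the inequality is used in Wolff's lemma, where
\<open>w\<close> runs to the boundary.\<close>

lemma schwarz_pick_quotient:
  assumes f: "holomorphic_self_map f" and w: "norm w < 1" and z: "norm z < 1"
  shows "(1 - (norm w)\<^sup>2) * (1 - (norm z)\<^sup>2) / (norm (1 - cnj w * z))\<^sup>2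
       \<le> (1 - (norm (f w))\<^sup>2) * (1 - (norm (f z))\<^sup>2) / (norm (1 - cnj (f w) * f z))\<^sup>2"
proof -
  note fw = self_map_norm_less[OF f]
  have "(norm (moebius (f w) (f z)))\<^sup>2 \<le> (norm (moebius w z))\<^sup>2"
    by (rule power_mono[OF schwarz_pick[OF assms]]) simp
  then show ?thesis
    using one_minus_norm_Moebius[OF w z] one_minus_norm_Moebius[OF fw[OF w] fw[OF z]] by linarith
qed

text \<open>The Cayley transform \<open>k = (p - p w) / (p + cnj (p w))\<close> maps the disc into itself and
vanishes at \<open>w\<close>, so Schwarz's lemma bounds it by the pseudo-hyperbolic distance \<open>\<rho>\<close>. Solving
for \<open>p\<close> gives the inequality with the factor \<open>1 - \<rho>\<^sup>2\<close>, which has a closed form.\<close>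

lemma harnack_strict:
  assumes p: "p holomorphic_on ball 0 1" and pos: "\<And>z. norm z < 1 \<Longrightarrow> 0 < Re (p z)"
    and w: "norm w < 1" and z: "norm z < 1"
  shows "norm (p z - p w) * ((1 - (norm w)\<^sup>2) * (1 - (norm z)\<^sup>2) / (norm (1 - cnj w * z))\<^sup>2) \<le> 4 * Re (p w)"
proof -
  define k where "k = (\<lambda>y. (p y - p w) / (p y + cnj (p w)))"
  have ne: "p y + cnj (p w) \<noteq> 0" if "norm y < 1" for y
  proof
    assume "p y + cnj (p w) = 0"
    then have "Re (p y + cnj (p w)) = 0" by simp
    then show False using pos[OF that] pos[OF w] by simp
  qed
  define \<rho> where "\<rho> = norm (moebius w z)"
  have \<rho>: "0 \<le> \<rho>" "\<rho> < 1" using Moebius_function_norm_lt_1[OF w z] by (simp_all add: \<rho>_def)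
  have "norm (k z) \<le> \<rho>" unfolding \<rho>_def
  proof (rule schwarz_lemma_based_at[OF _ _ _ w z])
    show "k holomorphic_on ball 0 1" unfolding k_def
      by (intro holomorphic_intros p) (use ne in auto)
    show "k w = 0" by (simp add: k_def)
    fix y :: complex assume y: "norm y < 1"
    have "(norm (p y + cnj (p w)))\<^sup>2 - (norm (p y - p w))\<^sup>2 = 4 * (Re (p y) * Re (p w))"
      unfolding cmod_power2 by (simp add: power2_eq_square algebra_simps)
    moreover have "Re (p y) * Re (p w) > 0" using pos y w by simp
    ultimately have "(norm (p y - p w))\<^sup>2 < (norm (p y + cnj (p w)))\<^sup>2" by linarith
    then have "norm (p y - p w) < norm (p y + cnj (p w))" by (rule power_less_imp_less_base) simp
    then show "norm (k y) < 1" using ne[OF y] by (simp add: k_def norm_divide)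
  qed
  then have "norm (p z - p w) \<le> \<rho> * norm (p z + cnj (p w))"
    using ne[OF z] by (simp add: k_def norm_divide divide_le_eq)
  also have "\<dots> \<le> \<rho> * (norm (p z - p w) + 2 * Re (p w))"
  proof (rule mult_left_mono[OF _ \<rho>(1)])
    have eq: "p z + cnj (p w) = (p z - p w) + of_real (2 * Re (p w))" by (simp add: complex_eq_iff)
    have "norm (of_real (2 * Re (p w)) :: complex) = 2 * Re (p w)"
      unfolding norm_of_real using pos[OF w] by simp
    then show "norm (p z + cnj (p w)) \<le> norm (p z - p w) + 2 * Re (p w)"
      unfolding eq using norm_triangle_ineq[of "p z - p w" "of_real (2 * Re (p w))"] by linarith
  qed
  finally have *: "norm (p z - p w) * (1 - \<rho>) \<le> 2 * \<rho> * Re (p w)" by (simp add: algebra_simps)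
  have "norm (p z - p w) * (1 - \<rho>\<^sup>2) = (norm (p z - p w) * (1 - \<rho>)) * (1 + \<rho>)"
    by (simp add: power2_eq_square algebra_simps)
  also have "\<dots> \<le> (2 * \<rho> * Re (p w)) * (1 + \<rho>)" by (rule mult_right_mono[OF *]) (use \<rho> in auto)
  also have "\<dots> = (2 * \<rho> * (1 + \<rho>)) * Re (p w)" by simp
  also have "\<dots> \<le> 4 * Re (p w)"
  proof (rule mult_right_mono)
    have "\<rho> * (1 + \<rho>) \<le> 1 * (1 + 1)" by (rule mult_mono) (use \<rho> in auto)
    then show "2 * \<rho> * (1 + \<rho>) \<le> 4" by simp
  qed (use pos[OF w] in simp)
  finally show ?thesis unfolding \<rho>_def one_minus_norm_Moebius[OF w z] .
qed

text \<open>Adding a positive constant to \<open>p\<close> makes the real part strictly positive; let the constant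
tend to zero.\<close>

lemma harnack:
  assumes p: "p holomorphic_on ball 0 1" and pos: "\<And>z. norm z < 1 \<Longrightarrow> 0 \<le> Re (p z)"
    and w: "norm w < 1" and z: "norm z < 1"
  shows "norm (p z - p w) \<le> 4 * (norm (1 - cnj w * z))\<^sup>2 / ((1 - (norm w)\<^sup>2) * (1 - (norm z)\<^sup>2)) * Re (p w)"
proof -
  define q where "q = (1 - (norm w)\<^sup>2) * (1 - (norm z)\<^sup>2) / (norm (1 - cnj w * z))\<^sup>2"
  have "norm (1 - cnj w * z) > 0" using one_minus_cnj_mult_nonzero[OF w] z by simp
  moreover have "(1 - (norm w)\<^sup>2) > 0" "(1 - (norm z)\<^sup>2) > 0" using w z by (simp_all add: abs_square_less_1)
  ultimately have q: "q > 0" unfolding q_def by (intro divide_pos_pos mult_pos_pos) auto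
  have "norm (p z - p w) * q \<le> 4 * Re (p w)"
  proof (rule field_le_epsilon)
    fix e :: real assume e: "e > 0"
    have "norm ((p z + of_real (e/4)) - (p w + of_real (e/4))) * q \<le> 4 * Re (p w + of_real (e/4))"
      unfolding q_def
    proof (rule harnack_strict[where p = "\<lambda>z. p z + of_real (e/4)"])
      show "(\<lambda>z. p z + of_real (e/4)) holomorphic_on ball 0 1" by (intro holomorphic_intros p)
      show "0 < Re (p y + of_real (e/4))" if "norm y < 1" for y using pos[OF that] e by simp
    qed fact+
    then show "norm (p z - p w) * q \<le> 4 * Re (p w) + e" by simp
  qed
  then have "norm (p z - p w) \<le> 4 * Re (p w) / q" using q by (simp add: pos_le_divide_eq)
  then show ?thesis unfolding q_def by (simp add: field_simps)
qed

lemma harnack_norm: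
  assumes p: "p holomorphic_on ball 0 1" and pos: "\<And>z. norm z < 1 \<Longrightarrow> 0 \<le> Re (p z)"
    and r: "r < 1" and w: "norm w \<le> r" and z: "norm z \<le> r"
  shows "norm (p z) \<le> (1 + 16 / (1 - r\<^sup>2)\<^sup>2) * norm (p w)"
proof -
  have r0: "0 \<le> r" using w norm_ge_zero[of w] by linarith
  have r1: "0 < 1 - r\<^sup>2" using r r0 by (simp add: abs_square_less_1)
  have "norm (1 - cnj w * z) \<le> norm (1::complex) + norm (cnj w * z)" by (rule norm_triangle_ineq4)
  also have "norm (cnj w * z) \<le> 1 * 1" unfolding norm_mult by (rule mult_mono) (use w z r in auto)
  finally have "norm (1 - cnj w * z) \<le> 2" by simp
  then have "(norm (1 - cnj w * z))\<^sup>2 \<le> 2\<^sup>2" by (rule power_mono) simp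
  then have n: "4 * (norm (1 - cnj w * z))\<^sup>2 \<le> 16" by simp
  have "(norm w)\<^sup>2 \<le> r\<^sup>2" "(norm z)\<^sup>2 \<le> r\<^sup>2" using w z by (auto intro: power_mono)
  then have d: "(1 - r\<^sup>2)\<^sup>2 \<le> (1 - (norm w)\<^sup>2) * (1 - (norm z)\<^sup>2)"
    unfolding power2_eq_square[of "1 - r\<^sup>2"] using r1 by (intro mult_mono) auto
  have "norm (p z - p w) \<le> 4 * (norm (1 - cnj w * z))\<^sup>2 / ((1 - (norm w)\<^sup>2) * (1 - (norm z)\<^sup>2)) * Re (p w)"
    by (rule harnack[OF p pos]) (use w z r in auto)
  also have "\<dots> \<le> 16 / (1 - r\<^sup>2)\<^sup>2 * Re (p w)"
    by (intro mult_right_mono frac_le n d) (use r1 pos[of w] w r in auto)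
  also have "\<dots> \<le> 16 / (1 - r\<^sup>2)\<^sup>2 * norm (p w)"
    by (intro mult_left_mono complex_Re_le_cmod) simp
  finally have "norm (p z - p w) \<le> 16 / (1 - r\<^sup>2)\<^sup>2 * norm (p w)" .
  moreover have "norm (p z) \<le> norm (p z - p w) + norm (p w)"
    using norm_triangle_ineq[of "p z - p w" "p w"] by simp
  ultimately show ?thesis by (simp add: algebra_simps)
qed

text \<open>A self-map does not increase the pseudo-hyperbolic distance, so one value well inside the
disc keeps all values on a compact set well inside, with a bound that does not depend on the
map.\<close>

lemma self_map_image_bound:
  assumes r: "r < 1" obtains R where "R < 1"
    "\<And>f z w. holomorphic_self_map f \<Longrightarrow> norm z \<le> r \<Longrightarrow> norm w \<le> r \<Longrightarrow> norm (f w) \<le> r \<Longrightarrow> norm (f z) \<le> R"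
proof (cases "r < 0")
  case True
  then show ?thesis using that[of 0] norm_ge_zero by (metis order.strict_trans1 not_less zero_less_one)
next
  case False
  define c where "c = (1 - r)\<^sup>2 * (1 - r\<^sup>2)\<^sup>2 / 4"
  have r1: "0 < 1 - r\<^sup>2" using r False by (simp add: abs_square_less_1)
  have c: "c > 0" using r r1 by (simp add: c_def)
  show ?thesis
  proof (rule that[of "sqrt (1 - c)"])
    show "sqrt (1 - c) < 1" using c by (simp add: real_sqrt_lt_1_iff)
    fix f and z w :: complex assume f: "holomorphic_self_map f" and z: "norm z \<le> r" and w: "norm w \<le> r" and fw: "norm (f w) \<le> r"
    have lt: "norm z < 1" "norm w < 1" using z w r by auto
    note flt = self_map_norm_less[OF f lt(1)] self_map_norm_less[OF f lt(2)]
    define A where "A = (1 - (norm w)\<^sup>2) * (1 - (norm z)\<^sup>2)"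
    have "(norm w)\<^sup>2 \<le> r\<^sup>2" "(norm z)\<^sup>2 \<le> r\<^sup>2" using w z by (auto intro: power_mono)
    then have A: "(1 - r\<^sup>2)\<^sup>2 \<le> A"
      unfolding A_def power2_eq_square[of "1 - r\<^sup>2"] using r1 by (intro mult_mono) auto
    have "norm (1 - cnj w * z) \<le> norm (1::complex) + norm (cnj w * z)" by (rule norm_triangle_ineq4)
    also have "norm (cnj w * z) \<le> 1 * 1" unfolding norm_mult by (rule mult_mono) (use lt in auto)
    finally have "norm (1 - cnj w * z) \<le> 2" by simp
    then have den: "(norm (1 - cnj w * z))\<^sup>2 \<le> 4" using power_mono[of "norm (1 - cnj w * z)" 2 2] by simp
    have denpos: "(norm (1 - cnj w * z))\<^sup>2 > 0" using one_minus_cnj_mult_nonzero[OF lt(2), of z] lt by simp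
    have A0: "A \<ge> 0" using A zero_le_power2[of "1 - r\<^sup>2"] by linarith
    have "A / 4 \<le> A / (norm (1 - cnj w * z))\<^sup>2"
      by (rule divide_left_mono) (use den denpos A0 in auto)
    also have "\<dots> \<le> (1 - (norm (f w))\<^sup>2) * (1 - (norm (f z))\<^sup>2) / (norm (1 - cnj (f w) * f z))\<^sup>2"
      unfolding A_def by (rule schwarz_pick_quotient[OF f lt(2) lt(1)])
    also have "\<dots> \<le> (1 - (norm (f z))\<^sup>2) / (1 - r)\<^sup>2"
    proof (rule frac_le)
      have fz0: "0 \<le> 1 - (norm (f z))\<^sup>2" using flt by (simp add: abs_square_le_1)
      then show "0 \<le> 1 - (norm (f z))\<^sup>2" .
      have "(1 - (norm (f w))\<^sup>2) * (1 - (norm (f z))\<^sup>2) \<le> 1 * (1 - (norm (f z))\<^sup>2)"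
        by (rule mult_right_mono) (use fz0 in auto)
      then show "(1 - (norm (f w))\<^sup>2) * (1 - (norm (f z))\<^sup>2) \<le> 1 - (norm (f z))\<^sup>2" by simp
      show "0 < (1 - r)\<^sup>2" using r by simp
      have "norm (cnj (f w) * f z) \<le> r * 1" unfolding norm_mult by (rule mult_mono) (use fw flt False in auto)
      moreover have "norm (1::complex) - norm (cnj (f w) * f z) \<le> norm (1 - cnj (f w) * f z)" by (rule norm_triangle_ineq2)
      ultimately have "1 - r \<le> norm (1 - cnj (f w) * f z)" by simp
      then show "(1 - r)\<^sup>2 \<le> (norm (1 - cnj (f w) * f z))\<^sup>2" by (rule power_mono) (use r in simp)
    qed
    finally have "(1 - r)\<^sup>2 * (A / 4) \<le> 1 - (norm (f z))\<^sup>2"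
      using r by (simp add: pos_le_divide_eq mult.commute)
    moreover have "c \<le> (1 - r)\<^sup>2 * (A / 4)"
      unfolding c_def using mult_left_mono[OF A, of "(1 - r)\<^sup>2"] by simp
    ultimately have "(norm (f z))\<^sup>2 \<le> 1 - c" by linarith
    then show "norm (f z) \<le> sqrt (1 - c)" by (rule real_le_rsqrt)
  qed
qed

section \<open>Self-maps with an interior fixed point\<close>

lemma Moebius_has_derivative:
  assumes "norm w < 1" "norm z < 1"
  shows "(moebius w has_field_derivative (1 - (norm w)\<^sup>2) / (1 - cnj w * z)\<^sup>2) (at z)"
proof -
  have ne: "1 - cnj w * z \<noteq> 0" using one_minus_cnj_mult_nonzero assms by auto
  have eq: "(complex_of_real (norm w))\<^sup>2 = w * cnj w" using complex_norm_square[of w] by simp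
  have "((\<lambda>z. (z - w) / (1 - cnj w * z)) has_field_derivative (1 - (norm w)\<^sup>2) / (1 - cnj w * z)\<^sup>2) (at z)"
    by (rule derivative_eq_intros refl ne)+
       (use ne eq in \<open>simp add: divide_simps power2_eq_square algebra_simps\<close>)
  then show ?thesis by (simp add: Moebius_function_def)
qed

lemma Moebius_diff:
  assumes w: "norm w < 1" and a: "norm a < 1" and b: "norm b < 1"
  shows "norm (moebius w a - moebius w b) * (norm (1 - cnj w * a) * norm (1 - cnj w * b)) = (1 - (norm w)\<^sup>2) * norm (a - b)"
proof -
  have ne: "1 - cnj w * a \<noteq> 0" "1 - cnj w * b \<noteq> 0" using one_minus_cnj_mult_nonzero assms by auto
  have eq: "(complex_of_real (norm w))\<^sup>2 = w * cnj w" using complex_norm_square[of w] by simp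
  have "(moebius w a - moebius w b) * ((1 - cnj w * a) * (1 - cnj w * b)) = of_real (1 - (norm w)\<^sup>2) * (a - b)"
    using ne eq by (simp add: Moebius_function_simple divide_simps) (simp add: algebra_simps)
  then have "norm ((moebius w a - moebius w b) * ((1 - cnj w * a) * (1 - cnj w * b))) = norm (of_real (1 - (norm w)\<^sup>2) * (a - b))"
    by simp
  moreover have "norm (of_real (1 - (norm w)\<^sup>2) :: complex) = 1 - (norm w)\<^sup>2"
    unfolding norm_of_real using w by (simp add: abs_square_le_1)
  ultimately show ?thesis by (simp only: norm_mult)
qed

text \<open>Moving \<open>\<tau>\<close> to the origin gives \<open>h y = y * g y\<close> with \<open>\<bar>g\<bar> \<le> 1\<close> by Schwarz's lemma, and \<open>g 0\<close>
is the multiplier. The function \<open>q = 1 - g\<close> is the relative displacement in the new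
coordinate.\<close>

lemma self_map_fixing_point:
  assumes f: "holomorphic_self_map f" and \<tau>: "norm \<tau> < 1" and fixp: "f \<tau> = \<tau>"
  obtains q where "q holomorphic_on ball 0 1" "\<And>z. norm z < 1 \<Longrightarrow> 0 \<le> Re (q z)" "q 0 = 1 - deriv f \<tau>"
    "\<And>z. norm z < 1 \<Longrightarrow> moebius \<tau> z - moebius \<tau> (f z) = moebius \<tau> z * q (moebius \<tau> z)"
    "norm (deriv f \<tau>) \<le> 1"
proof -
  define h where "h = moebius \<tau> \<circ> f \<circ> moebius (- \<tau>)"
  note flt = self_map_norm_less[OF f]
  have M: "norm (moebius (- \<tau>) y) < 1" if "norm y < 1" for y
    using Moebius_function_norm_lt_1[of "- \<tau>" y] \<tau> that by simp
  have fM: "f \<circ> moebius (- \<tau>) holomorphic_on ball 0 1"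
    by (rule holomorphic_on_compose_gen[OF Moebius_function_holomorphic]) (use M \<tau> f in \<open>auto simp: holomorphic_self_map_def\<close>)
  have h: "h holomorphic_on ball 0 1" unfolding h_def comp_assoc
    by (rule holomorphic_on_compose_gen[OF fM Moebius_function_holomorphic[OF \<tau>]]) (use M flt in auto)
  have M0: "moebius (- \<tau>) 0 = \<tau>" by (simp add: Moebius_function_of_zero)
  have h0: "h 0 = 0" by (simp add: h_def M0 fixp Moebius_function_eq_zero)
  have hlt: "norm (h y) < 1" if "norm y < 1" for y
    using Moebius_function_norm_lt_1[OF \<tau> flt[OF M[OF that]]] by (simp add: h_def)
  have dh: "deriv h 0 = deriv f \<tau>"
  proof -
    have d1: "(moebius (- \<tau>) has_field_derivative (1 - (norm \<tau>)\<^sup>2)) (at 0)"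
      using Moebius_has_derivative[of "- \<tau>" 0] \<tau> by simp
    have "f field_differentiable at \<tau>"
      using f \<tau> unfolding holomorphic_self_map_def
      by (intro holomorphic_on_imp_differentiable_at[of _ "ball 0 1"]) auto
    then have d2: "(f has_field_derivative deriv f \<tau>) (at (moebius (- \<tau>) 0))"
      unfolding M0 using field_differentiable_derivI by blast
    have d3: "(moebius \<tau> has_field_derivative (1 - (norm \<tau>)\<^sup>2) / (1 - cnj \<tau> * \<tau>)\<^sup>2) (at ((f \<circ> moebius (- \<tau>)) 0))"
      using Moebius_has_derivative[OF \<tau> \<tau>] by (simp add: M0 fixp)
    have eq: "1 - cnj \<tau> * \<tau> = of_real (1 - (norm \<tau>)\<^sup>2)"
      using complex_norm_square[of \<tau>] by (simp add: mult.commute)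
    have ne: "1 - (norm \<tau>)\<^sup>2 \<noteq> 0" using \<tau> abs_square_less_1[of "norm \<tau>"] by simp
    have "(h has_field_derivative ((1 - (norm \<tau>)\<^sup>2) / (1 - cnj \<tau> * \<tau>)\<^sup>2) * (deriv f \<tau> * (1 - (norm \<tau>)\<^sup>2))) (at 0)"
      unfolding h_def comp_assoc by (rule DERIV_chain[OF d3 DERIV_chain[OF d2 d1]])
    moreover have "((1 - (norm \<tau>)\<^sup>2) / (1 - cnj \<tau> * \<tau>)\<^sup>2) * (deriv f \<tau> * (1 - (norm \<tau>)\<^sup>2)) = deriv f \<tau>"
    proof -
      define s where "s = 1 - (complex_of_real (norm \<tau>))\<^sup>2"
      have "s \<noteq> 0" using ne unfolding s_def by (metis eq_iff_diff_eq_0 of_real_1 of_real_eq_iff of_real_power)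
      moreover have "1 - cnj \<tau> * \<tau> = s" using eq by (simp add: s_def)
      moreover have "1 - (complex_of_real (norm \<tau>))\<^sup>2 = s" by (simp add: s_def)
      ultimately show ?thesis by (simp add: power2_eq_square[of s])
    qed
    ultimately show ?thesis by (metis DERIV_imp_deriv)
  qed
  obtain g where g: "g holomorphic_on ball 0 1" "\<And>z. norm z < 1 \<Longrightarrow> h z = z * g z" "deriv h 0 = g 0"
    using Schwarz3[OF h h0] by blast
  have nd: "norm (deriv h 0) \<le> 1" by (rule Schwarz_Lemma(2)[OF h h0 hlt, of 0]) auto
  have g1: "norm (g y) \<le> 1" if y: "norm y < 1" for y
  proof (cases "y = 0")
    case True then show ?thesis using nd g(3) by simp
  next
    case False
    have "norm (y * g y) \<le> norm y" using Schwarz_Lemma(1)[OF h h0 hlt y] g(2)[OF y] by simp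
    then show ?thesis using False by (simp add: norm_mult)
  qed
  show ?thesis
  proof (rule that[of "\<lambda>z. 1 - g z"])
    show "(\<lambda>z. 1 - g z) holomorphic_on ball 0 1" by (intro holomorphic_intros g)
    show "0 \<le> Re (1 - g y)" if "norm y < 1" for y
      using g1[OF that] complex_Re_le_cmod[of "g y"] by simp
    show "1 - g 0 = 1 - deriv f \<tau>" using g(3) dh by simp
    show "norm (deriv f \<tau>) \<le> 1" using nd dh by simp
    fix z :: complex assume z: "norm z < 1"
    have "h (moebius \<tau> z) = moebius \<tau> (f z)"
      by (simp add: h_def Moebius_inverse[OF \<tau> z])
    moreover have "h (moebius \<tau> z) = moebius \<tau> z * g (moebius \<tau> z)"
      by (rule g(2)) (rule Moebius_function_norm_lt_1[OF \<tau> z])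
    ultimately show "moebius \<tau> z - moebius \<tau> (f z) = moebius \<tau> z * (1 - g (moebius \<tau> z))"
      by (simp add: algebra_simps)
  qed
qed

text \<open>Harnack's inequality for the relative displacement \<open>q\<close>, from the point \<open>z0\<close> to the fixed
point. The constant depends on \<open>z0\<close> through its distance to \<open>\<tau>\<close>, by which the displacement
has to be divided.\<close>

lemma interior_derivative_le_displacement:
  assumes \<tau>: "norm \<tau> < 1" and z0: "norm z0 < 1" "z0 \<noteq> \<tau>"
  obtains C where "C \<ge> 0" "\<And>f. holomorphic_self_map f \<Longrightarrow> f \<tau> = \<tau> \<Longrightarrow> norm (deriv f \<tau> - 1) \<le> C * norm (f z0 - z0)"
proof -
  define y where "y = moebius \<tau> z0"
  have y: "norm y < 1" unfolding y_def by (rule Moebius_function_norm_lt_1[OF \<tau> z0(1)])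
  have y0: "y \<noteq> 0"
    using Moebius_inverse[OF \<tau> z0(1)] z0(2) by (auto simp: y_def Moebius_function_of_zero)
  define K where "K = 1 + 16 / (1 - (norm y)\<^sup>2)\<^sup>2"
  define C where "C = K * ((1 - (norm \<tau>)\<^sup>2) / (1 - norm \<tau>)\<^sup>2) / norm y"
  have K: "K \<ge> 0" unfolding K_def by (simp add: add_nonneg_nonneg)
  have t1: "0 \<le> 1 - (norm \<tau>)\<^sup>2" using \<tau> by (simp add: abs_square_le_1)
  show ?thesis
  proof (rule that[of C])
    show "C \<ge> 0" using K t1 by (simp add: C_def)
    fix f assume f: "holomorphic_self_map f" "f \<tau> = \<tau>"
    obtain q where q: "q holomorphic_on ball 0 1" "\<And>z. norm z < 1 \<Longrightarrow> 0 \<le> Re (q z)" "q 0 = 1 - deriv f \<tau>"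
      "\<And>z. norm z < 1 \<Longrightarrow> moebius \<tau> z - moebius \<tau> (f z) = moebius \<tau> z * q (moebius \<tau> z)"
      using self_map_fixing_point[OF f(1) \<tau> f(2)] by metis
    have fz: "norm (f z0) < 1" by (rule self_map_norm_less[OF f(1) z0(1)])
    have "norm (q 0) \<le> K * norm (q y)" unfolding K_def
      by (rule harnack_norm[OF q(1,2) y]) auto
    moreover have "norm (q y) * norm y \<le> (1 - (norm \<tau>)\<^sup>2) / (1 - norm \<tau>)\<^sup>2 * norm (z0 - f z0)"
    proof -
      define D where "D = norm (moebius \<tau> z0 - moebius \<tau> (f z0))"
      have low: "1 - norm \<tau> \<le> norm (1 - cnj \<tau> * a)" if "norm a < 1" for a
      proof -
        have "norm (cnj \<tau> * a) \<le> norm \<tau> * 1" unfolding norm_mult by (rule mult_mono) (use that in auto)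
        then show ?thesis using norm_triangle_ineq2[of 1 "cnj \<tau> * a"] by simp
      qed
      have "D * (1 - norm \<tau>)\<^sup>2 \<le> D * (norm (1 - cnj \<tau> * z0) * norm (1 - cnj \<tau> * f z0))"
        unfolding power2_eq_square
        by (intro mult_left_mono mult_mono low z0 fz) (use \<tau> in \<open>auto simp: D_def\<close>)
      also have "\<dots> = (1 - (norm \<tau>)\<^sup>2) * norm (z0 - f z0)" unfolding D_def by (rule Moebius_diff[OF \<tau> z0(1) fz])
      finally have "D \<le> (1 - (norm \<tau>)\<^sup>2) * norm (z0 - f z0) / (1 - norm \<tau>)\<^sup>2"
        using \<tau> by (simp add: pos_le_divide_eq)
      moreover have "D = norm (q y) * norm y" unfolding D_def q(4)[OF z0(1)] y_def by (simp add: norm_mult)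
      ultimately show ?thesis by simp
    qed
    ultimately have "norm (q 0) \<le> K * ((1 - (norm \<tau>)\<^sup>2) / (1 - norm \<tau>)\<^sup>2 * norm (z0 - f z0) / norm y)"
      using K y0 by (meson mult_left_mono order_trans pos_le_divide_eq zero_less_norm_iff)
    then show "norm (deriv f \<tau> - 1) \<le> C * norm (f z0 - z0)"
      unfolding q(3) C_def by (simp add: norm_minus_commute mult_ac)
  qed
qed

text \<open>The same comparison from the fixed point to \<open>z\<close>, uniformly on pseudo-hyperbolic discs around
\<open>\<tau>\<close>; these are invariant under the maps considered, so an orbit never leaves the disc on
which the constant is valid.\<close>

lemma interior_displacement_le_derivative:
  assumes \<tau>: "norm \<tau> < 1" and r: "r < 1"
  obtains C where "C \<ge> 0" "\<And>f z. holomorphic_self_map f \<Longrightarrow> f \<tau> = \<tau> \<Longrightarrow> norm z < 1 \<Longrightarrow>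
     norm (moebius \<tau> z) \<le> r \<Longrightarrow> norm (f z - z) \<le> C * norm (deriv f \<tau> - 1)"
proof -
  define K where "K = 1 + 16 / (1 - r\<^sup>2)\<^sup>2"
  have K: "K \<ge> 0" unfolding K_def by (simp add: add_nonneg_nonneg)
  have t1: "0 < 1 - (norm \<tau>)\<^sup>2" using \<tau> by (simp add: abs_square_less_1)
  show ?thesis
  proof (rule that[of "4 / (1 - (norm \<tau>)\<^sup>2) * K"])
    show "0 \<le> 4 / (1 - (norm \<tau>)\<^sup>2) * K" using K t1 by simp
    fix f z assume f: "holomorphic_self_map f" "f \<tau> = \<tau>" and z: "norm z < 1" and y: "norm (moebius \<tau> z) \<le> r"
    obtain q where q: "q holomorphic_on ball 0 1" "\<And>z. norm z < 1 \<Longrightarrow> 0 \<le> Re (q z)" "q 0 = 1 - deriv f \<tau>"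
      "\<And>z. norm z < 1 \<Longrightarrow> moebius \<tau> z - moebius \<tau> (f z) = moebius \<tau> z * q (moebius \<tau> z)"
      using self_map_fixing_point[OF f(1) \<tau> f(2)] by metis
    have fz: "norm (f z) < 1" by (rule self_map_norm_less[OF f(1) z])
    define D where "D = norm (moebius \<tau> z - moebius \<tau> (f z))"
    have up: "norm (1 - cnj \<tau> * a) \<le> 2" if "norm a < 1" for a
    proof -
      have "norm (cnj \<tau> * a) \<le> 1 * 1" unfolding norm_mult by (rule mult_mono) (use that \<tau> in auto)
      then show ?thesis using norm_triangle_ineq4[of 1 "cnj \<tau> * a"] by simp
    qed
    have "(1 - (norm \<tau>)\<^sup>2) * norm (z - f z) = D * (norm (1 - cnj \<tau> * z) * norm (1 - cnj \<tau> * f z))"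
      unfolding D_def by (rule Moebius_diff[OF \<tau> z fz, symmetric])
    also have "\<dots> \<le> D * (2 * 2)" by (intro mult_left_mono mult_mono up z fz) (auto simp: D_def)
    also have "D = norm (moebius \<tau> z) * norm (q (moebius \<tau> z))"
      unfolding D_def q(4)[OF z] by (rule norm_mult)
    also have "\<dots> \<le> 1 * (K * norm (q 0))"
    proof (rule mult_mono)
      have "0 \<le> r" using y norm_ge_zero order_trans by blast
      then show "norm (q (moebius \<tau> z)) \<le> K * norm (q 0)" unfolding K_def
        by (intro harnack_norm[OF q(1,2) r _ y]) auto
    qed (use y r in auto)
    finally have "(1 - (norm \<tau>)\<^sup>2) * norm (z - f z) \<le> 4 * (K * norm (q 0))" by simp
    then have "norm (z - f z) \<le> 4 * (K * norm (q 0)) / (1 - (norm \<tau>)\<^sup>2)"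
      using t1 by (simp add: pos_le_divide_eq mult.commute)
    then show "norm (f z - z) \<le> 4 / (1 - (norm \<tau>)\<^sup>2) * K * norm (deriv f \<tau> - 1)"
      unfolding q(3) by (simp add: norm_minus_commute)
  qed
qed

lemma deriv_compose_fixed_point:
  assumes f: "holomorphic_self_map f" and g: "holomorphic_self_map g" and h: "\<And>z. norm z < 1 \<Longrightarrow> h z = g (f z)"
    and \<tau>: "norm \<tau> < 1" and fixp: "f \<tau> = \<tau>"
  shows "deriv h \<tau> = deriv g \<tau> * deriv f \<tau>"
proof -
  have d: "(k has_field_derivative deriv k \<tau>) (at \<tau>)" if "holomorphic_self_map k" for k
    using that \<tau> unfolding holomorphic_self_map_def
    by (intro field_differentiable_derivI holomorphic_on_imp_differentiable_at[of _ "ball 0 1"]) auto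
  have "((g \<circ> f) has_field_derivative deriv g \<tau> * deriv f \<tau>) (at \<tau>)"
    by (rule DERIV_chain) (use d[OF f] d[OF g] fixp in auto)
  then have "(h has_field_derivative deriv g \<tau> * deriv f \<tau>) (at \<tau>)"
    by (rule has_field_derivative_transform_within_open[where S = "ball 0 1"]) (use \<tau> h in auto)
  then show ?thesis by (rule DERIV_imp_deriv)
qed

section \<open>The Julia--Wolff--Caratheodory theorem\<close>

text \<open>The conformal map of the unit disc onto the right half-plane that sends \<open>\<tau>\<close> to infinity. The
level lines of its real part are the horocycles at \<open>\<tau>\<close>.\<close>

definition cayley :: "complex \<Rightarrow> complex \<Rightarrow> complex" where
  "cayley \<tau> z = (\<tau> + z) / (\<tau> - z)"

lemma boundary_point_neq: "norm \<tau> = 1 \<Longrightarrow> norm z < 1 \<Longrightarrow> \<tau> - z \<noteq> (0::complex)"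
  by auto

lemma Re_cayley:
  assumes "norm \<tau> = 1"
  shows "Re (cayley \<tau> z) = (1 - (norm z)\<^sup>2) / (norm (\<tau> - z))\<^sup>2"
proof -
  have "(Re \<tau>)\<^sup>2 + (Im \<tau>)\<^sup>2 = 1" using assms cmod_power2[of \<tau>] by simp
  then show ?thesis unfolding cayley_def Re_divide cmod_power2
    by (simp add: power2_eq_square algebra_simps)
qed

lemma Re_cayley_pos:
  assumes "norm \<tau> = 1" "norm z < 1" shows "0 < Re (cayley \<tau> z)"
proof -
  have "0 < 1 - (norm z)\<^sup>2" using assms by (simp add: abs_square_less_1)
  moreover have "0 < (norm (\<tau> - z))\<^sup>2" using boundary_point_neq[OF assms] by simp
  ultimately show ?thesis unfolding Re_cayley[OF assms(1)] by (rule divide_pos_pos)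
qed

lemma cayley_plus_one:
  assumes "norm \<tau> = 1" "norm z < 1"
  shows "(cayley \<tau> z + 1) * (\<tau> - z) = 2 * \<tau>"
  using boundary_point_neq[OF assms] by (simp add: cayley_def field_simps)

lemma norm_cayley_diff:
  assumes "norm \<tau> = 1" "norm a < 1" "norm b < 1"
  shows "norm (cayley \<tau> a - cayley \<tau> b) * (norm (\<tau> - a) * norm (\<tau> - b)) = 2 * norm (a - b)"
proof -
  have "(cayley \<tau> a - cayley \<tau> b) * ((\<tau> - a) * (\<tau> - b)) = 2 * \<tau> * (a - b)"
    using boundary_point_neq[OF assms(1,2)] boundary_point_neq[OF assms(1,3)]
    by (simp add: cayley_def divide_simps) (simp add: algebra_simps)
  then have "norm ((cayley \<tau> a - cayley \<tau> b) * ((\<tau> - a) * (\<tau> - b))) = norm (2 * \<tau> * (a - b))" by simp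
  then show ?thesis using assms(1) by (simp add: norm_mult)
qed

lemma cayley_holomorphic:
  assumes "norm \<tau> = 1" shows "cayley \<tau> holomorphic_on ball 0 1"
  unfolding cayley_def by (intro holomorphic_intros) (use boundary_point_neq[OF assms] in auto)

lemma norm_one_minus_cnj_boundary:
  assumes "norm \<tau> = 1"
  shows "norm (1 - cnj \<tau> * z) = norm (\<tau> - z)" and "norm (1 - cnj z * \<tau>) = norm (\<tau> - z)"
proof -
  have t: "\<tau> * cnj \<tau> = 1" using complex_norm_square[of \<tau>] assms by simp
  have "\<tau> * (1 - cnj \<tau> * z) = \<tau> - z" using t by (simp add: algebra_simps)
  then have "norm (\<tau> * (1 - cnj \<tau> * z)) = norm (\<tau> - z)" by simp
  then show *: "norm (1 - cnj \<tau> * z) = norm (\<tau> - z)" using assms by (simp add: norm_mult)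
  have "cnj (1 - cnj z * \<tau>) = 1 - cnj \<tau> * z" by (simp add: mult.commute)
  then show "norm (1 - cnj z * \<tau>) = norm (\<tau> - z)" using * complex_mod_cnj by metis
qed

text \<open>Equivalently, \<open>f\<close> maps every horodisc at \<open>\<tau>\<close> into itself.\<close>

definition horocycle_invariant :: "(complex \<Rightarrow> complex) \<Rightarrow> complex \<Rightarrow> bool" where
  "horocycle_invariant f \<tau> \<longleftrightarrow> (\<forall>z\<in>unit_disc. Re (cayley \<tau> z) \<le> Re (cayley \<tau> (f z)))"

text \<open>Apply the Schwarz--Pick inequality to \<open>z\<close> and the \<open>n\<close>-th iterate \<open>x n\<close> of the origin. The
factors \<open>b n = 1 - \<bar>x n\<bar>\<^sup>2\<close> are positive and tend to zero, so \<open>b (Suc n) \<le> b n\<close> infinitely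
often; along these \<open>n\<close> they cancel in the favourable direction, and the limit is the claim
because \<open>x n\<close> tends to \<open>\<tau>\<close>.\<close>

lemma wolff_lemma:
  assumes f: "holomorphic_self_map f" and \<tau>: "norm \<tau> = 1" and lim: "(\<lambda>n. (f ^^ n) 0) \<longlonglongrightarrow> \<tau>"
  shows "horocycle_invariant f \<tau>"
  unfolding horocycle_invariant_def
proof (rule ballI, rule ccontr)
  fix z assume "z \<in> unit_disc" and less: "\<not> Re (cayley \<tau> z) \<le> Re (cayley \<tau> (f z))"
  then have z: "norm z < 1" by simp
  have fz: "norm (f z) < 1" by (rule self_map_norm_less[OF f z])
  define x where "x = (\<lambda>n. (f ^^ n) 0)"
  have xS: "x (Suc n) = f (x n)" for n by (simp add: x_def)
  have x1: "norm (x n) < 1" for n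
  proof (induction n)
    case (Suc n) then show ?case using self_map_norm_less[OF f] xS by simp
  qed (simp add: x_def)
  have xl: "x \<longlonglongrightarrow> \<tau>" using lim by (simp add: x_def)
  have xl': "(\<lambda>n. f (x n)) \<longlonglongrightarrow> \<tau>" using LIMSEQ_Suc[OF xl] by (simp add: xS)
  define b where "b = (\<lambda>n. 1 - (norm (x n))\<^sup>2)"
  have b0: "b n > 0" for n using x1[of n] by (simp add: b_def abs_square_less_1)
  have "b \<longlonglongrightarrow> 1 - (norm \<tau>)\<^sup>2" unfolding b_def by (intro tendsto_intros xl)
  then have bl: "b \<longlonglongrightarrow> 0" using \<tau> by simp
  have io: "\<exists>n\<ge>N. b (Suc n) \<le> b n" for N
  proof (rule ccontr)
    assume "\<not> (\<exists>n\<ge>N. b (Suc n) \<le> b n)"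
    then have inc: "b n < b (Suc n)" if "n \<ge> N" for n using that by (meson not_le)
    have "b N \<le> b n" if "n \<ge> N" for n
      using that by (induction n rule: dec_induct) (use inc in \<open>auto intro: order_trans less_imp_le\<close>)
    then have "b N \<le> 0" by (intro LIMSEQ_le_const[OF bl]) auto
    then show False using b0[of N] by simp
  qed
  define L where "L = (\<lambda>n. (1 - (norm z)\<^sup>2) / (norm (1 - cnj (x n) * z))\<^sup>2)"
  define R where "R = (\<lambda>n. (1 - (norm (f z))\<^sup>2) / (norm (1 - cnj (f (x n)) * f z))\<^sup>2)"
  have "L \<longlonglongrightarrow> (1 - (norm z)\<^sup>2) / (norm (1 - cnj \<tau> * z))\<^sup>2"
    unfolding L_def using boundary_point_neq[OF \<tau> z]
    by (intro tendsto_intros xl) (simp add: norm_one_minus_cnj_boundary[OF \<tau>])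
  then have Ll: "L \<longlonglongrightarrow> Re (cayley \<tau> z)" by (simp add: Re_cayley[OF \<tau>] norm_one_minus_cnj_boundary[OF \<tau>])
  have "R \<longlonglongrightarrow> (1 - (norm (f z))\<^sup>2) / (norm (1 - cnj \<tau> * f z))\<^sup>2"
    unfolding R_def using boundary_point_neq[OF \<tau> fz]
    by (intro tendsto_intros xl') (simp add: norm_one_minus_cnj_boundary[OF \<tau>])
  then have Rl: "R \<longlonglongrightarrow> Re (cayley \<tau> (f z))" by (simp add: Re_cayley[OF \<tau>] norm_one_minus_cnj_boundary[OF \<tau>])
  have "(\<lambda>n. L n - R n) \<longlonglongrightarrow> Re (cayley \<tau> z) - Re (cayley \<tau> (f z))" by (intro tendsto_intros Ll Rl)
  then have "eventually (\<lambda>n. 0 < L n - R n) sequentially"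
    by (rule order_tendstoD) (use less in simp)
  then obtain N where N: "\<And>n. n \<ge> N \<Longrightarrow> R n < L n" by (auto simp: eventually_sequentially)
  obtain n where n: "n \<ge> N" "b (Suc n) \<le> b n" using io by blast
  have "b n * L n \<le> b (Suc n) * R n"
    using schwarz_pick_quotient[OF f x1[of n] z] by (simp add: b_def L_def R_def xS)
  also have "\<dots> \<le> b n * R n"
  proof (rule mult_right_mono[OF n(2)])
    show "0 \<le> R n" using fz by (simp add: R_def abs_square_le_1)
  qed
  finally have "L n \<le> R n" using b0[of n] by simp
  then show False using N[OF n(1)] by simp
qed

lemma denjoy_wolff_horocycle_invariant:
  assumes f: "holomorphic_self_map f" and \<tau>: "norm \<tau> = 1"
    and dw: "\<exists>z\<in>unit_disc. f z \<noteq> z \<Longrightarrow> is_Denjoy_Wolff_point f \<tau>"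
  shows "horocycle_invariant f \<tau>"
proof (cases "\<exists>z\<in>unit_disc. f z \<noteq> z")
  case False
  then show ?thesis by (auto simp: horocycle_invariant_def)
next
  case True
  have all: "\<forall>K. compact K \<and> K \<subseteq> unit_disc \<longrightarrow> uniform_limit K (\<lambda>n. f ^^ n) (\<lambda>_. \<tau>) sequentially"
    using dw[OF True] \<tau> unfolding is_Denjoy_Wolff_point_def by (auto split: if_splits)
  have "uniform_limit {0} (\<lambda>n. f ^^ n) (\<lambda>_. \<tau>) sequentially"
    by (rule all[THEN spec, THEN mp]) simp
  then have "(\<lambda>n. (f ^^ n) 0) \<longlonglongrightarrow> \<tau>" by (rule tendsto_uniform_limitI) simp
  then show ?thesis by (rule wolff_lemma[OF f \<tau>])
qed

lemma radial_approach:
  assumes \<tau>: "norm \<tau> = 1" and M: "M > 1"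
  shows "filterlim (\<lambda>r. of_real r * \<tau>) (at \<tau> within stolz_region \<tau> M) (at_left (1::real))"
  unfolding filterlim_at
proof
  have "((\<lambda>r. of_real r * \<tau>) \<longlongrightarrow> of_real 1 * \<tau>) (at_left (1::real))" by (intro tendsto_intros)
  then show "((\<lambda>r. of_real r * \<tau>) \<longlongrightarrow> \<tau>) (at_left (1::real))" by simp
  have "\<forall>\<^sub>F r in at_left (1::real). 0 < r \<and> r < 1"
    using eventually_at_left_real[of 0 "1::real"] by (auto elim: eventually_mono)
  then show "\<forall>\<^sub>F r in at_left (1::real). of_real r * \<tau> \<in> stolz_region \<tau> M \<and> of_real r * \<tau> \<noteq> \<tau>"
  proof eventually_elim
    case (elim r)
    have n: "norm (of_real r * \<tau>) = r" using elim \<tau> by (simp add: norm_mult)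
    have eq: "of_real r * \<tau> - \<tau> = of_real (r - 1) * \<tau>" by (simp add: algebra_simps)
    have "norm (of_real r * \<tau> - \<tau>) = \<bar>r - 1\<bar>"
      unfolding eq norm_mult norm_of_real \<tau> by simp
    then have d: "norm (of_real r * \<tau> - \<tau>) = 1 - r" using elim by simp
    have "1 * (1 - r) < M * (1 - r)" by (rule mult_strict_right_mono) (use elim M in auto)
    then have "of_real r * \<tau> \<in> stolz_region \<tau> M"
      unfolding stolz_region_def mem_Collect_eq d n using elim n by simp
    moreover have "of_real r * \<tau> \<noteq> \<tau>"
    proof
      assume "of_real r * \<tau> = \<tau>"
      then show False using d elim by simp
    qed
    ultimately show ?case by (rule conjI)
  qed
qed

lemma has_angular_limit_radial:
  assumes "has_angular_limit g \<tau> L" "filterlim \<gamma> (at \<tau> within stolz_region \<tau> M) F" "M > 1"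
  shows "((\<lambda>r. g (\<gamma> r)) \<longlongrightarrow> L) F"
proof -
  have "(g \<longlongrightarrow> L) (at \<tau> within stolz_region \<tau> M)"
    using assms(1,3) unfolding has_angular_limit_def by blast
  then show ?thesis using assms(2) by (rule filterlim_compose)
qed

lemma has_angular_limit_unique:
  assumes \<tau>: "norm \<tau> = 1" and "has_angular_limit g \<tau> L1" "has_angular_limit g \<tau> L2"
  shows "L1 = L2"
proof -
  have lim: "((\<lambda>r. g (of_real r * \<tau>)) \<longlongrightarrow> L) (at_left (1::real))" if "has_angular_limit g \<tau> L" for L
    by (rule has_angular_limit_radial[OF that radial_approach[OF \<tau>, of 2]]) simp_all
  show ?thesis
    by (rule tendsto_unique[OF trivial_limit_at_left_real lim[OF assms(2)] lim[OF assms(3)]])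
qed

text \<open>Let \<open>c\<close> be the infimum of \<open>R z\<close>, the quotient of the real parts of the transforms of \<open>f z\<close>
and \<open>z\<close>. Then \<open>p = cayley (f z) - c * cayley z\<close> has nonnegative real part, and at suitable
\<open>z1\<close> this real part is at most \<open>\<epsilon>'\<close> times that of \<open>cayley z1\<close>. Harnack's inequality based at
\<open>z1\<close> then shows that \<open>(\<tau> - z) * p z\<close> becomes small in each Stolz region, that is, \<open>p\<close> is
negligible against \<open>cayley\<close> at \<open>\<tau>\<close>.\<close>

lemma julia_wolff_caratheodory:
  assumes f: "holomorphic_self_map f" and \<tau>: "norm \<tau> = 1" and inv: "horocycle_invariant f \<tau>"
  obtains c where "c \<ge> 1" "\<And>z. norm z < 1 \<Longrightarrow> c * Re (cayley \<tau> z) \<le> Re (cayley \<tau> (f z))"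
    "has_angular_limit (\<lambda>z. (f z - \<tau>) / (z - \<tau>)) \<tau> (of_real (1 / c))"
    "angular_deriv f \<tau> = of_real (1 / c)"
proof -
  note flt = self_map_norm_less[OF f]
  define R where "R = (\<lambda>z. Re (cayley \<tau> (f z)) / Re (cayley \<tau> z))"
  have R1: "1 \<le> R z" if "z \<in> unit_disc" for z
    using inv that Re_cayley_pos[OF \<tau>, of z] unfolding horocycle_invariant_def R_def by simp
  define c where "c = (INF z\<in>unit_disc. R z)"
  have c1: "c \<ge> 1" unfolding c_def by (rule cINF_greatest) (use R1 in auto)
  have bdd: "bdd_below (R ` unit_disc)" using R1 by (intro bdd_belowI[of _ 1]) auto
  have cR: "c \<le> R z" if "norm z < 1" for z unfolding c_def by (rule cINF_lower[OF bdd]) (use that in simp)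
  have dom: "c * Re (cayley \<tau> z) \<le> Re (cayley \<tau> (f z))" if "norm z < 1" for z
    using cR[OF that] Re_cayley_pos[OF \<tau> that] by (simp add: R_def pos_le_divide_eq)
  define p where "p = (\<lambda>z. cayley \<tau> (f z) - of_real c * cayley \<tau> z)"
  have cf: "(cayley \<tau> \<circ> f) holomorphic_on ball 0 1"
    by (rule holomorphic_on_compose_gen[OF _ cayley_holomorphic[OF \<tau>]]) (use f in \<open>auto simp: holomorphic_self_map_def\<close>)
  then have p: "p holomorphic_on ball 0 1" unfolding p_def
    by (intro holomorphic_intros cayley_holomorphic[OF \<tau>]) (simp add: o_def)
  have Rep: "0 \<le> Re (p z)" if "norm z < 1" for z using dom[OF that] by (simp add: p_def)
  have lim: "((\<lambda>z. (f z - \<tau>) / (z - \<tau>)) \<longlongrightarrow> of_real (1 / c)) (at \<tau> within stolz_region \<tau> M)" if M: "M > 1" for M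
  proof -
    let ?F = "at \<tau> within stolz_region \<tau> M"
    have evS: "eventually (\<lambda>z. z \<in> stolz_region \<tau> M \<and> z \<noteq> \<tau>) ?F"
      by (simp add: eventually_at_filter)
    have idl: "((\<lambda>z. z) \<longlongrightarrow> \<tau>) ?F" by (rule tendsto_ident_at)
    have "((\<lambda>z. (\<tau> - z) * p z) \<longlongrightarrow> 0) ?F"
    proof (rule tendstoI)
      fix \<epsilon> :: real assume \<epsilon>: "\<epsilon> > 0"
      \<comment> \<open>In the Stolz region \<open>\<bar>\<tau> - z\<bar> \<le> M * (1 - \<bar>z\<bar>\<^sup>2)\<close>, so the bound \<open>H\<close> below tends to
        \<open>4 * \<epsilon>' * M\<close>.\<close>
      define \<epsilon>' where "\<epsilon>' = \<epsilon> / (8 * M)"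
      have \<epsilon>': "\<epsilon>' > 0" "4 * \<epsilon>' * M < \<epsilon>" using \<epsilon> M by (simp_all add: \<epsilon>'_def field_simps)
      have "(INF z\<in>unit_disc. R z) < c + \<epsilon>'" using \<epsilon>' by (simp add: c_def)
      then obtain z1 where z1: "norm z1 < 1" "R z1 < c + \<epsilon>'"
        using cINF_less_iff[OF _ bdd] by auto
      have "Re (p z1) \<le> \<epsilon>' * Re (cayley \<tau> z1)"
        using z1 Re_cayley_pos[OF \<tau> z1(1)] by (simp add: R_def p_def pos_divide_less_eq algebra_simps)
      then have pz1: "Re (p z1) \<le> \<epsilon>' * ((1 - (norm z1)\<^sup>2) / (norm (\<tau> - z1))\<^sup>2)" by (simp add: Re_cayley[OF \<tau>])
      have n1: "norm (\<tau> - z1) > 0" using boundary_point_neq[OF \<tau> z1(1)] by simp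
      have s1: "1 - (norm z1)\<^sup>2 > 0" using z1 by (simp add: abs_square_less_1)
      define H where "H = (\<lambda>z. norm (p z1) * norm (\<tau> - z) + 4 * \<epsilon>' * M * (norm (1 - cnj z1 * z))\<^sup>2 / (norm (\<tau> - z1))\<^sup>2)"
      have bound: "norm ((\<tau> - z) * p z) \<le> H z" if "z \<in> stolz_region \<tau> M" for z
      proof -
        have z: "norm z < 1" and zM: "norm (\<tau> - z) < M * (1 - norm z)"
          using that unfolding stolz_region_def by (auto simp: norm_minus_commute)
        have s: "1 - (norm z)\<^sup>2 > 0" using z by (simp add: abs_square_less_1)
        have "norm z * norm z \<le> norm z * 1" using z by (intro mult_left_mono) auto
        then have "1 - norm z \<le> 1 - (norm z)\<^sup>2" by (simp add: power2_eq_square)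
        then have "M * (1 - norm z) \<le> M * (1 - (norm z)\<^sup>2)" using M by (intro mult_left_mono) auto
        then have zM': "norm (\<tau> - z) \<le> M * (1 - (norm z)\<^sup>2)" using zM by linarith
        define E where "E = 4 * (norm (1 - cnj z1 * z))\<^sup>2"
        have E0: "E \<ge> 0" by (simp add: E_def)
        have "norm (p z - p z1) \<le> E / ((1 - (norm z1)\<^sup>2) * (1 - (norm z)\<^sup>2)) * Re (p z1)"
          unfolding E_def by (rule harnack[OF p Rep z1(1) z])
        also have "\<dots> \<le> E / ((1 - (norm z1)\<^sup>2) * (1 - (norm z)\<^sup>2)) * (\<epsilon>' * ((1 - (norm z1)\<^sup>2) / (norm (\<tau> - z1))\<^sup>2))"
          by (rule mult_left_mono[OF pz1]) (use s s1 E0 in simp)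
        also have "\<dots> = \<epsilon>' * E / (norm (\<tau> - z1))\<^sup>2 / (1 - (norm z)\<^sup>2)"
          using s1 by (simp add: mult.commute)
        finally have d: "norm (p z - p z1) \<le> \<epsilon>' * E / (norm (\<tau> - z1))\<^sup>2 / (1 - (norm z)\<^sup>2)" .
        have "norm (\<tau> - z) * norm (p z - p z1) \<le> (M * (1 - (norm z)\<^sup>2)) * (\<epsilon>' * E / (norm (\<tau> - z1))\<^sup>2 / (1 - (norm z)\<^sup>2))"
          by (rule mult_mono[OF zM' d]) (use M s in auto)
        also have "\<dots> = M * (\<epsilon>' * E / (norm (\<tau> - z1))\<^sup>2)" using s by simp
        finally have "norm (\<tau> - z) * norm (p z - p z1) \<le> M * (\<epsilon>' * E / (norm (\<tau> - z1))\<^sup>2)" .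
        moreover have "norm (\<tau> - z) * norm (p z) \<le> norm (\<tau> - z) * (norm (p z1) + norm (p z - p z1))"
          by (rule mult_left_mono) (use norm_triangle_ineq[of "p z1" "p z - p z1"] in simp_all)
        moreover have "H z = norm (\<tau> - z) * norm (p z1) + M * (\<epsilon>' * E / (norm (\<tau> - z1))\<^sup>2)"
          by (simp add: H_def E_def mult_ac)
        ultimately show ?thesis unfolding norm_mult distrib_left by linarith
      qed
      have "(H \<longlongrightarrow> norm (p z1) * norm (\<tau> - \<tau>) + 4 * \<epsilon>' * M * (norm (1 - cnj z1 * \<tau>))\<^sup>2 / (norm (\<tau> - z1))\<^sup>2) ?F"
        unfolding H_def by (intro tendsto_intros idl) (use n1 in auto)
      then have "(H \<longlongrightarrow> 4 * \<epsilon>' * M) ?F"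
        using n1 by (simp add: norm_one_minus_cnj_boundary(2)[OF \<tau>] mult.assoc)
      then have "eventually (\<lambda>z. H z < \<epsilon>) ?F" by (rule order_tendstoD) (fact \<epsilon>'(2))
      then show "eventually (\<lambda>z. dist ((\<tau> - z) * p z) 0 < \<epsilon>) ?F"
        using evS by eventually_elim (use bound in \<open>auto simp: dist_norm intro: le_less_trans\<close>)
    qed
    then have "((\<lambda>z. (\<tau> - z) * p z + of_real c * (\<tau> + z) + (\<tau> - z)) \<longlongrightarrow> 0 + of_real c * (\<tau> + \<tau>) + (\<tau> - \<tau>)) ?F"
      by (intro tendsto_intros idl)
    then have "((\<lambda>z. 2 * \<tau> / ((\<tau> - z) * p z + of_real c * (\<tau> + z) + (\<tau> - z))) \<longlongrightarrow> 2 * \<tau> / (0 + of_real c * (\<tau> + \<tau>) + (\<tau> - \<tau>))) ?F"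
      using \<tau> c1 by (intro tendsto_divide tendsto_const) auto
    moreover have "2 * \<tau> / (0 + of_real c * (\<tau> + \<tau>) + (\<tau> - \<tau>)) = of_real (1 / c)"
      using \<tau> c1 by (auto simp: field_simps)
    moreover have "eventually (\<lambda>z. 2 * \<tau> / ((\<tau> - z) * p z + of_real c * (\<tau> + z) + (\<tau> - z)) = (f z - \<tau>) / (z - \<tau>)) ?F"
      using evS
    proof eventually_elim
      case (elim z)
      then have z: "norm z < 1" unfolding stolz_region_def by auto
      have nz: "\<tau> - z \<noteq> 0" "\<tau> - f z \<noteq> 0" using boundary_point_neq[OF \<tau>] z flt[OF z] by auto
      have "(\<tau> - z) * cayley \<tau> z = \<tau> + z" using nz by (simp add: cayley_def)
      then have "(\<tau> - z) * p z + of_real c * (\<tau> + z) + (\<tau> - z) = (\<tau> - z) * (cayley \<tau> (f z) + 1)"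
        by (simp add: p_def algebra_simps)
      also have "\<dots> = (\<tau> - z) * (2 * \<tau> / (\<tau> - f z))"
        using cayley_plus_one[OF \<tau> flt[OF z]] nz by (simp add: eq_divide_eq)
      finally have eq: "(\<tau> - z) * p z + of_real c * (\<tau> + z) + (\<tau> - z) = (\<tau> - z) * (2 * \<tau> / (\<tau> - f z))" .
      have "2 * \<tau> / ((\<tau> - z) * p z + of_real c * (\<tau> + z) + (\<tau> - z)) = (\<tau> - f z) / (\<tau> - z)"
        unfolding eq using nz \<tau> by auto
      also have "\<dots> = (f z - \<tau>) / (z - \<tau>)" by (metis minus_diff_eq minus_divide_divide)
      finally show ?case .
    qed
    ultimately show ?thesis by (simp add: tendsto_cong)
  qed
  then have al: "has_angular_limit (\<lambda>z. (f z - \<tau>) / (z - \<tau>)) \<tau> (of_real (1 / c))"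
    unfolding has_angular_limit_def by blast
  have "angular_deriv f \<tau> = of_real (1 / c)"
    unfolding angular_deriv_def
  proof (rule the_equality)
    show "has_angular_limit (\<lambda>z. (f z - \<tau>) / (z - \<tau>)) \<tau> (of_real (1 / c))" by (rule al)
    show "L = of_real (1 / c)" if "has_angular_limit (\<lambda>z. (f z - \<tau>) / (z - \<tau>)) \<tau> L" for L
      by (rule has_angular_limit_unique[OF \<tau> that al])
  qed
  then show ?thesis using that[OF c1 dom al] by blast
qed

text \<open>Along the radius ending at \<open>\<tau>\<close> the difference quotient of \<open>g \<circ> f\<close> is the product of those of
\<open>g\<close> and \<open>f\<close>. It has to be checked that \<open>f\<close> maps the end of the radius into a Stolz region,
where the angular limit for \<open>g\<close> is available. This follows from the exact value of the limit
for \<open>f\<close> combined with the horocycle estimate with the same constant \<open>a\<close>.\<close>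

lemma angular_deriv_compose:
  assumes f: "holomorphic_self_map f" "horocycle_invariant f \<tau>" and g: "holomorphic_self_map g" "horocycle_invariant g \<tau>"
    and h: "holomorphic_self_map h" "horocycle_invariant h \<tau>" and comp: "\<And>z. norm z < 1 \<Longrightarrow> h z = g (f z)"
    and \<tau>: "norm \<tau> = 1"
  shows "angular_deriv h \<tau> = angular_deriv g \<tau> * angular_deriv f \<tau>"
proof -
  obtain a where a: "a \<ge> 1" "\<And>z. norm z < 1 \<Longrightarrow> a * Re (cayley \<tau> z) \<le> Re (cayley \<tau> (f z))"
    "has_angular_limit (\<lambda>z. (f z - \<tau>) / (z - \<tau>)) \<tau> (of_real (1 / a))" "angular_deriv f \<tau> = of_real (1 / a)"
    using julia_wolff_caratheodory[OF f(1) \<tau> f(2)] by metis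
  obtain b where b: "has_angular_limit (\<lambda>z. (g z - \<tau>) / (z - \<tau>)) \<tau> (of_real (1 / b))" "angular_deriv g \<tau> = of_real (1 / b)"
    using julia_wolff_caratheodory[OF g(1) \<tau> g(2)] by metis
  obtain c where c: "has_angular_limit (\<lambda>z. (h z - \<tau>) / (z - \<tau>)) \<tau> (of_real (1 / c))" "angular_deriv h \<tau> = of_real (1 / c)"
    using julia_wolff_caratheodory[OF h(1) \<tau> h(2)] by metis
  define \<gamma> where "\<gamma> = (\<lambda>r::real. of_real r * \<tau>)"
  have rad: "filterlim \<gamma> (at \<tau> within stolz_region \<tau> 2) (at_left 1)"
    unfolding \<gamma>_def by (rule radial_approach[OF \<tau>]) simp
  have ev: "\<forall>\<^sub>F r in at_left (1::real). 0 < r \<and> r < 1"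
    using eventually_at_left_real[of 0 "1::real"] by (auto elim: eventually_mono)
  have \<gamma>n: "norm (\<gamma> r) = r" "\<gamma> r - \<tau> = of_real (r - 1) * \<tau>" if "0 < r \<and> r < 1" for r
    using that \<tau> by (simp_all add: \<gamma>_def norm_mult algebra_simps)
  have fq: "((\<lambda>r. (f (\<gamma> r) - \<tau>) / (\<gamma> r - \<tau>)) \<longlongrightarrow> of_real (1 / a)) (at_left 1)"
    by (rule has_angular_limit_radial[OF a(3) rad]) simp
  have hq: "((\<lambda>r. (h (\<gamma> r) - \<tau>) / (\<gamma> r - \<tau>)) \<longlongrightarrow> of_real (1 / c)) (at_left 1)"
    by (rule has_angular_limit_radial[OF c(1) rad]) simp
  have "filterlim (\<lambda>r. f (\<gamma> r)) (at \<tau> within stolz_region \<tau> 2) (at_left 1)"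
    unfolding filterlim_at
  proof
    have "(\<gamma> \<longlongrightarrow> \<tau>) (at_left 1)" using rad by (simp add: filterlim_at)
    then have "((\<lambda>r. (f (\<gamma> r) - \<tau>) / (\<gamma> r - \<tau>) * (\<gamma> r - \<tau>) + \<tau>) \<longlongrightarrow> of_real (1 / a) * (\<tau> - \<tau>) + \<tau>) (at_left 1)"
      by (intro tendsto_intros fq)
    then have "((\<lambda>r. (f (\<gamma> r) - \<tau>) / (\<gamma> r - \<tau>) * (\<gamma> r - \<tau>) + \<tau>) \<longlongrightarrow> \<tau>) (at_left 1)" by simp
    moreover have "\<forall>\<^sub>F r in at_left 1. (f (\<gamma> r) - \<tau>) / (\<gamma> r - \<tau>) * (\<gamma> r - \<tau>) + \<tau> = f (\<gamma> r)"
      using ev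
    proof eventually_elim
      case (elim r)
      then have "\<gamma> r \<noteq> \<tau>" using \<gamma>n(1)[OF elim] \<tau> by auto
      then show ?case by simp
    qed
    ultimately show "((\<lambda>r. f (\<gamma> r)) \<longlongrightarrow> \<tau>) (at_left 1)" by (simp add: tendsto_cong)
    have "((\<lambda>r. a * (1 + r) * norm ((f (\<gamma> r) - \<tau>) / (\<gamma> r - \<tau>))) \<longlongrightarrow> a * (1 + 1) * norm (complex_of_real (1 / a))) (at_left 1)"
      by (intro tendsto_intros fq)
    then have "((\<lambda>r. a * (1 + r) * norm ((f (\<gamma> r) - \<tau>) / (\<gamma> r - \<tau>))) \<longlongrightarrow> 2) (at_left 1)"
      using a(1) by (simp add: norm_divide)
    then have "\<forall>\<^sub>F r in at_left 1. 1 < a * (1 + r) * norm ((f (\<gamma> r) - \<tau>) / (\<gamma> r - \<tau>))"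
      by (rule order_tendstoD) simp
    then show "\<forall>\<^sub>F r in at_left 1. f (\<gamma> r) \<in> stolz_region \<tau> 2 \<and> f (\<gamma> r) \<noteq> \<tau>"
      using ev
    proof eventually_elim
      case (elim r)
      have r: "0 < r" "r < 1" using elim by auto
      have \<gamma>1: "norm (\<gamma> r) < 1" using \<gamma>n(1)[of r] elim by simp
      have f1: "norm (f (\<gamma> r)) < 1" by (rule self_map_norm_less[OF f(1) \<gamma>1])
      have ng: "norm (\<gamma> r - \<tau>) = 1 - r" unfolding \<gamma>n(2)[OF elim(2)] norm_mult norm_of_real \<tau> using r by simp
      define D where "D = norm (\<tau> - f (\<gamma> r))"
      have D: "D > 0" using boundary_point_neq[OF \<tau> f1] by (simp add: D_def)
      have "1 < a * (1 + r) * (D / (1 - r))"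
        using elim(1) ng by (simp add: D_def norm_divide norm_minus_commute)
      then have A: "1 - r < a * (1 + r) * D" using r by (simp add: field_simps)
      \<comment> \<open>Since \<open>a * (1 + r) * D / (1 - r)\<close> tends to \<open>2\<close>, the horocycle estimate
        \<open>a * (1 + r) * D\<^sup>2 \<le> 2 * (1 - \<bar>f (\<gamma> r)\<bar>) * (1 - r)\<close> gives \<open>D < 2 * (1 - \<bar>f (\<gamma> r)\<bar>)\<close>
        near the end of the radius.\<close>
      have "Re (cayley \<tau> (\<gamma> r)) = (1 + r) / (1 - r)"
      proof -
        have "Re (cayley \<tau> (\<gamma> r)) = (1 - r\<^sup>2) / (1 - r)\<^sup>2"
          using ng \<gamma>n(1)[of r] r by (simp add: Re_cayley[OF \<tau>] norm_minus_commute)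
        also have "1 - r\<^sup>2 = (1 + r) * (1 - r)" by (simp add: power2_eq_square algebra_simps)
        finally show ?thesis using r by (simp add: power2_eq_square)
      qed
      then have "a * ((1 + r) / (1 - r)) \<le> (1 - (norm (f (\<gamma> r)))\<^sup>2) / D\<^sup>2"
        using a(2)[OF \<gamma>1] by (simp add: Re_cayley[OF \<tau>] D_def)
      then have "a * (1 + r) * D * D \<le> (1 - (norm (f (\<gamma> r)))\<^sup>2) * (1 - r)"
        using r D by (simp add: divide_simps power2_eq_square mult_ac split: if_splits)
      also have "\<dots> \<le> (2 * (1 - norm (f (\<gamma> r)))) * (1 - r)"
      proof (rule mult_right_mono)
        have "(1 - (norm (f (\<gamma> r)))\<^sup>2) = (1 + norm (f (\<gamma> r))) * (1 - norm (f (\<gamma> r)))" by (simp add: power2_eq_square algebra_simps)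
        also have "\<dots> \<le> 2 * (1 - norm (f (\<gamma> r)))" by (rule mult_right_mono) (use f1 in auto)
        finally show "1 - (norm (f (\<gamma> r)))\<^sup>2 \<le> 2 * (1 - norm (f (\<gamma> r)))" .
      qed (use r in simp)
      finally have B: "a * (1 + r) * D * D \<le> 2 * (1 - norm (f (\<gamma> r))) * (1 - r)" .
      have "(1 - r) * D < a * (1 + r) * D * D" using A D by (rule mult_strict_right_mono)
      then have "D * (1 - r) < 2 * (1 - norm (f (\<gamma> r))) * (1 - r)" using B by (simp add: mult.commute)
      then have "D < 2 * (1 - norm (f (\<gamma> r)))" using r by (simp add: mult_less_cancel_right)
      then show ?case using f1 \<tau> unfolding stolz_region_def D_def by (auto simp: norm_minus_commute)
    qed
  qed
  from has_angular_limit_radial[OF b(1) this]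
  have gq: "((\<lambda>r. (g (f (\<gamma> r)) - \<tau>) / (f (\<gamma> r) - \<tau>)) \<longlongrightarrow> of_real (1 / b)) (at_left 1)"
    by simp
  have "((\<lambda>r. (g (f (\<gamma> r)) - \<tau>) / (f (\<gamma> r) - \<tau>) * ((f (\<gamma> r) - \<tau>) / (\<gamma> r - \<tau>))) \<longlongrightarrow> of_real (1 / b) * of_real (1 / a)) (at_left 1)"
    by (rule tendsto_mult[OF gq fq])
  moreover have "\<forall>\<^sub>F r in at_left 1. (g (f (\<gamma> r)) - \<tau>) / (f (\<gamma> r) - \<tau>) * ((f (\<gamma> r) - \<tau>) / (\<gamma> r - \<tau>)) = (h (\<gamma> r) - \<tau>) / (\<gamma> r - \<tau>)"
    using ev
  proof eventually_elim
    case (elim r)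
    have \<gamma>1: "norm (\<gamma> r) < 1" using \<gamma>n(1)[of r] elim by simp
    have "f (\<gamma> r) \<noteq> \<tau>" using self_map_norm_less[OF f(1) \<gamma>1] \<tau> by auto
    then show ?case using comp[OF \<gamma>1] by simp
  qed
  ultimately have "((\<lambda>r. (h (\<gamma> r) - \<tau>) / (\<gamma> r - \<tau>)) \<longlongrightarrow> of_real (1 / b) * of_real (1 / a)) (at_left 1)"
    by (rule Lim_transform_eventually)
  then have "of_real (1 / c) = (of_real (1 / b) * of_real (1 / a) :: complex)"
    using hq tendsto_unique[of "at_left (1::real)"] trivial_limit_at_left_real by metis
  then show ?thesis using a(4) b(2) c(2) by simp
qed

section \<open>Displacement and multiplier at a boundary fixed point\<close>

text \<open>The transform of \<open>0\<close> is \<open>1\<close>, so that of \<open>f 0\<close> has real part at least \<open>c\<close> and therefore lies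
at distance at least \<open>c - 1\<close> from \<open>1\<close>; transforming back gives \<open>\<bar>f 0\<bar> \<ge> (c - 1) / (c + 1)\<close>.\<close>

lemma boundary_multiplier_le_displacement:
  assumes f: "holomorphic_self_map f" and \<tau>: "norm \<tau> = 1" and c: "c \<ge> 1"
    and dom: "c * Re (cayley \<tau> 0) \<le> Re (cayley \<tau> (f 0))"
  shows "1 - 1 / c \<le> 2 * norm (f 0)"
proof -
  have f0: "norm (f 0) < 1" by (rule self_map_norm_less[OF f]) simp
  define F where "F = cayley \<tau> (f 0)"
  have ne: "\<tau> - f 0 \<noteq> 0" by (rule boundary_point_neq[OF \<tau> f0])
  have t: "cayley \<tau> 0 = 1" using \<tau> by (auto simp: cayley_def)
  have ReF: "c \<le> Re F" using dom by (simp add: F_def t)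
  have "F * (\<tau> - f 0) = \<tau> + f 0" using ne by (simp add: F_def cayley_def)
  then have "f 0 * (F + 1) = \<tau> * (F - 1)" by (simp add: algebra_simps)
  then have "norm (f 0) * norm (F + 1) = norm (F - 1)" using \<tau> by (metis mult_1 norm_mult)
  moreover have "norm (F + 1) \<le> norm (F - 1) + 2" using norm_triangle_ineq[of "F - 1" 2] by (simp add: add.commute)
  then have "norm (f 0) * norm (F + 1) \<le> norm (f 0) * (norm (F - 1) + 2)" by (rule mult_left_mono) simp
  ultimately have "norm (F - 1) * (1 - norm (f 0)) \<le> 2 * norm (f 0)" by (simp add: algebra_simps)
  moreover have "c - 1 \<le> norm (F - 1)" using ReF complex_Re_le_cmod[of "F - 1"] by simp
  then have "(c - 1) * (1 - norm (f 0)) \<le> norm (F - 1) * (1 - norm (f 0))" using f0 by (intro mult_right_mono) auto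
  ultimately have "c - 1 \<le> norm (f 0) * (c + 1)" by (simp add: algebra_simps)
  also have "\<dots> \<le> norm (f 0) * (2 * c)" using c by (intro mult_left_mono) auto
  finally show ?thesis using c by (simp add: field_simps)
qed

text \<open>In the half-plane the displacement is \<open>p + (c - 1) * cayley\<close> with \<open>p\<close> of nonnegative real
part. Harnack's inequality bounds \<open>p z\<close> by \<open>p w\<close>, and \<open>p w\<close> is the displacement at \<open>w\<close> up to
the second term. Passing to the half-plane multiplies distances by a bounded factor on the
disc of radius \<open>r\<close>, and passing back does so everywhere.\<close>

lemma boundary_displacement_bound:
  assumes \<tau>: "norm \<tau> = 1" and r: "r < 1"
  obtains C where "C \<ge> 0" "\<And>f c z w. holomorphic_self_map f \<Longrightarrow> c \<ge> 1 \<Longrightarrow>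
     (\<And>z. norm z < 1 \<Longrightarrow> c * Re (cayley \<tau> z) \<le> Re (cayley \<tau> (f z))) \<Longrightarrow>
     norm z \<le> r \<Longrightarrow> norm w \<le> r \<Longrightarrow> norm (f w) \<le> r \<Longrightarrow>
     norm (f z - z) \<le> C * (norm (f w - w) + (c - 1))"
proof -
  define K where "K = 1 + 16 / (1 - r\<^sup>2)\<^sup>2"
  have K: "K \<ge> 0" unfolding K_def by (simp add: add_nonneg_nonneg)
  define C where "C = 4 * K / (1 - r)\<^sup>2 + 4 * (K + 1) / (1 - r)"
  show ?thesis
  proof (rule that[of C])
    show "C \<ge> 0" using K r by (simp add: C_def)
    fix f and c :: real and z w :: complex
    assume f: "holomorphic_self_map f" and c: "c \<ge> 1"
      and dom: "\<And>z. norm z < 1 \<Longrightarrow> c * Re (cayley \<tau> z) \<le> Re (cayley \<tau> (f z))"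
      and z: "norm z \<le> r" and w: "norm w \<le> r" and fw: "norm (f w) \<le> r"
    have lt: "norm z < 1" "norm w < 1" "norm (f w) < 1" using z w fw r by auto
    have fz: "norm (f z) < 1" by (rule self_map_norm_less[OF f lt(1)])
    have up: "norm (\<tau> - a) \<le> 2" if "norm a < 1" for a using norm_triangle_ineq4[of \<tau> a] that \<tau> by simp
    have low: "1 - r \<le> norm (\<tau> - a)" if "norm a \<le> r" for a using norm_triangle_ineq2[of \<tau> a] that \<tau> by simp
    define p where "p = (\<lambda>z. cayley \<tau> (f z) - of_real c * cayley \<tau> z)"
    have cf: "(cayley \<tau> \<circ> f) holomorphic_on ball 0 1"
      by (rule holomorphic_on_compose_gen[OF _ cayley_holomorphic[OF \<tau>]]) (use f in \<open>auto simp: holomorphic_self_map_def\<close>)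
    then have p: "p holomorphic_on ball 0 1" unfolding p_def
      by (intro holomorphic_intros cayley_holomorphic[OF \<tau>]) (simp add: o_def)
    have Rep: "0 \<le> Re (p z)" if "norm z < 1" for z using dom[OF that] by (simp add: p_def)
    have cay: "norm (cayley \<tau> a) \<le> 2 / (1 - r)" if "norm a \<le> r" for a
    proof -
      have "norm (\<tau> + a) \<le> 2" using norm_triangle_ineq[of \<tau> a] that \<tau> r by simp
      then show ?thesis unfolding cayley_def norm_divide by (intro frac_le low[OF that]) (use r in auto)
    qed
    define B where "B = (c - 1) * (2 / (1 - r))"
    have diff: "cayley \<tau> (f a) - cayley \<tau> a = p a + of_real (c - 1) * cayley \<tau> a" for a
      by (simp add: p_def algebra_simps)
    have cB: "norm (of_real (c - 1) * cayley \<tau> a) \<le> B" if "norm a \<le> r" for a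
    proof -
      have "norm (of_real (c - 1) * cayley \<tau> a) = (c - 1) * norm (cayley \<tau> a)"
        unfolding norm_mult norm_of_real using c by simp
      also have "\<dots> \<le> B" unfolding B_def by (rule mult_left_mono[OF cay[OF that]]) (use c in simp)
      finally show ?thesis .
    qed
    have 1: "norm (cayley \<tau> (f w) - cayley \<tau> w) \<le> 2 * norm (f w - w) / (1 - r)\<^sup>2"
    proof -
      have "norm (cayley \<tau> (f w) - cayley \<tau> w) * ((1 - r) * (1 - r)) \<le> norm (cayley \<tau> (f w) - cayley \<tau> w) * (norm (\<tau> - f w) * norm (\<tau> - w))"
        by (intro mult_left_mono mult_mono low w fw) (use r in auto)
      also have "\<dots> = 2 * norm (f w - w)" by (rule norm_cayley_diff[OF \<tau> lt(3,2)])
      finally show ?thesis using r by (simp add: pos_le_divide_eq power2_eq_square)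
    qed
    define A where "A = 2 * norm (f w - w) / (1 - r)\<^sup>2 + B"
    have 2: "norm (p w) \<le> A"
    proof -
      have "p w = (cayley \<tau> (f w) - cayley \<tau> w) - of_real (c - 1) * cayley \<tau> w" using diff[of w] by simp
      then have "norm (p w) \<le> norm (cayley \<tau> (f w) - cayley \<tau> w) + norm (of_real (c - 1) * cayley \<tau> w)"
        by (metis norm_triangle_ineq4)
      then show ?thesis unfolding A_def using 1 cB[OF w] by linarith
    qed
    have 3: "norm (p z) \<le> K * norm (p w)" unfolding K_def by (rule harnack_norm[OF p Rep r w z])
    have 4: "norm (cayley \<tau> (f z) - cayley \<tau> z) \<le> norm (p z) + B"
      unfolding diff using norm_triangle_ineq[of "p z" "of_real (c - 1) * cayley \<tau> z"] cB[OF z] by linarith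
    have "2 * norm (f z - z) = norm (cayley \<tau> (f z) - cayley \<tau> z) * (norm (\<tau> - f z) * norm (\<tau> - z))"
      by (rule norm_cayley_diff[OF \<tau> fz lt(1), symmetric])
    also have "\<dots> \<le> norm (cayley \<tau> (f z) - cayley \<tau> z) * (2 * 2)"
      by (intro mult_left_mono mult_mono up fz lt) auto
    finally have "norm (f z - z) \<le> 2 * norm (cayley \<tau> (f z) - cayley \<tau> z)" by simp
    also have "\<dots> \<le> 2 * (K * A + B)"
      by (rule mult_left_mono[OF order_trans[OF 4 add_right_mono[OF order_trans[OF 3 mult_left_mono[OF 2 K]]]]]) simp
    also have "\<dots> = 4 * K / (1 - r)\<^sup>2 * norm (f w - w) + 4 * (K + 1) / (1 - r) * (c - 1)"
      by (simp add: A_def B_def algebra_simps add_divide_distrib diff_divide_distrib)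
    also have "\<dots> \<le> C * norm (f w - w) + C * (c - 1)"
      unfolding C_def using K r c by (intro add_mono mult_right_mono) auto
    finally show "norm (f z - z) \<le> C * (norm (f w - w) + (c - 1))" by (simp add: algebra_simps)
  qed
qed

section \<open>Evolution families\<close>

lemma Lp_incrementsE:
  assumes "Lp_increments d \<phi> z" "T > 0"
  obtains k :: "real \<Rightarrow> real" where "\<And>\<xi>. \<xi> \<in> {0..T} \<Longrightarrow> 0 \<le> k \<xi>" "Lp_on d {0..T} k"
    "\<And>s u t. 0 \<le> s \<Longrightarrow> s \<le> u \<Longrightarrow> u \<le> t \<Longrightarrow> t \<le> T \<Longrightarrow> norm (\<phi> s u z - \<phi> s t z) \<le> (LINT \<xi>:{u..t}|lebesgue. k \<xi>)"
proof -
  from assms(1)[unfolded Lp_increments_def, THEN spec, THEN mp, OF assms(2)]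
  obtain k :: "real \<Rightarrow> real" where k: "\<forall>\<xi>\<in>{0..T}. 0 \<le> k \<xi>" "Lp_on d {0..T} k"
    "\<forall>s u t. 0 \<le> s \<and> s \<le> u \<and> u \<le> t \<and> t \<le> T \<longrightarrow> norm (\<phi> s u z - \<phi> s t z) \<le> (LINT \<xi>:{u..t}|lebesgue. k \<xi>)"
    by (elim exE conjE)
  show ?thesis by (rule that[of k]) (use k in simp_all)
qed

lemma Lp_increments_of_bounds:
  assumes d: "1 \<le> d"
    and ex: "\<And>T. T > 0 \<Longrightarrow> \<exists>C k l. 0 \<le> C \<and> (\<forall>\<xi>\<in>{0..T}. 0 \<le> k \<xi> \<and> 0 \<le> l \<xi>) \<and> Lp_on d {0..T} k \<and> Lp_on d {0..T} l \<and>
      (\<forall>s u t. 0 \<le> s \<and> s \<le> u \<and> u \<le> t \<and> t \<le> T \<longrightarrow>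
         norm (\<phi> s u z - \<phi> s t z) \<le> C * ((LINT \<xi>:{u..t}|lebesgue. (k \<xi> :: real)) + (LINT \<xi>:{u..t}|lebesgue. (l \<xi> :: real))))"
  shows "Lp_increments d \<phi> z"
  unfolding Lp_increments_def
proof (intro allI impI)
  fix T :: real assume T: "0 < T"
  obtain C and k l :: "real \<Rightarrow> real" where C: "0 \<le> C" and kl: "\<forall>\<xi>\<in>{0..T}. 0 \<le> k \<xi> \<and> 0 \<le> l \<xi>" "Lp_on d {0..T} k" "Lp_on d {0..T} l"
    and b: "\<forall>s u t. 0 \<le> s \<and> s \<le> u \<and> u \<le> t \<and> t \<le> T \<longrightarrow>
         norm (\<phi> s u z - \<phi> s t z) \<le> C * ((LINT \<xi>:{u..t}|lebesgue. k \<xi>) + (LINT \<xi>:{u..t}|lebesgue. l \<xi>))"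
    using ex[OF T] by blast
  have int: "set_integrable lebesgue {0..T} k" "set_integrable lebesgue {0..T} l"
    using kl by (auto intro!: Lp_on_imp_set_integrable[OF d])
  show "\<exists>k. (\<forall>\<xi>\<in>{0..T}. 0 \<le> k \<xi>) \<and> Lp_on d {0..T} k \<and>
     (\<forall>s u t. 0 \<le> s \<and> s \<le> u \<and> u \<le> t \<and> t \<le> T \<longrightarrow> norm (\<phi> s u z - \<phi> s t z) \<le> (LINT \<xi>:{u..t}|lebesgue. k \<xi>))"
  proof (intro exI[of _ "\<lambda>\<xi>. C * (k \<xi> + l \<xi>)"] conjI ballI allI impI)
    show "0 \<le> C * (k \<xi> + l \<xi>)" if "\<xi> \<in> {0..T}" for \<xi> using kl(1) C that by simp
    show "Lp_on d {0..T} (\<lambda>\<xi>. C * (k \<xi> + l \<xi>))" by (rule Lp_on_lincomb[OF _ C kl(2,3)]) simp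
    fix s u t assume stu: "0 \<le> s \<and> s \<le> u \<and> u \<le> t \<and> t \<le> T"
    have sub: "{u..t} \<subseteq> {0..T}" using stu by auto
    have "set_integrable lebesgue {u..t} k" "set_integrable lebesgue {u..t} l"
      using set_integrable_subset[OF int(1) _ sub] set_integrable_subset[OF int(2) _ sub] by simp_all
    from set_integral_lincomb[OF this, of C] b[THEN spec, THEN spec, THEN spec, THEN mp, OF stu]
    show "norm (\<phi> s u z - \<phi> s t z) \<le> (LINT \<xi>:{u..t}|lebesgue. C * (k \<xi> + l \<xi>))" by (simp only:)
  qed
qed

text \<open>Taking \<open>s = u\<close> in the increment condition starts the orbit at the base point \<open>z\<close>, which does
not move with \<open>u\<close>; so one constant \<open>C\<close> serves all times.\<close>

lemma multiplier_regularity: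
  fixes \<mu> :: "real \<Rightarrow> complex"
  assumes d: "1 \<le> d" and incr: "Lp_increments d \<phi> z" and C: "C \<ge> 0" and id: "\<And>u. 0 \<le> u \<Longrightarrow> \<phi> u u z = z"
    and le: "\<And>u t. 0 \<le> u \<Longrightarrow> u \<le> t \<Longrightarrow> norm (\<mu> t - \<mu> u) \<le> C * norm (\<phi> u t z - z)"
  shows "locally_absolutely_continuous_on {0..} \<mu> \<and> Lp_loc_on d {0..} (\<lambda>t. vector_derivative \<mu> (at t within {0..}))"
proof -
  have *: "\<exists>k::real\<Rightarrow>real. (\<forall>\<xi>\<in>{0..T}. 0 \<le> k \<xi>) \<and> Lp_on d {0..T} k \<and>
       (\<forall>u t. 0 \<le> u \<and> u \<le> t \<and> t \<le> T \<longrightarrow> norm (\<mu> t - \<mu> u) \<le> (LINT \<xi>:{u..t}|lebesgue. k \<xi>))" if T: "T > 0" for T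
  proof -
    obtain k :: "real \<Rightarrow> real" where k: "\<And>\<xi>. \<xi> \<in> {0..T} \<Longrightarrow> 0 \<le> k \<xi>" "Lp_on d {0..T} k"
      and b: "\<And>s u t. 0 \<le> s \<Longrightarrow> s \<le> u \<Longrightarrow> u \<le> t \<Longrightarrow> t \<le> T \<Longrightarrow> norm (\<phi> s u z - \<phi> s t z) \<le> (LINT \<xi>:{u..t}|lebesgue. k \<xi>)"
      using Lp_incrementsE[OF incr T] by blast
    show ?thesis
    proof (intro exI[of _ "\<lambda>\<xi>. C/2 * (k \<xi> + k \<xi>)"] conjI ballI allI impI)
      show "0 \<le> C/2 * (k \<xi> + k \<xi>)" if "\<xi> \<in> {0..T}" for \<xi> using k(1)[OF that] C by simp
      show "Lp_on d {0..T} (\<lambda>\<xi>. C/2 * (k \<xi> + k \<xi>))" by (rule Lp_on_lincomb[OF _ _ k(2) k(2)]) (use C in simp_all)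
      fix u t assume ut: "0 \<le> u \<and> u \<le> t \<and> t \<le> T"
      have "norm (\<mu> t - \<mu> u) \<le> C * norm (\<phi> u t z - z)" using le ut by blast
      also have "\<dots> \<le> C * (LINT \<xi>:{u..t}|lebesgue. k \<xi>)"
        by (rule mult_left_mono[OF _ C]) (use b[of u u t] ut id[of u] in \<open>simp add: norm_minus_commute\<close>)
      also have "\<dots> = (LINT \<xi>:{u..t}|lebesgue. C/2 * (k \<xi> + k \<xi>))" by simp
      finally show "norm (\<mu> t - \<mu> u) \<le> (LINT \<xi>:{u..t}|lebesgue. C/2 * (k \<xi> + k \<xi>))" .
    qed
  qed
  show ?thesis using Lp_increments_imp_Lp_derivative[OF d *] by blast
qed

text \<open>Over time intervals shorter than some \<open>\<delta>\<close> the orbit of \<open>z0\<close> stays close to \<open>z0\<close>, because the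
integral of \<open>k\<close> over them is small. A longer time interval is composed of boundedly many
such steps, and each step maps compact sets into a compact set that is independent of the
map, by \<open>self_map_image_bound\<close>.\<close>

lemma orbit_stays_in_compact:
  assumes d: "1 \<le> d" and hol: "\<And>s t. 0 \<le> s \<Longrightarrow> s \<le> t \<Longrightarrow> holomorphic_self_map (\<phi> s t)"
    and id: "\<And>s z. 0 \<le> s \<Longrightarrow> z \<in> unit_disc \<Longrightarrow> \<phi> s s z = z"
    and comp: "\<And>s u t z. 0 \<le> s \<Longrightarrow> s \<le> u \<Longrightarrow> u \<le> t \<Longrightarrow> z \<in> unit_disc \<Longrightarrow> \<phi> s t z = \<phi> u t (\<phi> s u z)"
    and z0: "norm z0 < 1" and incr: "Lp_increments d \<phi> z0" and T: "T > 0"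
  obtains r where "r < 1" "\<And>s t. 0 \<le> s \<Longrightarrow> s \<le> t \<Longrightarrow> t \<le> T \<Longrightarrow> norm (\<phi> s t z0) \<le> r"
proof -
  obtain k :: "real \<Rightarrow> real" where k: "\<And>\<xi>. \<xi> \<in> {0..T} \<Longrightarrow> 0 \<le> k \<xi>" "Lp_on d {0..T} k"
    and b: "\<And>s u t. 0 \<le> s \<Longrightarrow> s \<le> u \<Longrightarrow> u \<le> t \<Longrightarrow> t \<le> T \<Longrightarrow> norm (\<phi> s u z0 - \<phi> s t z0) \<le> (LINT \<xi>:{u..t}|lebesgue. k \<xi>)"
    using Lp_incrementsE[OF incr T] by blast
  have ki: "set_integrable lebesgue {0..T} k" by (rule Lp_on_imp_set_integrable[OF d _ k(2)]) simp
  define r0 where "r0 = (1 + norm z0) / 2"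
  have r0: "r0 < 1" "norm z0 \<le> r0" using z0 by (simp_all add: r0_def)
  have e0: "(1 - norm z0) / 2 > 0" using z0 by simp
  obtain \<delta> where \<delta>: "\<delta> > 0" "\<And>A. A \<in> lmeasurable \<Longrightarrow> A \<subseteq> {0..T} \<Longrightarrow> measure lebesgue A < \<delta> \<Longrightarrow> (LINT x:A|lebesgue. k x) < (1 - norm z0) / 2"
    using set_integral_uniformly_small[OF ki k(1) e0] by metis
  have short: "norm (\<phi> s t z0) \<le> r0" if st: "0 \<le> s" "s \<le> t" "t \<le> T" "t - s < \<delta>" for s t
  proof -
    have "norm (\<phi> s s z0 - \<phi> s t z0) \<le> (LINT \<xi>:{s..t}|lebesgue. k \<xi>)" by (rule b) (use st in auto)
    also have "\<dots> < (1 - norm z0) / 2" by (rule \<delta>(2)) (use st in auto)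
    finally have "norm (z0 - \<phi> s t z0) < (1 - norm z0) / 2" using id[of s z0] st z0 by simp
    then have "norm (\<phi> s t z0) \<le> norm z0 + (1 - norm z0) / 2"
      using norm_triangle_ineq2[of "\<phi> s t z0" z0] norm_minus_commute[of z0 "\<phi> s t z0"] by linarith
    then show ?thesis by (simp add: r0_def field_simps)
  qed
  have steps: "\<exists>r<1. \<forall>s t. 0 \<le> s \<and> s \<le> t \<and> t \<le> T \<and> t - s \<le> real n * (\<delta> / 2) \<longrightarrow> norm (\<phi> s t z0) \<le> r" for n
  proof (induction n)
    case 0
    show ?case
    proof (intro exI[of _ r0] conjI allI impI r0)
      fix s t assume "0 \<le> s \<and> s \<le> t \<and> t \<le> T \<and> t - s \<le> real 0 * (\<delta> / 2)"
      then show "norm (\<phi> s t z0) \<le> r0" using short[of s t] \<delta>(1) by simp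
    qed
  next
    case (Suc n)
    then obtain r where r: "r < 1" "\<And>s t. 0 \<le> s \<and> s \<le> t \<and> t \<le> T \<and> t - s \<le> real n * (\<delta> / 2) \<Longrightarrow> norm (\<phi> s t z0) \<le> r" by blast
    obtain R where R: "R < 1" "\<And>f z w. holomorphic_self_map f \<Longrightarrow> norm z \<le> max r r0 \<Longrightarrow> norm w \<le> max r r0 \<Longrightarrow> norm (f w) \<le> max r r0 \<Longrightarrow> norm (f z) \<le> R"
      using self_map_image_bound[of "max r r0"] r(1) r0(1) by (metis max_less_iff_conj)
    show ?case
    proof (intro exI[of _ R] conjI allI impI R(1))
      fix s t assume st: "0 \<le> s \<and> s \<le> t \<and> t \<le> T \<and> t - s \<le> real (Suc n) * (\<delta> / 2)"
      \<comment> \<open>The last step has length at most \<open>\<delta> / 2\<close>; the maximum covers the case of a short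
        interval.\<close>
      define v where "v = max s (t - \<delta> / 2)"
      have v: "0 \<le> v" "s \<le> v" "v \<le> t" "t - v < \<delta>" using st \<delta>(1) by (auto simp: v_def)
      have "v - s \<le> real n * (\<delta> / 2)" using st \<delta>(1) by (auto simp: v_def max_def algebra_simps)
      then have "norm (\<phi> s v z0) \<le> max r r0" using r(2)[of s v] st v by (simp add: le_max_iff_disj)
      moreover have "norm (\<phi> v t z0) \<le> max r r0" using short[of v t] st v by (simp add: le_max_iff_disj)
      moreover have "\<phi> s t z0 = \<phi> v t (\<phi> s v z0)" by (rule comp) (use st v z0 in auto)
      ultimately show "norm (\<phi> s t z0) \<le> R"
        using R(2)[OF hol[OF v(1) v(3)], of "\<phi> s v z0" z0] r0(2) by (simp add: le_max_iff_disj)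
    qed
  qed
  obtain n :: nat where n: "T / (\<delta> / 2) \<le> real n" using real_arch_simple by blast
  then have Tn: "T \<le> real n * (\<delta> / 2)" using \<delta>(1) by (simp add: divide_le_eq)
  obtain r where r: "r < 1" "\<forall>s t. 0 \<le> s \<and> s \<le> t \<and> t \<le> T \<and> t - s \<le> real n * (\<delta> / 2) \<longrightarrow> norm (\<phi> s t z0) \<le> r"
    using steps[of n] by blast
  show ?thesis
  proof (rule that[OF r(1)])
    fix s t assume "0 \<le> s" "s \<le> t" "t \<le> T"
    then show "norm (\<phi> s t z0) \<le> r" using r(2)[rule_format, of s t] Tn by simp
  qed
qed

lemma Denjoy_Wolff_interior_fixed:
  assumes "is_Denjoy_Wolff_point f \<tau>" "norm \<tau> < 1"
  shows "f \<tau> = \<tau>"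
proof (cases "\<exists>z\<in>unit_disc. f z = z")
  case True
  then show ?thesis using assms(1) unfolding is_Denjoy_Wolff_point_def by (simp only: if_True)
next
  case False
  then have "\<tau> \<in> sphere 0 1" using assms(1) unfolding is_Denjoy_Wolff_point_def by (simp only: if_False)
  then show ?thesis using assms(2) by simp
qed

theorem theorem7p3:
  fixes d :: ennreal
    and \<phi> :: "real \<Rightarrow> real \<Rightarrow> complex \<Rightarrow> complex"
    and \<tau> :: complex
    and \<mu> :: "real \<Rightarrow> complex"
  defines "\<mu> \<equiv> \<lambda>t. deriv_at_DW (\<phi> 0 t) \<tau>"
  assumes "1 \<le> d"
    and "\<And>s t. 0 \<le> s \<Longrightarrow> s \<le> t \<Longrightarrow> holomorphic_self_map (\<phi> s t)"
    and "\<tau> \<in> cball 0 1"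
    and "\<And>s t. 0 \<le> s \<Longrightarrow> s \<le> t \<Longrightarrow> \<exists>z\<in>unit_disc. \<phi> s t z \<noteq> z \<Longrightarrow>
           is_Denjoy_Wolff_point (\<phi> s t) \<tau>"
    and "\<And>s z. 0 \<le> s \<Longrightarrow> z \<in> unit_disc \<Longrightarrow> \<phi> s s z = z"
    and "\<And>s u t z. 0 \<le> s \<Longrightarrow> s \<le> u \<Longrightarrow> u \<le> t \<Longrightarrow> z \<in> unit_disc \<Longrightarrow>
           \<phi> s t z = \<phi> u t (\<phi> s u z)"
    and "\<And>t. 0 \<le> t \<Longrightarrow> deriv_at_DW (\<phi> 0 t) \<tau> \<noteq> 0"
  shows "evolution_family d \<phi> \<longleftrightarrow>
    (locally_absolutely_continuous_on {0..} \<mu> \<and>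
     Lp_loc_on d {0..} (\<lambda>t. vector_derivative \<mu> (at t within {0..}))) \<and>
    (\<tau> \<in> sphere 0 1 \<longrightarrow> (\<exists>z\<^sub>0\<in>unit_disc. Lp_increments d \<phi> z\<^sub>0))"
    (is "_ \<longleftrightarrow> ?reg \<and> ?bd")
proof -
  note d = assms(2) and hol = assms(3) and dw = assms(5) and id = assms(6) and comp = assms(7)
  have mu0: "\<mu> t \<noteq> 0" if "0 \<le> t" for t using assms(8)[OF that] by (simp add: \<mu>_def)
  have EF: "evolution_family d \<phi> \<longleftrightarrow> (\<forall>z\<in>unit_disc. Lp_increments d \<phi> z)"
    unfolding evolution_family_def using hol id comp by blast
  have self: "norm (\<phi> s t z) < 1" if "0 \<le> s" "s \<le> t" "norm z < 1" for s t z
    by (rule self_map_norm_less[OF hol[OF that(1,2)] that(3)])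
  have mu_incr: "norm (\<mu> t - \<mu> u) \<le> (LINT \<xi>:{u..t}|lebesgue. norm (vector_derivative \<mu> (at \<xi> within {0..})))"
    if "?reg" "0 \<le> u" "u \<le> t" for u t
    using Lp_derivative_imp_increment_bound[OF d] that by blast
  have mu_Lp: "Lp_on d {0..T} (\<lambda>\<xi>. norm (vector_derivative \<mu> (at \<xi> within {0..})))" if "?reg" for T
  proof -
    have "Lp_on d {0..T} (\<lambda>t. vector_derivative \<mu> (at t within {0..}))"
      using that unfolding Lp_loc_on_def by simp
    then show ?thesis by (rule Lp_on_norm)
  qed
  consider (interior) "norm \<tau> < 1" | (boundary) "norm \<tau> = 1" 
    using assms(4) by (auto simp: le_less)
  then show ?thesis
  proof cases
    case interior
    have fixp: "\<phi> s t \<tau> = \<tau>" if "0 \<le> s" "s \<le> t" for s t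
    proof (cases "\<exists>z\<in>unit_disc. \<phi> s t z \<noteq> z")
      case True
      from dw[OF that this] show ?thesis by (rule Denjoy_Wolff_interior_fixed[OF _ interior])
    next
      case False
      then have "\<forall>z\<in>unit_disc. \<phi> s t z = z" by (simp only: bex_simps not_not)
      then show ?thesis by (rule bspec) (use interior in simp)
    qed
    have mu: "\<mu> t = deriv (\<phi> 0 t) \<tau>" for t using interior by (simp add: \<mu>_def deriv_at_DW_def)
    have chain: "\<mu> t = deriv (\<phi> u t) \<tau> * \<mu> u" if "0 \<le> u" "u \<le> t" for u t
      unfolding mu
    proof (rule deriv_compose_fixed_point[OF hol[OF order_refl that(1)] hol[OF that] _ interior fixp[OF order_refl that(1)]])
      show "\<phi> 0 t z = \<phi> u t (\<phi> 0 u z)" if "norm z < 1" for z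
        by (rule comp[OF order_refl \<open>0 \<le> u\<close> \<open>u \<le> t\<close>]) (use that in simp)
    qed
    have der1: "norm (deriv (\<phi> u t) \<tau>) \<le> 1" if ut: "0 \<le> u" "u \<le> t" for u t
      using self_map_fixing_point[OF hol[OF ut] interior fixp[OF ut]] by metis
    have "?reg" if "evolution_family d \<phi>"
    proof -
      \<comment> \<open>Any base point other than \<open>\<tau>\<close> would do; at \<open>\<tau>\<close> itself the displacement vanishes.\<close>
      define z0 :: complex where "z0 = (if \<tau> = 0 then 1/2 else 0)"
      have z0: "norm z0 < 1" "z0 \<noteq> \<tau>" by (auto simp: z0_def)
      obtain C where C: "C \<ge> 0" "\<And>f. holomorphic_self_map f \<Longrightarrow> f \<tau> = \<tau> \<Longrightarrow> norm (deriv f \<tau> - 1) \<le> C * norm (f z0 - z0)"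
        using interior_derivative_le_displacement[OF interior z0] by metis
      show ?thesis
      proof (rule multiplier_regularity[OF d _ C(1)])
        show "Lp_increments d \<phi> z0" using that EF z0 by simp
        show "\<phi> u u z0 = z0" if "0 \<le> u" for u using id[OF that] z0 by simp
        fix u t :: real assume ut: "0 \<le> u" "u \<le> t"
        have "\<mu> t - \<mu> u = (deriv (\<phi> u t) \<tau> - 1) * \<mu> u" using chain[OF ut] by (simp add: algebra_simps)
        then have "norm (\<mu> t - \<mu> u) = norm (deriv (\<phi> u t) \<tau> - 1) * norm (\<mu> u)" by (simp add: norm_mult)
        also have "\<dots> \<le> norm (deriv (\<phi> u t) \<tau> - 1) * 1"
          by (rule mult_left_mono) (use der1[of 0 u] ut mu in auto)
        also have "\<dots> \<le> C * norm (\<phi> u t z0 - z0)" using C(2)[OF hol[OF ut] fixp[OF ut]] by simp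
        finally show "norm (\<mu> t - \<mu> u) \<le> C * norm (\<phi> u t z0 - z0)" .
      qed
    qed
    moreover have "Lp_increments d \<phi> z" if reg: "?reg" and z: "z \<in> unit_disc" for z
    proof (rule Lp_increments_of_bounds[OF d])
      fix T :: real assume T: "T > 0"
      define r where "r = norm (moebius \<tau> z)"
      have r: "r < 1" unfolding r_def by (rule Moebius_function_norm_lt_1[OF interior]) (use z in simp)
      obtain C where C: "C \<ge> 0" "\<And>f z. holomorphic_self_map f \<Longrightarrow> f \<tau> = \<tau> \<Longrightarrow> norm z < 1 \<Longrightarrow>
         norm (moebius \<tau> z) \<le> r \<Longrightarrow> norm (f z - z) \<le> C * norm (deriv f \<tau> - 1)"
        using interior_displacement_le_derivative[OF interior r] by metis
      let ?l = "\<lambda>\<xi>. norm (vector_derivative \<mu> (at \<xi> within {0..}))"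
      have muT: "norm (\<mu> T) > 0" using mu0 T by simp
      show "\<exists>C k l. 0 \<le> C \<and> (\<forall>\<xi>\<in>{0..T}. 0 \<le> k \<xi> \<and> 0 \<le> l \<xi>) \<and> Lp_on d {0..T} k \<and> Lp_on d {0..T} l \<and>
        (\<forall>s u t. 0 \<le> s \<and> s \<le> u \<and> u \<le> t \<and> t \<le> T \<longrightarrow>
         norm (\<phi> s u z - \<phi> s t z) \<le> C * ((LINT \<xi>:{u..t}|lebesgue. (k \<xi> :: real)) + (LINT \<xi>:{u..t}|lebesgue. (l \<xi> :: real))))"
      proof (rule exI[of _ "C / norm (\<mu> T)"], rule exI[of _ ?l], rule exI[of _ ?l], intro conjI ballI allI impI)
        show "0 \<le> C / norm (\<mu> T)" using C(1) by simp
        show "Lp_on d {0..T} ?l" "Lp_on d {0..T} ?l" using mu_Lp[OF reg] by simp_all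
        fix s u t assume "0 \<le> s \<and> s \<le> u \<and> u \<le> t \<and> t \<le> T"
        then have stu: "0 \<le> s" "s \<le> u" "u \<le> t" "t \<le> T" "0 \<le> u" "u \<le> T" by auto
        define w where "w = \<phi> s u z"
        have w: "norm w < 1" unfolding w_def by (rule self[OF stu(1,2)]) (use z in simp)
        have "norm (moebius (\<phi> s u \<tau>) (\<phi> s u z)) \<le> norm (moebius \<tau> z)"
          by (rule schwarz_pick[OF hol[OF stu(1,2)] interior]) (use z in simp)
        then have wr: "norm (moebius \<tau> w) \<le> r" using fixp[OF stu(1,2)] by (simp add: w_def r_def)
        have L0: "norm (\<mu> t - \<mu> u) \<le> (LINT \<xi>:{u..t}|lebesgue. ?l \<xi>)" by (rule mu_incr[OF reg stu(5,3)])
        have "\<mu> T = deriv (\<phi> u T) \<tau> * \<mu> u" by (rule chain[OF stu(5,6)])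
        then have muu: "norm (\<mu> T) \<le> norm (\<mu> u)"
          using mult_right_mono[OF der1[OF stu(5,6)], of "norm (\<mu> u)"] by (simp add: norm_mult)
        have "\<mu> t - \<mu> u = (deriv (\<phi> u t) \<tau> - 1) * \<mu> u" using chain[OF stu(5,3)] by (simp add: algebra_simps)
        then have "norm (\<mu> t - \<mu> u) = norm (deriv (\<phi> u t) \<tau> - 1) * norm (\<mu> u)" by (simp add: norm_mult)
        then have "norm (deriv (\<phi> u t) \<tau> - 1) * norm (\<mu> T) \<le> norm (\<mu> t - \<mu> u)"
          using mult_left_mono[OF muu, of "norm (deriv (\<phi> u t) \<tau> - 1)"] by simp
        then have E: "norm (deriv (\<phi> u t) \<tau> - 1) \<le> norm (\<mu> t - \<mu> u) / norm (\<mu> T)"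
          using muT by (simp add: pos_le_divide_eq)
        have "norm (\<phi> s u z - \<phi> s t z) = norm (\<phi> u t w - w)"
          using comp[OF stu(1,2,3) z] by (simp add: w_def norm_minus_commute)
        also have "\<dots> \<le> C * norm (deriv (\<phi> u t) \<tau> - 1)" by (rule C(2)[OF hol[OF stu(5,3)] fixp[OF stu(5,3)] w wr])
        also have "\<dots> \<le> C * (norm (\<mu> t - \<mu> u) / norm (\<mu> T))" by (rule mult_left_mono[OF E C(1)])
        also have "\<dots> = C / norm (\<mu> T) * norm (\<mu> t - \<mu> u)" by simp
        also have "\<dots> \<le> C / norm (\<mu> T) * ((LINT \<xi>:{u..t}|lebesgue. ?l \<xi>) + (LINT \<xi>:{u..t}|lebesgue. ?l \<xi>))"
        proof (rule mult_left_mono)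
          show "norm (\<mu> t - \<mu> u) \<le> (LINT \<xi>:{u..t}|lebesgue. ?l \<xi>) + (LINT \<xi>:{u..t}|lebesgue. ?l \<xi>)"
            using L0 norm_ge_zero[of "\<mu> t - \<mu> u"] by linarith
        qed (use C(1) in simp)
        finally show "norm (\<phi> s u z - \<phi> s t z) \<le> C / norm (\<mu> T) * ((LINT \<xi>:{u..t}|lebesgue. ?l \<xi>) + (LINT \<xi>:{u..t}|lebesgue. ?l \<xi>))" .
      qed simp_all
    qed
    moreover have "?bd" using interior by simp
    ultimately show ?thesis unfolding EF by blast
  next
    case boundary
    have inv: "horocycle_invariant (\<phi> s t) \<tau>" if "0 \<le> s" "s \<le> t" for s t
      by (rule denjoy_wolff_horocycle_invariant[OF hol[OF that] boundary dw[OF that]])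
    have mu: "\<mu> t = angular_deriv (\<phi> 0 t) \<tau>" for t using boundary by (simp add: \<mu>_def deriv_at_DW_def)
    have mult: "\<exists>c\<ge>1. (\<forall>z. norm z < 1 \<longrightarrow> c * Re (cayley \<tau> z) \<le> Re (cayley \<tau> (\<phi> u t z))) \<and> \<mu> u = of_real c * \<mu> t"
      if ut: "0 \<le> u" "u \<le> t" for u t
    proof -
      have t0: "0 \<le> t" using ut by simp
      obtain c where c: "c \<ge> 1" "\<And>z. norm z < 1 \<Longrightarrow> c * Re (cayley \<tau> z) \<le> Re (cayley \<tau> (\<phi> u t z))"
        "angular_deriv (\<phi> u t) \<tau> = of_real (1 / c)"
        using julia_wolff_caratheodory[OF hol[OF ut] boundary inv[OF ut]] by metis
      have "\<mu> t = angular_deriv (\<phi> u t) \<tau> * \<mu> u" unfolding mu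
        by (rule angular_deriv_compose[OF hol[OF order_refl ut(1)] inv[OF order_refl ut(1)] hol[OF ut] inv[OF ut]
              hol[OF order_refl t0] inv[OF order_refl t0] _ boundary])
           (rule comp[OF order_refl ut], simp)
      then have "\<mu> u = of_real c * \<mu> t" using c(1,3) by simp
      then show ?thesis using c(1,2) by blast
    qed
    have mu_le: "norm (\<mu> t) \<le> norm (\<mu> u)" if ut: "0 \<le> u" "u \<le> t" for u t
    proof -
      obtain c where c: "c \<ge> 1" "\<mu> u = of_real c * \<mu> t" using mult[OF ut] by blast
      then have "norm (\<mu> u) = c * norm (\<mu> t)" by (simp add: norm_mult)
      then show ?thesis using c(1) mult_right_mono[OF c(1), of "norm (\<mu> t)"] by simp
    qed
    have mu1: "norm (\<mu> t) \<le> 1" if t0: "0 \<le> t" for t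
    proof -
      obtain c where "c \<ge> 1" "angular_deriv (\<phi> 0 t) \<tau> = of_real (1 / c)"
        using julia_wolff_caratheodory[OF hol[OF order_refl t0] boundary inv[OF order_refl t0]] by metis
      then show ?thesis unfolding mu by (simp add: norm_divide)
    qed
    have "?reg" if EFa: "evolution_family d \<phi>"
    proof (rule multiplier_regularity[OF d, of _ 0 2])
      show "Lp_increments d \<phi> 0" using EFa EF by simp
      show "\<phi> u u 0 = 0" if "0 \<le> u" for u using id[OF that] by simp
      fix u t :: real assume ut: "0 \<le> u" "u \<le> t"
      obtain c where c: "c \<ge> 1" "\<And>z. norm z < 1 \<Longrightarrow> c * Re (cayley \<tau> z) \<le> Re (cayley \<tau> (\<phi> u t z))"
        "\<mu> u = of_real c * \<mu> t" using mult[OF ut] by blast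
      have "1 - 1 / c \<le> 2 * norm (\<phi> u t 0)"
        by (rule boundary_multiplier_le_displacement[OF hol[OF ut] boundary c(1) c(2)]) simp
      moreover have "\<mu> t - \<mu> u = - (of_real (1 - 1 / c) * \<mu> u)" using c(1,3) by (simp add: field_simps)
      then have "norm (\<mu> t - \<mu> u) = \<bar>1 - 1 / c\<bar> * norm (\<mu> u)" by (simp only: norm_minus_cancel norm_mult norm_of_real)
      moreover have "\<bar>1 - 1 / c\<bar> * norm (\<mu> u) \<le> \<bar>1 - 1 / c\<bar> * 1" by (rule mult_left_mono[OF mu1[OF ut(1)]]) simp
      moreover have "\<bar>1 - 1 / c\<bar> = 1 - 1 / c" using c(1) by simp
      ultimately show "norm (\<mu> t - \<mu> u) \<le> 2 * norm (\<phi> u t 0 - 0)" by simp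
    qed simp
    moreover have "?bd" if "evolution_family d \<phi>"
      using that unfolding EF by (intro impI bexI[of _ 0]) auto
    moreover have "Lp_increments d \<phi> z" if reg: "?reg" and bd: "?bd" and z: "z \<in> unit_disc" for z
    proof -
      obtain z0 where z0: "norm z0 < 1" "Lp_increments d \<phi> z0" using bd boundary by auto
      show ?thesis
      proof (rule Lp_increments_of_bounds[OF d])
        fix T :: real assume T: "T > 0"
        obtain k :: "real \<Rightarrow> real" where k: "\<And>\<xi>. \<xi> \<in> {0..T} \<Longrightarrow> 0 \<le> k \<xi>" "Lp_on d {0..T} k"
          and kb: "\<And>s u t. 0 \<le> s \<Longrightarrow> s \<le> u \<Longrightarrow> u \<le> t \<Longrightarrow> t \<le> T \<Longrightarrow> norm (\<phi> s u z0 - \<phi> s t z0) \<le> (LINT \<xi>:{u..t}|lebesgue. k \<xi>)"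
          using Lp_incrementsE[OF z0(2) T] by blast
        obtain r1 where r1: "r1 < 1" "\<And>s t. 0 \<le> s \<Longrightarrow> s \<le> t \<Longrightarrow> t \<le> T \<Longrightarrow> norm (\<phi> s t z0) \<le> r1"
        proof (rule orbit_stays_in_compact[OF d _ _ _ z0 T])
          show "holomorphic_self_map (\<phi> s t)" if "0 \<le> s" "s \<le> t" for s t by (rule hol[OF that])
          show "\<phi> s s z = z" if "0 \<le> s" "z \<in> unit_disc" for s z by (rule id[OF that])
          show "\<phi> s t z = \<phi> u t (\<phi> s u z)" if "0 \<le> s" "s \<le> u" "u \<le> t" "z \<in> unit_disc" for s u t z
            by (rule comp[OF that])
        qed (rule that)
        \<comment> \<open>The orbit of \<open>z0\<close> stays in the disc of radius \<open>r1\<close>, hence that of \<open>z\<close> in the disc of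
          radius \<open>R\<close>.\<close>
        define r2 where "r2 = max r1 (max (norm z0) (norm z))"
        have r2: "r2 < 1" using r1 z0 z by (simp add: r2_def)
        obtain R where R: "R < 1" "\<And>f z w. holomorphic_self_map f \<Longrightarrow> norm z \<le> r2 \<Longrightarrow> norm w \<le> r2 \<Longrightarrow> norm (f w) \<le> r2 \<Longrightarrow> norm (f z) \<le> R"
          using self_map_image_bound[OF r2] by metis
        define r where "r = max r1 R"
        have r: "r < 1" using r1 R by (simp add: r_def)
        have orbit0: "norm (\<phi> s t z0) \<le> r" if "0 \<le> s" "s \<le> t" "t \<le> T" for s t
          using r1(2)[OF that] by (simp add: r_def)
        have orbit: "norm (\<phi> s t z) \<le> r" if st: "0 \<le> s" "s \<le> t" "t \<le> T" for s t
        proof -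
          have "norm (\<phi> s t z0) \<le> r2" using r1(2)[OF st] by (simp add: r2_def)
          then have "norm (\<phi> s t z) \<le> R" by (intro R(2)[OF hol[OF st(1,2)], of z z0]) (simp_all add: r2_def)
          then show ?thesis by (simp add: r_def)
        qed
        obtain C where C: "C \<ge> 0" "\<And>f c z w. holomorphic_self_map f \<Longrightarrow> c \<ge> 1 \<Longrightarrow>
           (\<And>z. norm z < 1 \<Longrightarrow> c * Re (cayley \<tau> z) \<le> Re (cayley \<tau> (f z))) \<Longrightarrow>
           norm z \<le> r \<Longrightarrow> norm w \<le> r \<Longrightarrow> norm (f w) \<le> r \<Longrightarrow>
           norm (f z - z) \<le> C * (norm (f w - w) + (c - 1))"
          using boundary_displacement_bound[OF boundary r] by metis
        let ?l = "\<lambda>\<xi>. norm (vector_derivative \<mu> (at \<xi> within {0..}))"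
        have muT: "norm (\<mu> T) > 0" using mu0 T by simp
        \<comment> \<open>\<open>\<bar>\<mu>\<bar>\<close> is decreasing, so \<open>c - 1 = \<bar>\<mu> u - \<mu> t\<bar> / \<bar>\<mu> t\<bar>\<close> is at most
          \<open>\<bar>\<mu> u - \<mu> t\<bar> / \<bar>\<mu> T\<bar>\<close>; \<open>A\<close> majorises this factor and \<open>1\<close>.\<close>
        define A where "A = 1 + 1 / norm (\<mu> T)"
        have A: "A \<ge> 1" "A \<ge> 1 / norm (\<mu> T)" using muT by (simp_all add: A_def)
        show "\<exists>C k l. 0 \<le> C \<and> (\<forall>\<xi>\<in>{0..T}. 0 \<le> k \<xi> \<and> 0 \<le> l \<xi>) \<and> Lp_on d {0..T} k \<and> Lp_on d {0..T} l \<and>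
          (\<forall>s u t. 0 \<le> s \<and> s \<le> u \<and> u \<le> t \<and> t \<le> T \<longrightarrow>
           norm (\<phi> s u z - \<phi> s t z) \<le> C * ((LINT \<xi>:{u..t}|lebesgue. (k \<xi> :: real)) + (LINT \<xi>:{u..t}|lebesgue. (l \<xi> :: real))))"
        proof (rule exI[of _ "C * A"], rule exI[of _ k], rule exI[of _ ?l], intro conjI ballI allI impI)
          show "0 \<le> C * A" using C(1) A by simp
          show "Lp_on d {0..T} ?l" by (rule mu_Lp[OF reg])
          fix s u t assume "0 \<le> s \<and> s \<le> u \<and> u \<le> t \<and> t \<le> T"
          then have stu: "0 \<le> s" "s \<le> u" "u \<le> t" "t \<le> T" "0 \<le> u" "u \<le> T" "s \<le> t" "0 \<le> t" by auto
          obtain c where c: "c \<ge> 1" "\<And>z. norm z < 1 \<Longrightarrow> c * Re (cayley \<tau> z) \<le> Re (cayley \<tau> (\<phi> u t z))"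
            "\<mu> u = of_real c * \<mu> t" using mult[OF stu(5,3)] by blast
          have L0: "norm (\<mu> t - \<mu> u) \<le> (LINT \<xi>:{u..t}|lebesgue. ?l \<xi>)" by (rule mu_incr[OF reg stu(5,3)])
          have K0: "norm (\<phi> s u z0 - \<phi> s t z0) \<le> (LINT \<xi>:{u..t}|lebesgue. k \<xi>)" by (rule kb[OF stu(1,2,3,4)])
          have "\<mu> u - \<mu> t = of_real (c - 1) * \<mu> t" using c(3) by (simp add: algebra_simps)
          then have "norm (\<mu> u - \<mu> t) = \<bar>c - 1\<bar> * norm (\<mu> t)" by (simp only: norm_mult norm_of_real)
          then have "(c - 1) * norm (\<mu> T) \<le> norm (\<mu> t - \<mu> u)"
            using mult_left_mono[OF mu_le[OF stu(8,4)], of "c - 1"] c(1) by (simp add: norm_minus_commute)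
          then have "c - 1 \<le> norm (\<mu> t - \<mu> u) * (1 / norm (\<mu> T))"
            using muT by (simp add: pos_le_divide_eq)
          also have "\<dots> \<le> norm (\<mu> t - \<mu> u) * A" by (rule mult_left_mono[OF A(2)]) simp
          also have "\<dots> \<le> (LINT \<xi>:{u..t}|lebesgue. ?l \<xi>) * A" by (rule mult_right_mono[OF L0]) (use A in simp)
          finally have c1: "c - 1 \<le> (LINT \<xi>:{u..t}|lebesgue. ?l \<xi>) * A" .
          have k0: "norm (\<phi> s t z0 - \<phi> s u z0) \<le> (LINT \<xi>:{u..t}|lebesgue. k \<xi>) * A"
          proof -
            have "norm (\<phi> s t z0 - \<phi> s u z0) * 1 \<le> (LINT \<xi>:{u..t}|lebesgue. k \<xi>) * A"
              using K0 A(1) by (intro mult_mono) (auto simp: norm_minus_commute intro: order_trans[OF norm_ge_zero])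
            then show ?thesis by simp
          qed
          have cz: "\<phi> s t z = \<phi> u t (\<phi> s u z)" by (rule comp[OF stu(1,2,3) z])
          have cz0: "\<phi> s t z0 = \<phi> u t (\<phi> s u z0)" by (rule comp[OF stu(1,2,3)]) (use z0 in simp)
          have "norm (\<phi> u t (\<phi> s u z) - \<phi> s u z) \<le> C * (norm (\<phi> u t (\<phi> s u z0) - \<phi> s u z0) + (c - 1))"
          proof (rule C(2)[OF hol[OF stu(5,3)] c(1) c(2)])
            show "norm (\<phi> s u z) \<le> r" "norm (\<phi> s u z0) \<le> r" by (rule orbit[OF stu(1,2,6)], rule orbit0[OF stu(1,2,6)])
            show "norm (\<phi> u t (\<phi> s u z0)) \<le> r" unfolding cz0[symmetric] by (rule orbit0[OF stu(1,7,4)])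
          qed
          then have "norm (\<phi> s t z - \<phi> s u z) \<le> C * (norm (\<phi> s t z0 - \<phi> s u z0) + (c - 1))"
            unfolding cz cz0 .
          also have "\<dots> \<le> C * ((LINT \<xi>:{u..t}|lebesgue. k \<xi>) * A + (LINT \<xi>:{u..t}|lebesgue. ?l \<xi>) * A)"
            by (rule mult_left_mono[OF add_mono[OF k0 c1] C(1)])
          also have "\<dots> = C * A * ((LINT \<xi>:{u..t}|lebesgue. k \<xi>) + (LINT \<xi>:{u..t}|lebesgue. ?l \<xi>))"
            by (simp add: algebra_simps)
          finally show "norm (\<phi> s u z - \<phi> s t z) \<le> C * A * ((LINT \<xi>:{u..t}|lebesgue. k \<xi>) + (LINT \<xi>:{u..t}|lebesgue. ?l \<xi>))"
            by (simp add: norm_minus_commute)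
        qed (use k in auto)
      qed
    qed
    ultimately show ?thesis unfolding EF by blast
  qed
qed

end
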